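(* Let $H$ be a separable real Hilbert space, let $Q$ be a positive, self-adjoint trace class operator on $H$, and let $(W(t): t\in[0,1])$ be a $Q$-Wiener process with values in $H$. For $\varepsilon\in(0,1]$ let $\mu_\varepsilon$ be the law of $\sqrt{\varepsilon}\,W$ on $C([0,1];H)$. Then $(\mu_\varepsilon)_{\varepsilon\in(0,1]}$ satisfies a large deviation principle on $(C([0,1];H),\lVert\cdot\rVert_\infty)$ with rate function $$I(F)=\inf\left\{\frac12\int_0^1\lVert U(s)\rVert_{H_0}^2\,ds:\ U\in L^2([0,1];H_0),\ F(\cdot)=\int_0^\cdot U(s)\,ds\right\},\qquad F\in C([0,1];H),$$ where $\inf\emptyset=\infty$.
   Context: $H$ is a separable real Hilbert space with inner product $\langle\cdot,\cdot\rangle$ and norm $\lVert\cdot\rVert_H$; $C([0,1];H)$ is the space of continuous functions $[0,1]\to H$ and $\lVert\cdot\rVert_\infty$ is the supremum norm. A random variable $X$ in $H$ is $\mathcal N(m,Q)$-distributed if $E[\exp(i\langle h,X\rangle)]=\exp(i\langle h,m\rangle-\tfrac12\langle Qh,h\rangle)$ for all $h\in H$. A $Q$-Wiener process is an $H$-valued stochastic process $(W(t):t\in[0,1])$ with $W(0)=0$, continuous trajectories, independent increments, and $W(t)-W(s)\sim\mathcal N(0,(t-s)Q)$ for $s\le t$. $H_0:=Q^{1/2}H$ with inner product $\langle x,y\rangle_{H_0}:=\langle Q^{-1/2}x,Q^{-1/2}y\rangle_H$ (if $Q$ is not injective, $Q^{-1/2}$ is the pseudo-inverse, i.e. $Q^{-1/2}x$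 is the preimage of $x$ under $Q^{1/2}$ that is orthogonal to $\ker Q^{1/2}$), and induced norm $\lVert\cdot\rVert_{H_0}$. $L^2([0,1];H_0)$ is the space of measurable $U:[0,1]\to H_0$ with $\int_0^1\lVert U(s)\rVert_{H_0}^2ds<\infty$. Large deviations: for a Hausdorff topological space $X$ with Borel $\sigma$-algebra $\mathcal B$, a rate function is a lower semicontinuous function $I:X\to[0,\infty]$ (i.e. all level sets $\{I\le C\}$, $C\ge0$, are closed). Write $I(A)=\inf_{x\in A}I(x)$. A family $(\mu_\varepsilon)$ of probability measures on $(X,\mathcal B)$ satisfies the large deviation principle (LDP) with rate function $I$ if $\limsup_{\varepsilon\to0}\varepsilon\log\mu_\varepsilon(A)\le -I(A)$ for every closed $A\subset X$ and $\liminf_{\varepsilon\to0}\varepsilon\log\mu_\varepsilon(G)\ge -I(G)$ for every open $G\subset X$. *)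

theory Defs
  imports "HOL-Probability.Probability"
begin

definition self_adjoint :: "('h::real_inner \<Rightarrow> 'h) \<Rightarrow> bool" where
  "self_adjoint T \<longleftrightarrow> (\<forall>x y. T x \<bullet> y = x \<bullet> T y)"

text \<open>Positive in the sense of nonnegative; the kernel may be nontrivial.\<close>

definition positive_operator :: "('h::real_inner \<Rightarrow> 'h) \<Rightarrow> bool" where
  "positive_operator T \<longleftrightarrow> (\<forall>x. 0 \<le> T x \<bullet> x)"

text \<open>On a Hilbert space, the description below determines a unique operator whenever
  \<open>T\<close> is bounded, self-adjoint and positive; for other \<open>T\<close> the value is unspecified.\<close>

definition op_sqrt :: "('h::real_inner \<Rightarrow> 'h) \<Rightarrow> 'h \<Rightarrow> 'h" where
  "op_sqrt T = (THE R. bounded_linear R \<and> self_adjoint R \<and> positive_operator R \<and> R \<circ> R = T)"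

definition op_abs :: "('h::real_inner \<Rightarrow> 'h) \<Rightarrow> 'h \<Rightarrow> 'h" where
  "op_abs T = op_sqrt (adjoint T \<circ> T)"

definition orthonormal_basis :: "'h::real_inner set \<Rightarrow> bool" where
  "orthonormal_basis B \<longleftrightarrow>
     pairwise orthogonal B \<and> (\<forall>e\<in>B. norm e = 1) \<and> closure (span B) = UNIV"

text \<open>The trace of \<open>op_abs T\<close> does not depend on the orthonormal basis.\<close>

definition trace_class :: "('h::real_inner \<Rightarrow> 'h) \<Rightarrow> bool" where
  "trace_class T \<longleftrightarrow>
     bounded_linear T \<and> (\<exists>B. orthonormal_basis B \<and> (\<lambda>e. op_abs T e \<bullet> e) summable_on B)"

definition gaussian_distributed ::
  "'w measure \<Rightarrow> ('w \<Rightarrow> 'h::real_inner) \<Rightarrow> 'h \<Rightarrow> ('h \<Rightarrow> 'h) \<Rightarrow> bool" where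
  "gaussian_distributed M X m Q \<longleftrightarrow>
     X \<in> borel_measurable M \<and>
     (\<forall>h. (LINT \<omega>|M. exp (\<i> * complex_of_real (h \<bullet> X \<omega>))) =
          exp (\<i> * complex_of_real (h \<bullet> m) - complex_of_real (Q h \<bullet> h / 2)))"

locale Q_Wiener_process = prob_space M
  for M :: "'w measure" and Q :: "'h::{real_inner, banach, second_countable_topology} \<Rightarrow> 'h"
    and W :: "real \<Rightarrow> 'w \<Rightarrow> 'h" +
  assumes measurable_W: "t \<in> {0..1} \<Longrightarrow> W t \<in> borel_measurable M"
    and W_0: "\<omega> \<in> space M \<Longrightarrow> W 0 \<omega> = 0"
    and continuous_W: "\<omega> \<in> space M \<Longrightarrow> continuous_on {0..1} (\<lambda>t. W t \<omega>)"
    and indep_increments: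
      "(\<And>i. i \<le> n \<Longrightarrow> \<tau> i \<in> {0..1}) \<Longrightarrow> (\<And>i. i < n \<Longrightarrow> \<tau> i \<le> \<tau> (Suc i)) \<Longrightarrow>
       indep_vars (\<lambda>_. borel) (\<lambda>i \<omega>. W (\<tau> (Suc i)) \<omega> - W (\<tau> i) \<omega>) {..<n::nat}"
    and gaussian_increments:
      "0 \<le> s \<Longrightarrow> s \<le> t \<Longrightarrow> t \<le> 1 \<Longrightarrow>
       gaussian_distributed M (\<lambda>\<omega>. W t \<omega> - W s \<omega>) 0 (\<lambda>h. (t - s) *\<^sub>R Q h)"

definition borel_of :: "'x topology \<Rightarrow> 'x measure" where
  "borel_of X = sigma (topspace X) {U. openin X U}"

definition rate_function :: "'x topology \<Rightarrow> ('x \<Rightarrow> ennreal) \<Rightarrow> bool" where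
  "rate_function X I \<longleftrightarrow> (\<forall>C::real. 0 \<le> C \<longrightarrow> closedin X {x \<in> topspace X. I x \<le> ennreal C})"

text \<open>The library has \<open>ln 0 = 0\<close>; events of probability 0 must get \<open>-\<infinity>\<close> instead.\<close>

definition log_prob :: "real \<Rightarrow> ereal" where
  "log_prob p = (if p = 0 then -\<infinity> else ereal (ln p))"

definition large_deviation_principle ::
  "'x topology \<Rightarrow> (real \<Rightarrow> 'x measure) \<Rightarrow> ('x \<Rightarrow> ennreal) \<Rightarrow> bool" where
  "large_deviation_principle X \<mu> I \<longleftrightarrow>
     Hausdorff_space X \<and> rate_function X I \<and>
     (\<forall>\<epsilon>\<in>{0<..1}. prob_space (\<mu> \<epsilon>) \<and> sets (\<mu> \<epsilon>) = sets (borel_of X)) \<and>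
     (\<forall>A. closedin X A \<longrightarrow>
        Limsup (at_right 0) (\<lambda>\<epsilon>. ereal \<epsilon> * log_prob (measure (\<mu> \<epsilon>) A))
          \<le> - enn2ereal (INF x\<in>A. I x)) \<and>
     (\<forall>G. openin X G \<longrightarrow>
        Liminf (at_right 0) (\<lambda>\<epsilon>. ereal \<epsilon> * log_prob (measure (\<mu> \<epsilon>) G))
          \<ge> - enn2ereal (INF x\<in>G. I x))"

text \<open>\<open>C([0,1];H)\<close>: its elements are the continuous functions on \<open>[0,1]\<close>, extended by
  \<open>undefined\<close> to all of \<open>\<real>\<close>; the metric is the supremum distance over \<open>[0,1]\<close>, and boundedness
  is automatic by compactness.\<close>

definition path_space :: "(real \<Rightarrow> 'h::real_normed_vector) topology" where
  "path_space = mtopology_of (cfunspace (top_of_set {0..1}) euclidean_metric)"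

definition scaled_law ::
  "'w measure \<Rightarrow> (real \<Rightarrow> 'w \<Rightarrow> 'h::real_normed_vector) \<Rightarrow> real \<Rightarrow> (real \<Rightarrow> 'h) measure" where
  "scaled_law M W \<epsilon> = distr M (borel_of path_space) (\<lambda>\<omega>. \<lambda>t\<in>{0..1}. sqrt \<epsilon> *\<^sub>R W t \<omega>)"

definition H0 :: "('h::real_inner \<Rightarrow> 'h) \<Rightarrow> 'h set" where
  "H0 Q = range (op_sqrt Q)"

definition sqrt_pinv :: "('h::real_inner \<Rightarrow> 'h) \<Rightarrow> 'h \<Rightarrow> 'h" where
  "sqrt_pinv Q x = (THE y. op_sqrt Q y = x \<and> y \<in> orthogonal_comp {z. op_sqrt Q z = 0})"

definition H0_inner :: "('h::real_inner \<Rightarrow> 'h) \<Rightarrow> 'h \<Rightarrow> 'h \<Rightarrow> real" where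
  "H0_inner Q x y = sqrt_pinv Q x \<bullet> sqrt_pinv Q y"

definition H0_norm :: "('h::real_inner \<Rightarrow> 'h) \<Rightarrow> 'h \<Rightarrow> real" where
  "H0_norm Q x = sqrt (H0_inner Q x x)"

definition H0_topology :: "('h::real_inner \<Rightarrow> 'h) \<Rightarrow> 'h topology" where
  "H0_topology Q = Metric_space.mtopology (H0 Q) (\<lambda>x y. H0_norm Q (x - y))"

definition L2_H0 :: "('h::real_inner \<Rightarrow> 'h) \<Rightarrow> (real \<Rightarrow> 'h) set" where
  "L2_H0 Q = {U. U \<in> restrict_space lborel {0..1} \<rightarrow>\<^sub>M borel_of (H0_topology Q) \<and>
     (\<integral>\<^sup>+ s\<in>{0..1}. ennreal ((H0_norm Q (U s))\<^sup>2) \<partial>lborel) < \<infinity>}"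

text \<open>The integral of \<open>U\<close> is the Bochner integral in the ambient space: the inclusion of
  \<open>H0 Q\<close> is continuous. The infimum over the empty set is \<open>\<infinity>\<close> in \<^typ>\<open>ennreal\<close>.\<close>

definition wiener_rate ::
  "('h::{real_inner, banach, second_countable_topology} \<Rightarrow> 'h) \<Rightarrow> (real \<Rightarrow> 'h) \<Rightarrow> ennreal" where
  "wiener_rate Q F =
     (INF U\<in>{U \<in> L2_H0 Q. \<forall>t\<in>{0..1}. F t = (LINT s:{0..t}|lborel. U s)}.
        (\<integral>\<^sup>+ s\<in>{0..1}. ennreal ((H0_norm Q (U s))\<^sup>2) \<partial>lborel) / 2)"

end

theory Submission
  imports Defs "HOL-Library.Diagonal_Subsequence"
begin

text \<open>
  Orthonormalise a basis with respect to the form \<open>\<langle>Q x, y\<rangle>\<close>, obtaining vectors \<open>h\<^sub>j\<close>, and let \<open>proj n F\<close> be the dyadic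
  polygon of level \<open>n\<close> through the values \<open>\<Sum>j<n. \<langle>h\<^sub>j, F\<rangle> Q h\<^sub>j\<close>. Its energy is the sum of the squares of the
  coordinates \<open>2\<^sup>n\<^sup>/\<^sup>2 \<langle>h\<^sub>j, \<Delta>F\<rangle>\<close>, which for the Wiener process are jointly Gaussian with identity covariance.

  Upper bound: outside an event of probability \<open>exp (- K / \<epsilon>)\<close>, with \<open>K\<close> as large as desired for large \<open>n\<close>, the path
  \<open>\<surd>\<epsilon> W\<close> is uniformly close to \<open>proj n (\<surd>\<epsilon> W)\<close> (chaining over dyadic increments and a union bound). If \<open>\<surd>\<epsilon> W\<close> lies
  in a closed set \<open>A\<close>, then the energy of the projection exceeds \<open>inf\<^sub>A I\<close> approximately, by compactness of the level
  sets, and exponential moments of the sum of squares give the rate.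

  Lower bound: for \<open>F\<close> of finite energy, \<open>\<surd>\<epsilon> W\<close> is near \<open>F\<close> as soon as finitely many coordinates are near those of
  \<open>F\<close>; an exponential tilt bounds this probability from below.

  The moment generating functions of linear combinations suffice throughout, so that uniqueness of characteristic
  functions is needed in dimension one only. The level sets of \<open>I\<close> are described by the energies of all
  projections: these are stable under limits, and conversely bounded energies yield an \<open>L\<^sup>2\<close>-Cauchy sequence of
  step densities.
\<close>

section \<open>Positive square roots\<close>

text \<open>No spectral theorem is invoked. Algebra alone produces \<open>h\<close> from any
  orthonormal basis \<open>e\<close>; in H_0 the vectors \<open>Q (h j)\<close> are orthonormal or
  zero, and the H_0-pairing of \<open>Q (h j)\<close> with x is \<open>h j \<bullet> x\<close>. The
  H_0-orthogonal projection onto their span therefore extends to all of H as \<open>P n\<close>,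
  which is essential because Wiener paths do not take values in H_0. The basis \<open>e\<close>
  remains in charge of norms in H: on vectors orthogonal to the kernel of Q, the error of
  \<open>P n\<close> has no component along \<open>e i\<close> for i < n, and the trace controls the
  remaining ones. A single index n governs both the time mesh and the number of coordinates. The
  kernel of Q needs separate care: bounded energies do not exclude components in it, so
  orthogonality to it is its own condition on paths of finite rate, and some \<open>h j\<close> may
  vanish, which leaves coordinates of variance 0. The square root in the definition of H_0 is a
  definite description, so its existence and uniqueness have to be settled before anything about the
  rate function can be said.\<close>

definition op_root :: "('h::real_inner \<Rightarrow> 'h) \<Rightarrow> ('h \<Rightarrow> 'h) \<Rightarrow> bool" where
  "op_root T R \<longleftrightarrow> bounded_linear R \<and> self_adjoint R \<and> positive_operator R \<and> R \<circ> R = T"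

lemma positive_operator_Cauchy_Schwarz:
  fixes T :: "'h::real_inner \<Rightarrow> 'h"
  assumes "bounded_linear T" "self_adjoint T" "positive_operator T"
  shows "(T x \<bullet> y)\<^sup>2 \<le> (T x \<bullet> x) * (T y \<bullet> y)"
proof -
  interpret bounded_linear T by fact
  have sa: "T y \<bullet> x = T x \<bullet> y"
    using assms(2) by (metis self_adjoint_def inner_commute)
  have *: "0 \<le> T x \<bullet> x + 2 * t * (T x \<bullet> y) + t\<^sup>2 * (T y \<bullet> y)" for t
  proof -
    have "0 \<le> T (x + t *\<^sub>R y) \<bullet> (x + t *\<^sub>R y)"
      using assms(3) by (simp add: positive_operator_def)
    also have "\<dots> = T x \<bullet> x + 2 * t * (T x \<bullet> y) + t\<^sup>2 * (T y \<bullet> y)"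
      by (simp add: add scaleR inner_add_left inner_add_right sa power2_eq_square algebra_simps)
    finally show ?thesis .
  qed
  have x: "T x \<bullet> x \<ge> 0" and y: "T y \<bullet> y \<ge> 0"
    using assms(3) by (auto simp: positive_operator_def)
  show ?thesis
  proof (cases "T y \<bullet> y = 0")
    case True
    have "T x \<bullet> y = 0"
    proof (rule ccontr)
      assume ne: "T x \<bullet> y \<noteq> 0"
      \<comment> \<open>With vanishing quadratic coefficient the expression is affine in t; this t
        makes it equal to -1.\<close>
      show False
        using *[of "- (T x \<bullet> x + 1) / (2 * (T x \<bullet> y))"] True ne by (simp add: field_simps)
    qed
    then show ?thesis by (simp add: True)
  next
    case False
    then show ?thesis
      using *[of "- (T x \<bullet> y) / (T y \<bullet> y)"] y
      by (simp add: field_simps power2_eq_square)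
  qed
qed

text \<open>Cauchy-Schwarz for the form of T with second argument \<open>T x\<close>, followed by
  cancelling the square of \<open>norm (T x)\<close>.\<close>

lemma positive_operator_norm_sq_le:
  fixes T :: "'h::real_inner \<Rightarrow> 'h"
  assumes "bounded_linear T" "self_adjoint T" "positive_operator T"
  shows "(norm (T x))\<^sup>2 \<le> onorm T * (T x \<bullet> x)"
proof (cases "T x = 0")
  case False
  have "(norm (T x))^2 * (norm (T x))^2 = (T x \<bullet> T x)\<^sup>2"
    by (metis power2_norm_eq_inner power2_eq_square)
  also have "\<dots> \<le> (T x \<bullet> x) * (T (T x) \<bullet> T x)"
    by (rule positive_operator_Cauchy_Schwarz[OF assms])
  also have "T (T x) \<bullet> T x \<le> norm (T (T x)) * norm (T x)"
    by (rule norm_cauchy_schwarz)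
  also have "norm (T (T x)) \<le> onorm T * norm (T x)"
    by (rule onorm[OF assms(1)])
  finally have "(norm (T x))^2 * (norm (T x))^2 \<le> (onorm T * (T x \<bullet> x)) * (norm (T x))^2"
    using assms(3) by (simp add: positive_operator_def power2_eq_square mult_left_mono mult_right_mono algebra_simps)
  then show ?thesis
    using False by (subst (asm) mult_le_cancel_right) auto
qed (use assms in \<open>simp add: positive_operator_def onorm_pos_le\<close>)

text \<open>With \<open>D = R - S\<close> one has \<open>R D = - D S\<close>, so \<open>\<langle>R D\<^sup>2 x, x\<rangle> = - \<langle>S D x, D x\<rangle> \<le> 0\<close>. At approximate
  maximisers of \<open>\<parallel>D x\<parallel>\<close> the vector \<open>D\<^sup>2 x\<close> is close to \<open>\<parallel>D\<parallel>\<^sup>2 x\<close>, which forces \<open>R x\<close> to be small.\<close>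

lemma op_root_unique_aux:
  fixes R S :: "'h::real_inner \<Rightarrow> 'h"
  assumes R: "op_root T R" and S: "op_root T S"
    and D: "D = (\<lambda>x. R x - S x)" and x: "norm x = 1"
  shows "(onorm D)\<^sup>2 * (norm (R x))\<^sup>2
    \<le> (onorm R)\<^sup>2 * onorm D * sqrt ((onorm D)\<^sup>2 - (norm (D x))\<^sup>2)"
proof -
  have bl: "bounded_linear R" "bounded_linear S" and sa: "self_adjoint R" "self_adjoint S"
    and pos: "positive_operator R" "positive_operator S" and RS: "R (R x) = S (S x)" for x
    using R S unfolding op_root_def by (auto simp: o_def fun_eq_iff)
  interpret R: bounded_linear R by fact
  interpret S: bounded_linear S by fact
  have blD: "bounded_linear D" unfolding D by (intro bounded_linear_sub bl)
  interpret D: bounded_linear D by fact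
  define \<mu> where "\<mu> = onorm D"
  have \<mu>0: "\<mu> \<ge> 0" unfolding \<mu>_def by (rule onorm_pos_le[OF blD])
  have saD: "D u \<bullet> v = u \<bullet> D v" for u v
    using sa unfolding D self_adjoint_def by (simp add: inner_diff_left inner_diff_right)
  have RD: "R (D u) = - D (S u)" for u
    unfolding D by (simp add: R.diff S.diff RS)
  have nD: "norm (D u) \<le> \<mu> * norm u" for u unfolding \<mu>_def by (rule onorm[OF blD])
  define \<delta> where "\<delta> = \<mu>\<^sup>2 - (norm (D x))\<^sup>2"
  have \<delta>0: "\<delta> \<ge> 0"
    using nD[of x] x unfolding \<delta>_def by (simp add: power_mono)
  have "(norm (D (D x) - \<mu>\<^sup>2 *\<^sub>R x))\<^sup>2
      = (norm (D (D x)))\<^sup>2 - 2 * \<mu>\<^sup>2 * (D (D x) \<bullet> x) + \<mu>^4 * (norm x)\<^sup>2"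
    unfolding power2_norm_eq_inner
    by (simp add: inner_diff_left inner_diff_right inner_commute power2_eq_square
        power4_eq_xxxx algebra_simps)
  also have "D (D x) \<bullet> x = (norm (D x))\<^sup>2"
    by (simp add: saD power2_norm_eq_inner)
  also have "(norm (D (D x)))\<^sup>2 \<le> (\<mu> * norm (D x))\<^sup>2"
    using nD by (intro power_mono) auto
  finally have 1: "(norm (D (D x) - \<mu>\<^sup>2 *\<^sub>R x))\<^sup>2 \<le> \<mu>\<^sup>2 * \<delta>"
    using x by (simp add: \<delta>_def power_mult_distrib algebra_simps power4_eq_xxxx power2_eq_square)
  then have "norm (D (D x) - \<mu>\<^sup>2 *\<^sub>R x) \<le> sqrt (\<mu>\<^sup>2 * \<delta>)"
    by (rule real_le_rsqrt)
  then have 1: "norm (D (D x) - \<mu>\<^sup>2 *\<^sub>R x) \<le> \<mu> * sqrt \<delta>"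
    using \<mu>0 by (simp add: real_sqrt_mult)
  have "R (D (D x)) \<bullet> x = - (S (D x) \<bullet> D x)"
    by (simp add: RD saD)
  then have 2: "R (D (D x)) \<bullet> x \<le> 0"
    using pos by (simp add: positive_operator_def)
  have "\<mu>\<^sup>2 * (R x \<bullet> x) = R (D (D x)) \<bullet> x - R (D (D x) - \<mu>\<^sup>2 *\<^sub>R x) \<bullet> x"
    by (simp add: R.diff R.scaleR inner_diff_left)
  also have "\<dots> \<le> \<bar>R (D (D x) - \<mu>\<^sup>2 *\<^sub>R x) \<bullet> x\<bar>"
    using 2 by simp
  also have "\<dots> \<le> norm (R (D (D x) - \<mu>\<^sup>2 *\<^sub>R x)) * norm x"
    by (rule Cauchy_Schwarz_ineq2)
  also have "\<dots> \<le> onorm R * norm (D (D x) - \<mu>\<^sup>2 *\<^sub>R x)"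
    using onorm[OF bl(1)] x by simp
  also have "\<dots> \<le> onorm R * (\<mu> * sqrt \<delta>)"
    by (intro mult_left_mono 1 onorm_pos_le bl)
  finally have 3: "\<mu>\<^sup>2 * (R x \<bullet> x) \<le> onorm R * (\<mu> * sqrt \<delta>)" .
  have "\<mu>\<^sup>2 * (norm (R x))\<^sup>2 \<le> \<mu>\<^sup>2 * (onorm R * (R x \<bullet> x))"
    by (intro mult_left_mono positive_operator_norm_sq_le bl sa pos) auto
  also have "\<dots> = onorm R * (\<mu>\<^sup>2 * (R x \<bullet> x))"
    by simp
  also have "\<dots> \<le> onorm R * (onorm R * (\<mu> * sqrt \<delta>))"
    by (intro mult_left_mono 3 onorm_pos_le bl)
  finally show ?thesis
    by (simp add: \<delta>_def \<mu>_def power2_eq_square mult.assoc)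
qed

text \<open>The preceding estimate applies to both roots and bounds R x and S x, hence D x itself.
  Along unit vectors that nearly attain the norm \<mu> of D, its left side tends to \<mu>^4 and its
  right side to 0.\<close>

lemma op_root_unique:
  fixes R S :: "'h::real_inner \<Rightarrow> 'h"
  assumes R: "op_root T R" and S: "op_root T S"
  shows "R = S"
proof -
  define D where "D = (\<lambda>x. R x - S x)"
  have bl: "bounded_linear R" "bounded_linear S"
    using R S unfolding op_root_def by auto
  have blD: "bounded_linear D" unfolding D_def by (intro bounded_linear_sub bl)
  define \<mu> where "\<mu> = onorm D"
  have \<mu>0: "\<mu> \<ge> 0" unfolding \<mu>_def by (rule onorm_pos_le[OF blD])
  define C where "C = 2 * ((onorm R)\<^sup>2 + (onorm S)\<^sup>2) * \<mu>"
  have \<mu>': "onorm (\<lambda>x. S x - R x) = \<mu>"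
    unfolding \<mu>_def D_def by (subst onorm_neg[symmetric]) simp
  have key: "\<mu>\<^sup>2 * (norm (D x))\<^sup>2 \<le> C * sqrt (\<mu>\<^sup>2 - (norm (D x))\<^sup>2)" if x: "norm x = 1" for x
  proof -
    have "(norm (D x))\<^sup>2 \<le> (norm (R x) + norm (S x))\<^sup>2"
      unfolding D_def by (intro power_mono norm_triangle_ineq4) auto
    also have "\<dots> \<le> 2 * (norm (R x))\<^sup>2 + 2 * (norm (S x))\<^sup>2"
      using zero_le_power2[of "norm (R x) - norm (S x)"]
      by (simp add: power2_eq_square algebra_simps)
    finally have "\<mu>\<^sup>2 * (norm (D x))\<^sup>2 \<le> \<mu>\<^sup>2 * (2 * (norm (R x))\<^sup>2 + 2 * (norm (S x))\<^sup>2)"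
      by (intro mult_left_mono) auto
    also have "\<dots> \<le> C * sqrt (\<mu>\<^sup>2 - (norm (D x))\<^sup>2)"
      using op_root_unique_aux[OF R S D_def x, folded \<mu>_def] op_root_unique_aux[OF S R refl x, unfolded \<mu>']
      by (simp add: C_def D_def norm_minus_commute algebra_simps)
    finally show ?thesis .
  qed
  have "\<mu> = 0"
  proof (rule ccontr)
    assume "\<mu> \<noteq> 0"
    with \<mu>0 have \<mu>: "\<mu> > 0" by simp
    \<comment> \<open>The denominator is at least 2, so the level stays in [0, \<mu>) for every n;
      being below the operator norm, it is exceeded by D at some unit vector.\<close>
    have le: "\<mu>\<^sup>2 * (\<mu> - \<mu> / (2 + real n))\<^sup>2 \<le> C * sqrt (\<mu>\<^sup>2 - (\<mu> - \<mu> / (2 + real n))\<^sup>2)" for n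
    proof -
      define s where "s = \<mu> - \<mu> / (2 + real n)"
      have s: "0 \<le> s" "s < \<mu>"
        using \<mu> by (auto simp: s_def field_simps)
      have "\<exists>y. norm (D y) > s * norm y"
      proof (rule ccontr)
        assume "\<not> ?thesis"
        then have "onorm D \<le> s"
          using s by (intro onorm_bound) (auto simp: not_less)
        then show False using s \<mu>_def by simp
      qed
      then obtain y where y: "norm (D y) > s * norm y" by blast
      have y0: "y \<noteq> 0" using y linear_simps(3)[OF blD] by auto
      define x where "x = y /\<^sub>R norm y"
      have x: "norm x = 1" using y0 by (simp add: x_def)
      have "norm (D x) = norm (D y) / norm y"
        unfolding x_def using linear_simps(5)[OF blD] by (simp add: divide_inverse_commute)
      then have xs: "norm (D x) \<ge> s"
        using y y0 by (simp add: pos_le_divide_eq)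
      have C: "C \<ge> 0" using \<mu>0 by (simp add: C_def)
      have "\<mu>\<^sup>2 * s\<^sup>2 \<le> \<mu>\<^sup>2 * (norm (D x))\<^sup>2"
        using xs s by (intro mult_left_mono power_mono) auto
      also have "\<dots> \<le> C * sqrt (\<mu>\<^sup>2 - (norm (D x))\<^sup>2)"
        by (rule key[OF x])
      also have "\<dots> \<le> C * sqrt (\<mu>\<^sup>2 - s\<^sup>2)"
        using xs s C by (intro mult_left_mono) (auto intro!: power_mono)
      finally show ?thesis by (simp add: s_def)
    qed
    have l: "(\<lambda>n. \<mu> - \<mu> / (2 + real n)) \<longlonglongrightarrow> \<mu>"
    proof -
      have "(\<lambda>n. inverse (real (Suc (Suc n)))) \<longlonglongrightarrow> 0"
        by (rule LIMSEQ_Suc[OF LIMSEQ_inverse_real_of_nat])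
      then have "(\<lambda>n. \<mu> - \<mu> * inverse (real (Suc (Suc n)))) \<longlonglongrightarrow> \<mu> - \<mu> * 0"
        by (intro tendsto_intros)
      then show ?thesis by (simp add: divide_inverse)
    qed
    have "(\<lambda>n. \<mu>\<^sup>2 * (\<mu> - \<mu> / (2 + real n))\<^sup>2) \<longlonglongrightarrow> \<mu>\<^sup>2 * \<mu>\<^sup>2"
      by (intro tendsto_intros l)
    moreover have "(\<lambda>n. C * sqrt (\<mu>\<^sup>2 - (\<mu> - \<mu> / (2 + real n))\<^sup>2)) \<longlonglongrightarrow> C * sqrt (\<mu>\<^sup>2 - \<mu>\<^sup>2)"
      by (intro tendsto_intros l)
    ultimately have "\<mu>\<^sup>2 * \<mu>\<^sup>2 \<le> C * sqrt (\<mu>\<^sup>2 - \<mu>\<^sup>2)"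
      using le by (intro LIMSEQ_le) auto
    then show False using \<mu> by (simp add: power2_eq_square mult_le_0_iff)
  qed
  then have "D x = 0" for x
    using onorm[OF blD, of x] by (simp add: \<mu>_def)
  then show ?thesis by (simp add: D_def fun_eq_iff)
qed

lemma op_sqrt_eqI: "op_root T R \<Longrightarrow> op_sqrt T = R"
  using op_root_unique unfolding op_sqrt_def op_root_def[symmetric] by blast

text \<open>For \<open>\<parallel>A\<parallel> \<le> 1\<close> the iteration \<open>Y \<mapsto> (A + Y\<^sup>2) / 2\<close> is dominated by its scalar version at \<open>A = 1\<close>;
  its limit \<open>Y\<close> satisfies \<open>(1 - Y)\<^sup>2 = 1 - A\<close>.\<close>

lemma contraction_quadratic_fixpoint:
  fixes A :: "'h::{real_inner, banach} \<Rightarrow>\<^sub>L 'h"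
  assumes A: "norm A \<le> 1" and sa: "self_adjoint (blinfun_apply A)"
  obtains Y where "norm Y \<le> 1" "self_adjoint (blinfun_apply Y)" "Y = (1/2) *\<^sub>R (A + (Y o\<^sub>L Y))"
proof -
  define Y :: "nat \<Rightarrow> 'h \<Rightarrow>\<^sub>L 'h" where "Y = rec_nat 0 (\<lambda>_ y. (1/2) *\<^sub>R (A + (y o\<^sub>L y)))"
  have Y0: "Y 0 = 0" and YS: "Y (Suc n) = (1/2) *\<^sub>R (A + (Y n o\<^sub>L Y n))" for n
    by (auto simp: Y_def)
  \<comment> \<open>The scalar majorant: the same iteration with A replaced by 1. It increases and
    stays below 1.\<close>
  define y :: "nat \<Rightarrow> real" where "y = rec_nat 0 (\<lambda>_ y. (1 + y\<^sup>2) / 2)"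
  have y0: "y 0 = 0" and yS: "y (Suc n) = (1 + (y n)\<^sup>2) / 2" for n
    by (auto simp: y_def)
  have y01: "0 \<le> y n \<and> y n \<le> 1" for n
    by (induction n) (auto simp: y0 yS power_le_one)
  have "y n \<le> y (Suc n)" for n
    using zero_le_power2[of "y n - 1"] by (simp add: yS power2_eq_square algebra_simps)
  then have "incseq y" by (rule incseq_SucI)
  have "\<exists>L. y \<longlonglongrightarrow> L"
    using incseq_convergent[OF \<open>incseq y\<close>, of 1] y01 by blast
  then have "Cauchy y" by (auto intro: LIMSEQ_imp_Cauchy)
  have Yn: "norm (Y n) \<le> y n" for n
  proof (induction n)
    case (Suc n)
    have "norm (Y (Suc n)) \<le> (norm A + norm ((Y n o\<^sub>L Y n))) / 2"
      using norm_triangle_ineq[of A "(Y n o\<^sub>L Y n)"] by (simp add: YS)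
    also have "norm ((Y n o\<^sub>L Y n)) \<le> norm (Y n) * norm (Y n)" by (rule norm_blinfun_compose)
    also have "\<dots> \<le> (y n)\<^sup>2"
      unfolding power2_eq_square using Suc by (intro mult_mono) (use y01 in auto)
    finally show ?case using A by (simp add: yS)
  qed (simp add: Y0 y0)
  \<comment> \<open>The Cauchy property is inherited from the majorant. The factorisation a a - b b
    = a (a - b) + (a - b) b in the induction requires no commutation of a and b.\<close>
  have Yd: "norm (Y (n + k) - Y n) \<le> y (n + k) - y n" for n k
  proof (induction n)
    case 0
    show ?case using Yn[of k] by (simp add: Y0 y0)
  next
    case (Suc n)
    let ?a = "Y (n + k)" and ?b = "Y n"
    have "(?a o\<^sub>L ?a) - (?b o\<^sub>L ?b) = (?a o\<^sub>L (?a - ?b)) + ((?a - ?b) o\<^sub>L ?b)"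
      by (intro blinfun_eqI) (simp add: blinfun.diff_left blinfun.diff_right blinfun.add_left)
    then have "norm ((?a o\<^sub>L ?a) - (?b o\<^sub>L ?b)) \<le> norm ?a * norm (?a - ?b) + norm (?a - ?b) * norm ?b"
      using norm_triangle_ineq[of "(?a o\<^sub>L (?a - ?b))" "((?a - ?b) o\<^sub>L ?b)"]
        norm_blinfun_compose[of ?a "?a - ?b"] norm_blinfun_compose[of "?a - ?b" ?b] by simp
    also have "\<dots> \<le> y (n + k) * (y (n + k) - y n) + (y (n + k) - y n) * y n"
      using Suc Yn y01 incseqD[OF \<open>incseq y\<close>, of n "n + k"]
      by (intro add_mono mult_mono) (auto intro: order_trans[OF norm_ge_zero])
    finally have "norm ((?a o\<^sub>L ?a) - (?b o\<^sub>L ?b)) \<le> (y (n + k))\<^sup>2 - (y n)\<^sup>2"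
      by (simp add: power2_eq_square algebra_simps)
    moreover have "Y (Suc n + k) - Y (Suc n) = (1/2) *\<^sub>R ((?a o\<^sub>L ?a) - (?b o\<^sub>L ?b))"
      by (simp add: YS algebra_simps)
    ultimately have "norm (Y (Suc n + k) - Y (Suc n)) \<le> (1/2) * ((y (n + k))\<^sup>2 - (y n)\<^sup>2)"
      by simp
    then show ?case by (simp add: yS field_simps)
  qed
  have "Cauchy Y"
  proof (rule metric_CauchyI)
    fix e :: real assume "e > 0"
    then obtain N where N: "\<And>m n. m \<ge> N \<Longrightarrow> n \<ge> N \<Longrightarrow> dist (y m) (y n) < e"
      using \<open>Cauchy y\<close> by (meson metric_CauchyD)
    have "dist (Y m) (Y n) < e" if "m \<ge> n" "n \<ge> N" for m n
      using Yd[of n "m - n"] N[of m n] that by (simp add: dist_norm)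
    then show "\<exists>N. \<forall>m\<ge>N. \<forall>n\<ge>N. dist (Y m) (Y n) < e"
      by (metis dist_commute nle_le)
  qed
  then obtain Z where Z: "Y \<longlonglongrightarrow> Z"
    by (auto simp: Cauchy_convergent_iff convergent_def)
  have "norm Z \<le> 1"
    by (rule LIMSEQ_le_const2[OF tendsto_norm[OF Z]]) (use Yn y01 order_trans in blast)
  moreover have "self_adjoint (blinfun_apply Z)"
    unfolding self_adjoint_def
  proof (intro allI)
    fix u v
    have saY: "blinfun_apply (Y n) u \<bullet> v = u \<bullet> blinfun_apply (Y n) v" for n u v
    proof (induction n arbitrary: u v)
      case (Suc n)
      then show ?case
        using sa by (simp add: YS blinfun.add_left blinfun.scaleR_left inner_add_left inner_add_right self_adjoint_def)
    qed (simp add: Y0)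
    have 1: "(\<lambda>n. blinfun_apply (Y n) u \<bullet> v) \<longlonglongrightarrow> blinfun_apply Z u \<bullet> v"
      and 2: "(\<lambda>n. u \<bullet> blinfun_apply (Y n) v) \<longlonglongrightarrow> u \<bullet> blinfun_apply Z v"
      by (intro tendsto_intros Z)+
    show "blinfun_apply Z u \<bullet> v = u \<bullet> blinfun_apply Z v"
      using LIMSEQ_unique[OF 1] 2 by (simp add: saY)
  qed
  moreover have "Z = (1/2) *\<^sub>R (A + (Z o\<^sub>L Z))"
  proof -
    have "(\<lambda>n. (1/2) *\<^sub>R (A + (Y n o\<^sub>L Y n))) \<longlonglongrightarrow> (1/2) *\<^sub>R (A + (Z o\<^sub>L Z))"
      by (intro tendsto_intros bounded_bilinear.tendsto[OF bounded_bilinear_blinfun_compose] Z)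
    moreover have "(\<lambda>n. Y (Suc n)) \<longlonglongrightarrow> Z" using Z by (rule LIMSEQ_Suc)
    ultimately show ?thesis by (auto simp: YS intro: LIMSEQ_unique)
  qed
  ultimately show ?thesis by (rule that)
qed

text \<open>After division by a large c, A = 1 - T / c is a contraction, and the fixed point Y of
  the quadratic iteration gives \<open>sqrt c\<close> times (1 - Y) as root. Positivity comes from
  the norm of Y being at most 1.\<close>

lemma op_root_exists:
  fixes T :: "'h::{real_inner, banach} \<Rightarrow> 'h"
  assumes T: "bounded_linear T" "self_adjoint T" "positive_operator T"
  shows "\<exists>R. op_root T R"
proof -
  interpret T: bounded_linear T by fact
  \<comment> \<open>The summand 1 keeps c positive when T = 0.\<close>
  define c where "c = onorm T + 1"
  have c: "c > 0" using onorm_pos_le[OF T(1)] by (simp add: c_def)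
  define A where "A = Blinfun (\<lambda>x. x - (1 / c) *\<^sub>R T x)"
  have Aap: "blinfun_apply A x = x - (1 / c) *\<^sub>R T x" for x
    unfolding A_def by (subst bounded_linear_Blinfun_apply) (auto intro!: bounded_linear_intros T)
  have "norm A \<le> 1"
  proof (rule norm_blinfun_bound)
    fix x
    have "(norm (T x))\<^sup>2 \<le> c * (T x \<bullet> x)"
      using positive_operator_norm_sq_le[OF T, of x] T(3)
      by (simp add: c_def positive_operator_def algebra_simps add_increasing)
    moreover have "0 \<le> T x \<bullet> x" using T(3) by (simp add: positive_operator_def)
    moreover have "(norm (blinfun_apply A x))\<^sup>2
        = (norm x)\<^sup>2 - 2 / c * (T x \<bullet> x) + (norm (T x))\<^sup>2 / c\<^sup>2"
      unfolding Aap power2_norm_eq_inner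
      by (simp add: inner_diff_left inner_diff_right inner_commute power2_eq_square algebra_simps)
    ultimately have "(norm (blinfun_apply A x))\<^sup>2 \<le> (norm x)\<^sup>2 - 2 / c * (T x \<bullet> x) + c * (T x \<bullet> x) / c\<^sup>2"
      using c by (simp add: divide_right_mono)
    also have "\<dots> \<le> (norm x)\<^sup>2"
      using c \<open>0 \<le> T x \<bullet> x\<close> by (simp add: power2_eq_square field_simps)
    finally have "norm (blinfun_apply A x) \<le> norm x"
      by (rule power2_le_imp_le) simp
    then show "norm (blinfun_apply A x) \<le> 1 * norm x" by simp
  qed simp
  moreover have "self_adjoint (blinfun_apply A)"
    using T(2) unfolding self_adjoint_def Aap by (simp add: inner_diff_left inner_diff_right)
  ultimately obtain Y where Y: "norm Y \<le> 1" "self_adjoint (blinfun_apply Y)" "Y = (1/2) *\<^sub>R (A + (Y o\<^sub>L Y))"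
    by (rule contraction_quadratic_fixpoint)
  define R where "R = (\<lambda>x. sqrt c *\<^sub>R (x - blinfun_apply Y x))"
  have "R (R x) = T x" for x
  proof -
    have "2 *\<^sub>R Y = A + (Y o\<^sub>L Y)"
      by (subst Y(3)) simp
    then have "blinfun_apply (2 *\<^sub>R Y) x = blinfun_apply (A + (Y o\<^sub>L Y)) x"
      by simp
    then have "2 *\<^sub>R blinfun_apply Y x = x - (1/c) *\<^sub>R T x + blinfun_apply Y (blinfun_apply Y x)"
      by (simp add: blinfun.add_left blinfun.scaleR_left Aap)
    then have *: "x - 2 *\<^sub>R blinfun_apply Y x + blinfun_apply Y (blinfun_apply Y x) = (1/c) *\<^sub>R T x"
      by (simp add: algebra_simps)
    have "R (R x) = c *\<^sub>R (x - 2 *\<^sub>R blinfun_apply Y x + blinfun_apply Y (blinfun_apply Y x))"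
      using c unfolding R_def
      by (simp add: blinfun.diff_right blinfun.scaleR_right algebra_simps scaleR_2)
    then show ?thesis unfolding * using c by simp
  qed
  moreover have "bounded_linear R"
    unfolding R_def by (intro bounded_linear_intros)
  moreover have "self_adjoint R"
    using Y(2) unfolding self_adjoint_def R_def by (simp add: inner_diff_left inner_diff_right)
  moreover have "positive_operator R"
    unfolding positive_operator_def
  proof
    fix x
    have "blinfun_apply Y x \<bullet> x \<le> norm (blinfun_apply Y x) * norm x" by (rule norm_cauchy_schwarz)
    also have "\<dots> \<le> (1 * norm x) * norm x"
      using order_trans[OF norm_blinfun[of Y x] mult_right_mono[OF Y(1) norm_ge_zero]]
      by (intro mult_right_mono) auto
    finally have "blinfun_apply Y x \<bullet> x \<le> x \<bullet> x"
      by (simp add: power2_norm_eq_inner[symmetric] power2_eq_square)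
    then show "0 \<le> R x \<bullet> x"
      using c by (simp add: R_def inner_diff_left)
  qed
  ultimately show ?thesis
    unfolding op_root_def by (auto simp: fun_eq_iff)
qed

lemma op_root_op_sqrt:
  fixes T :: "'h::{real_inner, banach} \<Rightarrow> 'h"
  assumes "bounded_linear T" "self_adjoint T" "positive_operator T"
  shows "op_root T (op_sqrt T)"
  using op_root_exists[OF assms] op_sqrt_eqI by metis

text \<open>Trace class is defined through \<open>op_abs\<close>; for the covariance this reduces
  the trace to the sum of \<open>Q e \<bullet> e\<close>.\<close>

lemma op_abs_eq_self:
  fixes T :: "'h::real_inner \<Rightarrow> 'h"
  assumes T: "bounded_linear T" "self_adjoint T" "positive_operator T"
  shows "op_abs T = T"
proof -
  have "adjoint T = T"
    using T(2) by (intro adjoint_unique) (simp add: self_adjoint_def)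
  then show ?thesis
    unfolding op_abs_def using T by (intro op_sqrt_eqI) (simp add: op_root_def)
qed

section \<open>Gram-Schmidt for the covariance form\<close>

locale covariance_operator =
  fixes Q :: "'h::{real_inner, banach, second_countable_topology} \<Rightarrow> 'h"
  assumes bounded_linear_Q: "bounded_linear Q"
    and self_adjoint_Q: "self_adjoint Q"
    and positive_Q: "positive_operator Q"
begin

sublocale Q: bounded_linear Q
  by (rule bounded_linear_Q)

abbreviation R :: "'h \<Rightarrow> 'h" where "R \<equiv> op_sqrt Q"

lemma op_root_R: "op_root Q R"
  by (intro op_root_op_sqrt bounded_linear_Q self_adjoint_Q positive_Q)

lemma bounded_linear_R: "bounded_linear R"
  using op_root_R by (simp add: op_root_def)

sublocale R: bounded_linear R
  by (rule bounded_linear_R)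

lemma R_R: "R (R x) = Q x"
  using op_root_R by (auto simp: op_root_def fun_eq_iff)

lemma R_inner: "R x \<bullet> y = x \<bullet> R y"
  using op_root_R by (simp add: op_root_def self_adjoint_def)

lemma Q_inner_commute: "Q x \<bullet> y = Q y \<bullet> x"
  using self_adjoint_Q by (metis self_adjoint_def inner_commute)

lemma Q_inner_eq_R: "Q x \<bullet> y = R x \<bullet> R y"
  by (simp add: R_inner flip: R_R)

lemma Q_inner_self: "Q x \<bullet> x = (norm (R x))\<^sup>2"
  by (simp add: Q_inner_eq_R power2_norm_eq_inner)

lemma Q_inner_nonneg: "0 \<le> Q x \<bullet> x"
  by (simp add: Q_inner_self)

lemma R_eq_0_iff: "R x = 0 \<longleftrightarrow> Q x = 0"
proof
  assume "R x = 0" then show "Q x = 0" by (metis R_R R.zero)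
next
  assume "Q x = 0" then show "R x = 0" using Q_inner_self[of x] by simp
qed

end

locale covariance_basis = covariance_operator Q
  for Q :: "'h::{real_inner, banach, second_countable_topology} \<Rightarrow> 'h" +
  fixes e :: "nat \<Rightarrow> 'h"
  assumes e_orthogonal: "i \<noteq> j \<Longrightarrow> e i \<bullet> e j = 0"
    and e_norm: "norm (e i) = 0 \<or> norm (e i) = 1"
    and e_dense: "closure (span (range e)) = UNIV"
    and e_trace: "summable (\<lambda>i. Q (e i) \<bullet> e i)"
begin

section \<open>Bessel and Parseval for the basis \<open>e\<close>\<close>

lemma e_self: "e i = 0 \<or> e i \<bullet> e i = 1"
  using e_norm[of i] by (simp add: norm_eq_1)

lemma e_coeff: "e i \<bullet> e i * (e i \<bullet> x) = e i \<bullet> x"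
  using e_self[of i] by auto

lemma in_span_e: "y \<in> span (range e) \<Longrightarrow> \<exists>N. y \<in> span (e ` {..<N})"
proof (induction rule: span_induct_alt)
  case base
  show ?case by (auto intro: span_zero)
next
  case (step c x y)
  then obtain N i where N: "y \<in> span (e ` {..<N})" and i: "x = e i" by auto
  have "y \<in> span (e ` {..<max N (Suc i)})"
    by (rule subsetD[OF span_mono N]) auto
  moreover have "x \<in> span (e ` {..<max N (Suc i)})"
    unfolding i by (rule span_base) auto
  ultimately have "c *\<^sub>R x + y \<in> span (e ` {..<max N (Suc i)})"
    by (intro span_add span_scale)
  then show ?case by blast
qed

text \<open>p is the orthogonal projection of x onto the span of the first N basis vectors;
  Pythagoras and best approximation follow from x - p being orthogonal to that span.\<close>

lemma norm_sq_e_expansion: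
  assumes p: "p = (\<Sum>i<N. (e i \<bullet> x) *\<^sub>R e i)"
  shows "(norm p)\<^sup>2 = (\<Sum>i<N. (e i \<bullet> x)\<^sup>2)" "(norm x)\<^sup>2 = (norm p)\<^sup>2 + (norm (x - p))\<^sup>2"
    "y \<in> span (e ` {..<N}) \<Longrightarrow> norm (x - p) \<le> norm (x - y)"
proof -
  have pe: "e j \<bullet> p = e j \<bullet> x" if "j < N" for j
  proof -
    have "e j \<bullet> p = (\<Sum>i<N. if i = j then (e i \<bullet> x) * (e i \<bullet> e i) else 0)"
      unfolding p inner_sum_right by (intro sum.cong) (auto simp: e_orthogonal)
    also have "\<dots> = e j \<bullet> x" using that e_coeff[of j x] by (simp add: mult.commute)
    finally show ?thesis .
  qed
  have "p \<bullet> p = (\<Sum>i<N. (e i \<bullet> x) * (e i \<bullet> p))"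
    by (subst (1) p) (simp add: inner_sum_left)
  also have "\<dots> = (\<Sum>i<N. (e i \<bullet> x)\<^sup>2)"
    by (intro sum.cong) (auto simp: pe power2_eq_square)
  finally show "(norm p)\<^sup>2 = (\<Sum>i<N. (e i \<bullet> x)\<^sup>2)"
    by (simp add: power2_norm_eq_inner)
  have orth: "(x - p) \<bullet> z = 0" if "z \<in> span (e ` {..<N})" for z
    using that
  proof (induction rule: span_induct_alt)
    case (step c z y)
    then obtain i where i: "i < N" "z = e i" by auto
    have "(x - p) \<bullet> z = 0"
      using pe[OF i(1)] by (simp add: i(2) inner_diff_right inner_commute)
    with step show ?case by (simp add: inner_add_right)
  qed simp
  have pin: "p \<in> span (e ` {..<N})"
    unfolding p by (intro span_sum span_scale span_base) auto
  show "(norm x)\<^sup>2 = (norm p)\<^sup>2 + (norm (x - p))\<^sup>2"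
    using orth[OF pin]
    by (simp add: power2_norm_eq_inner inner_diff_left inner_diff_right inner_commute algebra_simps)
  assume y: "y \<in> span (e ` {..<N})"
  have "(x - p) \<bullet> (p - y) = 0" using pin y by (intro orth span_diff)
  then have "(norm (x - y))\<^sup>2 = (norm (x - p))\<^sup>2 + (norm (p - y))\<^sup>2"
    by (simp add: power2_norm_eq_inner inner_diff_left inner_diff_right inner_commute algebra_simps)
  then have "(norm (x - p))\<^sup>2 \<le> (norm (x - y))\<^sup>2" by simp
  then show "norm (x - p) \<le> norm (x - y)" by (rule power2_le_imp_le) simp
qed

lemma Bessel_e: "(\<Sum>i<N. (e i \<bullet> x)\<^sup>2) \<le> (norm x)\<^sup>2"
  using norm_sq_e_expansion(1,2)[OF refl, of x N] by simp

text \<open>By density some finite span comes arbitrarily close to x, and the projection onto it is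
  at least as close. This allows norms in H to be bounded coordinate by coordinate.\<close>

lemma norm_sq_le_if_partial_sums_le:
  assumes "\<And>N. (\<Sum>i<N. (e i \<bullet> x)\<^sup>2) \<le> B"
  shows "(norm x)\<^sup>2 \<le> B"
proof (rule field_le_epsilon)
  fix d :: real assume d: "d > 0"
  have "x \<in> closure (span (range e))" by (simp add: e_dense)
  then obtain y where y: "y \<in> span (range e)" "dist y x < sqrt d"
    using d by (meson closure_approachable real_sqrt_gt_0_iff)
  obtain N where N: "y \<in> span (e ` {..<N})" using in_span_e[OF y(1)] ..
  define p where "p = (\<Sum>i<N. (e i \<bullet> x) *\<^sub>R e i)"
  have "norm (x - p) \<le> sqrt d"
    using norm_sq_e_expansion(3)[OF p_def N] y(2) by (simp add: dist_norm norm_minus_commute)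
  then have "(norm (x - p))\<^sup>2 \<le> (sqrt d)\<^sup>2"
    by (intro power_mono) auto
  then show "(norm x)\<^sup>2 \<le> B + d"
    using norm_sq_e_expansion(1,2)[OF p_def] assms[of N] d by simp
qed

lemma eq_0_if_orthogonal_e: "(\<And>i. e i \<bullet> x = 0) \<Longrightarrow> x = 0"
  using norm_sq_le_if_partial_sums_le[of x 0] by simp

lemma Parseval_e: "(\<lambda>N. \<Sum>i<N. (e i \<bullet> x)\<^sup>2) \<longlonglongrightarrow> (norm x)\<^sup>2"
proof -
  let ?s = "\<lambda>N. \<Sum>i<N. (e i \<bullet> x)\<^sup>2"
  have inc: "incseq ?s" by (rule incseq_SucI) simp
  obtain L where L: "?s \<longlonglongrightarrow> L" "\<And>N. ?s N \<le> L"
    using incseq_convergent[OF inc, of "(norm x)\<^sup>2"] Bessel_e by blast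
  moreover have "L \<le> (norm x)\<^sup>2"
    by (rule LIMSEQ_le_const2[OF L(1)]) (use Bessel_e in auto)
  moreover have "(norm x)\<^sup>2 \<le> L"
    by (rule norm_sq_le_if_partial_sums_le[OF L(2)])
  ultimately show ?thesis by simp
qed

text \<open>Gram-Schmidt for the semi-inner product \<open>Q x \<bullet> y\<close>. If the residual
  g is null for it, the inverse of 0 is 0 and the vector becomes 0; degenerate directions thus drop
  out without a case distinction.\<close>

fun h :: "nat \<Rightarrow> 'h" where
  "h i = (let g = e i - (\<Sum>j<i. (Q (h j) \<bullet> e i) *\<^sub>R h j) in g /\<^sub>R sqrt (Q g \<bullet> g))"

declare h.simps [simp del]

text \<open>The Gram-Schmidt residual. Its adjoint in H is x - P n x, see
  \<open>inner_diff_P\<close>.\<close>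

definition T :: "nat \<Rightarrow> 'h \<Rightarrow> 'h" where
  "T n x = x - (\<Sum>j<n. (Q (h j) \<bullet> x) *\<^sub>R h j)"

lemma h_eq: "h i = T i (e i) /\<^sub>R sqrt (Q (T i (e i)) \<bullet> T i (e i))"
  by (subst h.simps) (simp add: T_def Let_def)

lemma h_self: "h i = 0 \<or> Q (h i) \<bullet> h i = 1"
proof (cases "Q (T i (e i)) \<bullet> T i (e i) = 0")
  case False
  then have "Q (T i (e i)) \<bullet> T i (e i) > 0" using Q_inner_nonneg[of "T i (e i)"] by simp
  then show ?thesis
    by (subst (2 3) h_eq) (simp add: Q.scaleR field_simps flip: real_sqrt_mult)
qed (simp add: h_eq)

lemma h_coeff: "Q (h i) \<bullet> h i * (h i \<bullet> x) = h i \<bullet> x" "Q (h i) \<bullet> h i * (Q (h i) \<bullet> x) = Q (h i) \<bullet> x"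
  using h_self[of i] by (auto simp: Q.zero)

lemma h_self_le_1: "Q (h i) \<bullet> h i \<le> 1" "0 \<le> Q (h i) \<bullet> h i"
  using h_self[of i] by (auto simp: Q.zero)

text \<open>Orthogonality is a local hypothesis here because the lemma is used inside the induction
  that establishes it.\<close>

lemma Q_h_T_aux:
  assumes "\<And>i. i < n \<Longrightarrow> i \<noteq> k \<Longrightarrow> Q (h k) \<bullet> h i = 0" "k < n"
  shows "Q (h k) \<bullet> T n x = 0"
proof -
  have "Q (h k) \<bullet> T n x = Q (h k) \<bullet> x - (\<Sum>j<n. (Q (h j) \<bullet> x) * (Q (h k) \<bullet> h j))"
    by (simp add: T_def inner_diff_right inner_sum_right)
  also have "(\<Sum>j<n. (Q (h j) \<bullet> x) * (Q (h k) \<bullet> h j))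
      = (\<Sum>j<n. if j = k then (Q (h k) \<bullet> x) * (Q (h k) \<bullet> h k) else 0)"
    by (intro sum.cong) (auto simp: assms(1))
  also have "\<dots> = Q (h k) \<bullet> x"
    using assms(2) h_coeff(2)[of k x] by (simp add: mult.commute)
  finally show ?thesis by simp
qed

lemma Q_h_orthogonal_less: "i < j \<Longrightarrow> Q (h i) \<bullet> h j = 0"
proof (induction j arbitrary: i rule: less_induct)
  case (less j)
  have "Q (h i) \<bullet> T j (e j) = 0"
  proof (rule Q_h_T_aux)
    fix k assume "k < j" "k \<noteq> i"
    then show "Q (h i) \<bullet> h k = 0"
      using less(1)[of i k] less(1)[of k i] less(2) Q_inner_commute[of "h i" "h k"]
      by (cases "k < i") auto
  qed fact
  then show ?case by (subst (2) h_eq) simp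
qed

lemma Q_h_orthogonal: "i \<noteq> j \<Longrightarrow> Q (h i) \<bullet> h j = 0"
  using Q_h_orthogonal_less[of i j] Q_h_orthogonal_less[of j i] Q_inner_commute[of "h i" "h j"]
  by (cases "i < j") auto

lemma Q_h_T: "k < n \<Longrightarrow> Q (h k) \<bullet> T n x = 0"
  by (rule Q_h_T_aux) (auto intro: Q_h_orthogonal)

lemma Q_T_self: "Q (T n x) \<bullet> T n x = Q x \<bullet> x - (\<Sum>j<n. (Q (h j) \<bullet> x)\<^sup>2)"
proof -
  have "Q (T n x) \<bullet> T n x = Q (T n x) \<bullet> x - (\<Sum>j<n. (Q (h j) \<bullet> x) * (Q (T n x) \<bullet> h j))"
    by (subst (2) T_def) (simp add: inner_diff_right inner_sum_right)
  also have "(\<Sum>j<n. (Q (h j) \<bullet> x) * (Q (T n x) \<bullet> h j)) = 0"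
    by (intro sum.neutral) (simp add: Q_inner_commute[of "T n x"] Q_h_T)
  also have "Q (T n x) \<bullet> x = Q x \<bullet> x - (\<Sum>j<n. (Q (h j) \<bullet> x)\<^sup>2)"
    by (simp add: T_def Q.diff Q.sum Q.scaleR inner_diff_left inner_sum_left power2_eq_square)
  finally show ?thesis by simp
qed

lemma Q_T_le: "Q (T n x) \<bullet> T n x \<le> Q x \<bullet> x"
  unfolding Q_T_self by (simp add: sum_nonneg)

text \<open>Up to a vector in the kernel of Q, \<open>e i\<close> lies in the span of
  \<open>h 0\<close>, ..., \<open>h i\<close>, so its residual is null from level i + 1 on; by
  \<open>Q_T_self\<close> residuals only shrink with n. A vector null for the form is killed by
  \<open>R\<close>, hence by Q.\<close>

lemma Q_T_e:
  assumes "i < n"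
  shows "Q (T n (e i)) = 0"
proof -
  let ?g = "T i (e i)" and ?s = "sqrt (Q (T i (e i)) \<bullet> T i (e i))"
  have s: "?s *\<^sub>R h i = ?g" if "Q ?g \<bullet> ?g \<noteq> 0"
    using that by (subst h_eq) simp
  have e: "e i = ?g + (\<Sum>j<i. (Q (h j) \<bullet> e i) *\<^sub>R h j)"
    by (simp add: T_def)
  have "(Q (h i) \<bullet> e i) *\<^sub>R h i = (Q (h i) \<bullet> ?g) *\<^sub>R h i"
  proof -
    have "Q (h i) \<bullet> e i = Q (h i) \<bullet> (?g + (\<Sum>j<i. (Q (h j) \<bullet> e i) *\<^sub>R h j))"
      using e by simp
    also have "\<dots> = Q (h i) \<bullet> ?g"
      by (simp add: inner_add_right inner_sum_right Q_h_orthogonal)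
    finally show ?thesis by simp
  qed
  then have T: "T (Suc i) (e i) = ?g - (Q (h i) \<bullet> ?g) *\<^sub>R h i"
    by (simp add: T_def)
  \<comment> \<open>If ?g is null, then \<open>h i = 0\<close> and nothing is subtracted; otherwise
    ?g is a multiple of the normalised \<open>h i\<close> and the subtraction leaves 0.\<close>
  have "Q (T (Suc i) (e i)) \<bullet> T (Suc i) (e i) = 0"
  proof (cases "Q ?g \<bullet> ?g = 0")
    case True
    then have "h i = 0" by (simp add: h_eq[of i])
    with T True show ?thesis by simp
  next
    case False
    then have g: "?g = ?s *\<^sub>R h i"
      using s by simp
    have "h i \<noteq> 0"
      using False s[OF False] by (auto simp: Q.zero)
    then have "Q (h i) \<bullet> h i = 1" using h_self by blast
    then have "T (Suc i) (e i) = 0" unfolding T by (subst (1 2) g) (simp add: inner_commute)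
    then show ?thesis by simp
  qed
  moreover have "Q (T n (e i)) \<bullet> T n (e i) \<le> Q (T (Suc i) (e i)) \<bullet> T (Suc i) (e i)"
    unfolding Q_T_self using assms by (intro diff_left_mono sum_mono2) auto
  ultimately have "Q (T n (e i)) \<bullet> T n (e i) = 0"
    using Q_inner_nonneg[of "T n (e i)"] by simp
  then have "R (T n (e i)) = 0" by (simp add: Q_inner_self)
  then show ?thesis by (simp add: R_eq_0_iff)
qed

text \<open>The H_0-orthogonal projection onto the span of the \<open>Q (h j)\<close>, written with
  the pairings \<open>h j \<bullet> x\<close> so that it is bounded on all of H.\<close>

definition P :: "nat \<Rightarrow> 'h \<Rightarrow> 'h" where
  "P n x = (\<Sum>j<n. (h j \<bullet> x) *\<^sub>R Q (h j))"

lemma bounded_linear_P: "bounded_linear (P n)"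
  unfolding P_def by (intro bounded_linear_intros)

sublocale P: bounded_linear "P n"
  by (rule bounded_linear_P)

text \<open>Moves the error of \<open>P n\<close> onto the test vector, where it becomes a residual
  that the trace controls.\<close>

lemma inner_diff_P: "(x - P n x) \<bullet> y = x \<bullet> T n y"
  by (simp add: P_def T_def inner_diff_left inner_diff_right inner_sum_left inner_sum_right
      mult.commute inner_commute)

lemma h_inner_P: "j < n \<Longrightarrow> h j \<bullet> P n x = h j \<bullet> x"
proof -
  assume j: "j < n"
  have "h j \<bullet> P n x = (\<Sum>i<n. if i = j then (h j \<bullet> x) * (Q (h j) \<bullet> h j) else 0)"
    unfolding P_def inner_sum_right
    by (intro sum.cong) (auto simp: inner_commute[of _ "Q _"] Q_h_orthogonal)
  then show ?thesis using j h_coeff(1)[of j x] by (simp add: mult.commute)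
qed

lemma inner_P_e_eq:
  assumes "i < n" and x: "\<And>z. Q z = 0 \<Longrightarrow> x \<bullet> z = 0"
  shows "P n x \<bullet> e i = x \<bullet> e i"
  using inner_diff_P[of x n "e i"] x[OF Q_T_e[OF assms(1)]] by (simp add: inner_diff_left)

definition e_var :: "nat \<Rightarrow> real" where
  "e_var i = Q (e i) \<bullet> e i"

lemma e_var_nonneg: "0 \<le> e_var i"
  by (simp add: e_var_def Q_inner_nonneg)

lemma summable_e_var: "summable e_var"
  using e_trace by (simp add: e_var_def[abs_def])

text \<open>The tail is filled with zeros instead of being shifted, so that it compares index by
  index with \<open>Q_T_e_le\<close>.\<close>

definition tail_trace :: "nat \<Rightarrow> real" where
  "tail_trace n = (\<Sum>i. if i < n then 0 else e_var i)"

lemma summable_tail: "summable (\<lambda>i. if i < n then 0 else e_var i)"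
  by (rule summable_comparison_test'[OF summable_e_var, of 0]) (simp add: e_var_nonneg)

lemma tail_trace_tendsto_0: "tail_trace \<longlonglongrightarrow> 0"
proof -
  have "tail_trace n = (\<Sum>i. e_var (i + n))" for n
    unfolding tail_trace_def
    by (subst suminf_split_initial_segment[OF summable_tail, of n n]) simp
  then show ?thesis
    using suminf_exist_split2[OF summable_e_var] by presburger
qed

lemma sum_tail_le: "(\<Sum>i<N. if i < n then 0 else e_var i) \<le> tail_trace n"
  unfolding tail_trace_def by (intro sum_le_suminf summable_tail) (auto simp: e_var_nonneg)

lemma Q_T_e_le: "Q (T n (e i)) \<bullet> T n (e i) \<le> (if i < n then 0 else e_var i)"
  using Q_T_e[of i n] Q_T_le[of n "e i"] by (simp add: e_var_def)

end

text \<open>Orthonormal vectors have mutual distance at least 1, which in a second countable space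
  leaves only countably many; an enumeration then turns the unordered trace into a series.\<close>

lemma (in covariance_operator) covariance_basis_exists:
  assumes "trace_class Q"
  shows "\<exists>e. covariance_basis Q e"
proof -
  obtain B where B: "orthonormal_basis B" and sB: "(\<lambda>e. op_abs Q e \<bullet> e) summable_on B"
    using assms unfolding trace_class_def by blast
  have sB: "(\<lambda>e. Q e \<bullet> e) summable_on B"
    using sB by (simp add: op_abs_eq_self[OF bounded_linear_Q self_adjoint_Q positive_Q])
  have orth: "x \<bullet> y = 0" if "x \<in> B" "y \<in> B" "x \<noteq> y" for x y
    using B that unfolding orthonormal_basis_def pairwise_def orthogonal_def by blast
  have unit: "norm x = 1" if "x \<in> B" for x
    using B that unfolding orthonormal_basis_def by blast
  have far: "dist x y \<ge> 1" if "x \<in> B" "y \<in> B" "x \<noteq> y" for x y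
  proof -
    have "(norm (x - y))\<^sup>2 = 2"
      using orth[OF that] orth[OF that(2,1)] that unit[of x] unit[of y]
      by (simp add: power2_norm_eq_inner inner_diff_left inner_diff_right norm_eq_1)
    then have "1\<^sup>2 \<le> (dist x y)\<^sup>2" by (simp add: dist_norm)
    then show ?thesis by (rule power2_le_imp_le) simp
  qed
  \<comment> \<open>The balls of radius 1/2 around the points of B are disjoint open sets.\<close>
  have "countable B"
  proof -
    let ?F = "(\<lambda>x. ball x (1/2)) ` B"
    have disj: "disjoint ?F"
    proof (rule pairwiseI, clarsimp simp: disjnt_def)
      fix x y assume xy: "x \<in> B" "y \<in> B" "ball x (1/2) \<noteq> ball y (1/2)"
      then have "dist x y \<ge> 1" using far by auto
      then show "ball x (1/2) \<inter> ball y (1/2) = {}"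
        by (intro disjoint_ballI) simp
    qed
    then have "countable ?F"
      by (intro countable_disjoint_open_subsets) auto
    moreover have "inj_on (\<lambda>x. ball x (1/2)) B"
    proof (rule inj_onI)
      fix x y assume "x \<in> B" "y \<in> B" "ball x (1/2) = ball y (1/2)"
      then show "x = y"
        using far[of x y] centre_in_ball[of x "1/2"] by (force simp: dist_commute)
    qed
    ultimately show ?thesis by (rule countable_image_inj_on)
  qed
  define J where "J = to_nat_on B ` B"
  \<comment> \<open>Indices outside the range of the enumeration receive the zero vector.\<close>
  define e where "e i = (if i \<in> J then from_nat_into B i else 0)" for i
  have inj: "inj_on (to_nat_on B) B" by (rule inj_on_to_nat_on[OF \<open>countable B\<close>])
  have eJ: "e (to_nat_on B x) = x" if "x \<in> B" for x
    using that \<open>countable B\<close> by (simp add: e_def J_def)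
  have e0: "e i = 0" if "i \<notin> J" for i using that by (simp add: e_def)
  have "covariance_basis Q e"
  proof
    fix i j :: nat assume ij: "i \<noteq> j"
    show "e i \<bullet> e j = 0"
    proof (cases "i \<in> J \<and> j \<in> J")
      case True
      then obtain x y where "x \<in> B" "y \<in> B" "i = to_nat_on B x" "j = to_nat_on B y"
        by (auto simp: J_def)
      then show ?thesis using eJ orth ij by auto
    qed (use e0 in auto)
  next
    fix i show "norm (e i) = 0 \<or> norm (e i) = 1"
      using eJ e0[of i] unit by (cases "i \<in> J") (auto simp: J_def)
  next
    have "B \<subseteq> range e" using eJ by (metis rangeI subsetI)
    then show "closure (span (range e)) = UNIV"
      using B closure_mono[OF span_mono, of B "range e"] unfolding orthonormal_basis_def by auto
  next
    have "(\<lambda>i. Q (e i) \<bullet> e i) summable_on J"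
      unfolding J_def using sB
      by (subst summable_on_reindex[OF inj]) (auto simp: o_def eJ cong: summable_on_cong)
    then have "(\<lambda>i. Q (e i) \<bullet> e i) summable_on UNIV"
      by (rule summable_on_cong_neutral[THEN iffD1, rotated -1]) (auto simp: e0)
    then show "summable (\<lambda>i. Q (e i) \<bullet> e i)"
      by (rule summable_on_UNIV_nonneg_real_iff[THEN iffD1, rotated]) (rule Q_inner_nonneg)
  qed
  then have "Ex (covariance_basis Q)" by (rule exI[of "covariance_basis Q" e])
  then show ?thesis by simp
qed

section \<open>The space \<open>H\<^sub>0\<close>\<close>

lemma space_borel_of: "space (borel_of X) = topspace X"
  by (simp add: borel_of_def space_measure_of_conv)

lemma sets_borel_of: "sets (borel_of X) = sigma_sets (topspace X) {U. openin X U}"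
  unfolding borel_of_def by (rule sets_measure_of) (auto dest: openin_subset)

lemma sets_borel_of_openin: "openin X U \<Longrightarrow> U \<in> sets (borel_of X)"
  by (auto simp: sets_borel_of)

lemma sets_borel_of_closedin:
  assumes "closedin X A"
  shows "A \<in> sets (borel_of X)"
proof -
  have "topspace X - A \<in> sets (borel_of X)" "A \<subseteq> topspace X"
    using assms by (auto simp: closedin_def intro: sets_borel_of_openin)
  then have "space (borel_of X) - (topspace X - A) \<in> sets (borel_of X)" "A \<subseteq> topspace X"
    by auto
  then show ?thesis by (simp add: space_borel_of double_diff)
qed

lemma measurable_borel_of_open:
  "f \<in> N \<rightarrow>\<^sub>M borel_of X \<Longrightarrow> openin X U \<Longrightarrow> f -` U \<inter> space N \<in> sets N"
  by (rule measurable_sets) (auto simp: sets_borel_of)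

context covariance_basis
begin

text \<open>The vectors R (h j) are orthonormal or zero, and the Fourier series of y in them
  converges to its part orthogonal to the kernel of \<open>R\<close>. This is the preimage that
  \<open>sqrt_pinv\<close> selects, and the one of least norm.\<close>

lemma exists_projection:
  "\<exists>p. R p = R y \<and> p \<in> orthogonal_comp {z. R z = 0} \<and> norm p \<le> norm y"
proof -
  define f where "f j = R (h j)" for j
  have ff: "f i \<bullet> f j = Q (h i) \<bullet> h j" for i j
    by (simp add: f_def Q_inner_eq_R)
  have fc: "f i \<bullet> f i * (f i \<bullet> y) = f i \<bullet> y" for i
    using h_coeff(1)[of i "R y"] unfolding ff by (simp add: f_def R_inner)
  define p where "p n = (\<Sum>j<n. (f j \<bullet> y) *\<^sub>R f j)" for n
  have fp: "f j \<bullet> p n = (if j < n then f j \<bullet> y else 0)" for j n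
  proof -
    have "f j \<bullet> p n = (\<Sum>i<n. if i = j then f j \<bullet> f j * (f j \<bullet> y) else 0)"
      unfolding p_def inner_sum_right
      by (intro sum.cong) (auto simp: ff Q_h_orthogonal)
    then show ?thesis by (simp add: fc)
  qed
  have pp: "p m \<bullet> p n = (\<Sum>j<m. (f j \<bullet> y)\<^sup>2)" if "m \<le> n" for m n
  proof -
    have "p m \<bullet> p n = (\<Sum>j<m. (f j \<bullet> y) * (f j \<bullet> p n))"
      by (subst (1) p_def) (simp add: inner_sum_left)
    also have "\<dots> = (\<Sum>j<m. (f j \<bullet> y)\<^sup>2)"
      using that by (intro sum.cong) (auto simp: fp power2_eq_square)
    finally show ?thesis .
  qed
  define a where "a n = (\<Sum>j<n. (f j \<bullet> y)\<^sup>2)" for n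
  have norm_p: "(norm (p n))\<^sup>2 = a n" for n
    by (simp add: power2_norm_eq_inner pp a_def)
  have "y \<bullet> p n = a n" for n
    by (simp add: p_def a_def inner_sum_right inner_commute power2_eq_square)
  then have "(norm (y - p n))\<^sup>2 = (norm y)\<^sup>2 - a n" for n
    using norm_p[of n] by (simp add: power2_norm_eq_inner inner_diff_left inner_diff_right inner_commute)
  then have a_le: "a n \<le> (norm y)\<^sup>2" for n
    by (metis diff_ge_0_iff_ge zero_le_power2)
  have inc: "incseq a" by (rule incseq_SucI) (simp add: a_def)
  then obtain L where "a \<longlonglongrightarrow> L"
    using incseq_convergent[OF inc, of "(norm y)\<^sup>2"] a_le by blast
  then have Ca: "Cauchy a" by (rule LIMSEQ_imp_Cauchy)
  have diff: "(norm (p n - p m))\<^sup>2 = a n - a m" if "m \<le> n" for m n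
  proof -
    have "p m \<bullet> p n = a m" using pp[OF that] by (simp add: a_def)
    then show ?thesis
      using norm_p by (simp add: power2_norm_eq_inner inner_diff_left inner_diff_right inner_commute)
  qed
  have "Cauchy p"
  proof (rule metric_CauchyI)
    fix r :: real assume r: "r > 0"
    then obtain N where N: "\<And>m n. m \<ge> N \<Longrightarrow> n \<ge> N \<Longrightarrow> dist (a m) (a n) < r\<^sup>2"
      using Ca by (meson metric_CauchyD zero_less_power)
    have "dist (p m) (p n) < r" if "m \<ge> n" "n \<ge> N" for m n
    proof -
      have "(dist (p m) (p n))\<^sup>2 < r\<^sup>2"
        using diff[OF that(1)] N[of m n] that by (simp add: dist_norm)
      then show ?thesis using r by (meson less_imp_le power_less_imp_less_base)
    qed
    then show "\<exists>N. \<forall>m\<ge>N. \<forall>n\<ge>N. dist (p m) (p n) < r"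
      by (metis dist_commute nle_le)
  qed
  then obtain l where l: "p \<longlonglongrightarrow> l"
    by (auto simp: Cauchy_convergent_iff convergent_def)
  \<comment> \<open>Tested against \<open>e i\<close>, the partial sums are exact from n = i + 1 on,
    because R (T n (e i)) = 0.\<close>
  have "e i \<bullet> (R y - R l) = 0" for i
  proof -
    have *: "p n \<bullet> R (e i) = y \<bullet> R (e i)" if "n > i" for n
    proof -
      have "p n \<bullet> R (e i) = y \<bullet> R (\<Sum>j<n. (Q (h j) \<bullet> e i) *\<^sub>R h j)"
        unfolding Q_inner_eq_R
        by (simp add: p_def inner_sum_left R.sum R.scaleR inner_sum_right f_def inner_commute mult.commute)
      moreover have "R (T n (e i)) = 0" using Q_T_e[OF that] by (simp add: R_eq_0_iff)
      then have "R (\<Sum>j<n. (Q (h j) \<bullet> e i) *\<^sub>R h j) = R (e i)"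
        by (simp add: T_def R.diff)
      ultimately show ?thesis by simp
    qed
    have "(\<lambda>n. p n \<bullet> R (e i)) \<longlonglongrightarrow> l \<bullet> R (e i)"
      by (intro tendsto_intros l)
    moreover have "(\<lambda>n. p n \<bullet> R (e i)) \<longlonglongrightarrow> y \<bullet> R (e i)"
      by (rule tendsto_eventually) (rule eventually_mono[OF eventually_gt_at_top[of i] *])
    ultimately have "l \<bullet> R (e i) = y \<bullet> R (e i)" by (rule LIMSEQ_unique)
    moreover have "e i \<bullet> R v = v \<bullet> R (e i)" for v
      by (metis R_inner inner_commute)
    ultimately show ?thesis by (simp add: inner_diff_right)
  qed
  then have "R l = R y" using eq_0_if_orthogonal_e[of "R y - R l"] by simp
  moreover have "norm l \<le> norm y"
  proof (rule LIMSEQ_le_const2[OF tendsto_norm[OF l]])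
    have "norm (p n) \<le> norm y" for n
      by (rule power2_le_imp_le) (use norm_p a_le in auto)
    then show "\<exists>N. \<forall>n\<ge>N. norm (p n) \<le> norm y" by blast
  qed
  moreover have "z \<bullet> l = 0" if "R z = 0" for z
  proof -
    have "z \<bullet> p n = 0" for n
      using that by (simp add: p_def f_def inner_sum_right flip: R_inner)
    moreover have "(\<lambda>n. z \<bullet> p n) \<longlonglongrightarrow> z \<bullet> l"
      by (intro tendsto_intros l)
    ultimately show ?thesis by (simp add: LIMSEQ_const_iff)
  qed
  ultimately show ?thesis
    by (auto simp: orthogonal_comp_def orthogonal_def)
qed

lemma sqrt_pinv_eq:
  assumes "R p = x" "p \<in> orthogonal_comp {z. R z = 0}"
  shows "sqrt_pinv Q x = p"
  unfolding sqrt_pinv_def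
proof (rule the_equality)
  fix q assume q: "R q = x \<and> q \<in> orthogonal_comp {z. R z = 0}"
  have "R (q - p) = 0" using q assms by (simp add: R.diff)
  then have "(q - p) \<bullet> q = 0" "(q - p) \<bullet> p = 0"
    using q assms by (auto simp: orthogonal_comp_def orthogonal_def)
  then have "(q - p) \<bullet> (q - p) = 0" by (simp only: inner_diff_right)
  then show "q = p" by simp
next
  show "R p = x \<and> p \<in> orthogonal_comp {z. R z = 0}" using assms by simp
qed

lemma H0_norm_eq: "R p = x \<Longrightarrow> p \<in> orthogonal_comp {z. R z = 0} \<Longrightarrow> H0_norm Q x = norm p"
  by (simp add: H0_norm_def H0_inner_def sqrt_pinv_eq norm_eq_sqrt_inner)

text \<open>With \<open>H0E\<close> this characterises the H_0-norm as the least norm of a preimage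
  under \<open>R\<close>, from which the triangle inequality, symmetry and definiteness on H_0 are
  deduced.\<close>

lemma H0_norm_R_le: "H0_norm Q (R y) \<le> norm y"
proof -
  obtain p where "R p = R y" "p \<in> orthogonal_comp {z. R z = 0}" "norm p \<le> norm y"
    using exists_projection by blast
  then show ?thesis using H0_norm_eq by metis
qed

lemma H0E:
  assumes "x \<in> H0 Q"
  obtains p where "R p = x" "H0_norm Q x = norm p"
proof -
  obtain y where y: "x = R y" using assms by (auto simp: H0_def)
  obtain p where "R p = R y" "p \<in> orthogonal_comp {z. R z = 0}"
    using exists_projection by blast
  then show ?thesis using that H0_norm_eq y by metis
qed

lemma H0_norm_nonneg: "0 \<le> H0_norm Q x"
  by (simp add: H0_norm_def H0_inner_def)

lemma R_in_H0: "R y \<in> H0 Q"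
  by (simp add: H0_def)

lemma H0_diff: "x \<in> H0 Q \<Longrightarrow> y \<in> H0 Q \<Longrightarrow> x - y \<in> H0 Q"
  unfolding H0_def by (auto simp flip: R.diff)

lemma H0_norm_add_le:
  assumes "x \<in> H0 Q" "y \<in> H0 Q"
  shows "H0_norm Q (x + y) \<le> H0_norm Q x + H0_norm Q y"
proof -
  obtain p q where "R p = x" "H0_norm Q x = norm p" "R q = y" "H0_norm Q y = norm q"
    using H0E[OF assms(1)] H0E[OF assms(2)] by metis
  then show ?thesis
    using H0_norm_R_le[of "p + q"] norm_triangle_ineq[of p q] by (simp add: R.add)
qed

lemma H0_norm_minus: "H0_norm Q (- x) = H0_norm Q x"
proof (cases "x \<in> H0 Q")
  case True
  have le: "H0_norm Q (- z) \<le> H0_norm Q z" if z: "z \<in> H0 Q" for z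
  proof -
    obtain p where "R p = z" "H0_norm Q z = norm p" using H0E[OF z] .
    then show ?thesis using H0_norm_R_le[of "- p"] by (simp add: R.neg)
  qed
  have "- x \<in> H0 Q" using True by (auto simp: H0_def simp flip: R.neg)
  then show ?thesis using le[of x] le[of "- x"] True by simp
next
  \<comment> \<open>A metric must be symmetric off its carrier as well. Outside H_0 both
    descriptions have no solution and so denote the same unspecified vector.\<close>
  case False
  moreover have "- x \<notin> H0 Q"
    using False unfolding H0_def by (metis R.neg minus_minus rangeE rangeI)
  ultimately have "sqrt_pinv Q x = sqrt_pinv Q (- x)"
    unfolding sqrt_pinv_def H0_def by (metis rangeI)
  then show ?thesis by (simp add: H0_norm_def H0_inner_def)
qed

lemma H0_norm_eq_0_iff: "x \<in> H0 Q \<Longrightarrow> H0_norm Q x = 0 \<longleftrightarrow> x = 0"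
  using H0_norm_R_le[of 0] H0_norm_nonneg[of 0] by (elim H0E) (auto simp: R.zero)

sublocale H0: Metric_space "H0 Q" "\<lambda>x y. H0_norm Q (x - y)"
proof
  show "H0_norm Q (x - y) = H0_norm Q (y - x)" for x y
    using H0_norm_minus[of "x - y"] by simp
  show "H0_norm Q (x - y) = 0 \<longleftrightarrow> x = y" if "x \<in> H0 Q" "y \<in> H0 Q" for x y
    using H0_norm_eq_0_iff[OF H0_diff[OF that]] by simp
  show "H0_norm Q (x - z) \<le> H0_norm Q (x - y) + H0_norm Q (y - z)"
    if "x \<in> H0 Q" "y \<in> H0 Q" "z \<in> H0 Q" for x y z
    using H0_norm_add_le[of "x - y" "y - z"] that by (simp add: H0_diff)
qed (rule H0_norm_nonneg)

text \<open>The condition \<open>cm_le x c\<close> expresses \<open>\<parallel>x\<parallel>\<^sup>2 \<le> c\<close> for the norm of \<open>H\<^sub>0\<close> through duality, which makes it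
  stable under limits.\<close>

definition cm_le :: "'h \<Rightarrow> real \<Rightarrow> bool" where
  "cm_le x c \<longleftrightarrow> (\<forall>g. (g \<bullet> x)\<^sup>2 \<le> c * (Q g \<bullet> g))"

lemma cm_le_R: "cm_le (R y) ((norm y)\<^sup>2)"
  unfolding cm_le_def
proof
  fix g
  have "(g \<bullet> R y)\<^sup>2 = (R g \<bullet> y)\<^sup>2" by (simp add: R_inner)
  also have "\<dots> \<le> (R g \<bullet> R g) * (y \<bullet> y)" by (rule Cauchy_Schwarz_ineq)
  finally show "(g \<bullet> R y)\<^sup>2 \<le> (norm y)\<^sup>2 * (Q g \<bullet> g)"
    by (simp add: Q_inner_eq_R power2_norm_eq_inner mult.commute)
qed

lemma cm_le_H0_norm: "x \<in> H0 Q \<Longrightarrow> cm_le x ((H0_norm Q x)\<^sup>2)"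
  using cm_le_R by (metis H0E)

lemma cm_le_orthogonal_kernel: "cm_le x c \<Longrightarrow> Q z = 0 \<Longrightarrow> x \<bullet> z = 0"
  unfolding cm_le_def by (drule spec[of _ z]) (simp add: inner_commute)

text \<open>The extremal test vector g for the duality in \<open>cm_le\<close>: its pairing with x
  and its Q-form are the same number, so testing with g bounds a sum of squares.\<close>

lemma h_combination:
  fixes n x
  defines "S \<equiv> (\<Sum>j<n. (h j \<bullet> x)\<^sup>2)"
    and "g \<equiv> (\<Sum>j<n. (h j \<bullet> x) *\<^sub>R h j)"
  shows "g \<bullet> x = S" "Q g \<bullet> g = S"
proof -
  show "g \<bullet> x = S"
    by (simp add: g_def S_def inner_sum_left power2_eq_square)
  have "Q g \<bullet> g = (\<Sum>j<n. (h j \<bullet> x) * (Q (h j) \<bullet> g))"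
    by (subst (1) g_def) (simp add: Q.sum Q.scaleR inner_sum_left)
  also have "\<dots> = S"
    unfolding S_def
  proof (intro sum.cong refl)
    fix j assume "j \<in> {..<n}"
    have "Q (h j) \<bullet> g = (\<Sum>i<n. if i = j then Q (h j) \<bullet> h j * (h j \<bullet> x) else 0)"
      unfolding g_def inner_sum_right by (intro sum.cong) (auto simp: Q_h_orthogonal)
    then show "(h j \<bullet> x) * (Q (h j) \<bullet> g) = (h j \<bullet> x)\<^sup>2"
      using \<open>j \<in> {..<n}\<close> h_coeff(1)[of j x] by (simp add: power2_eq_square)
  qed
  finally show "Q g \<bullet> g = S" .
qed

text \<open>Along \<open>e i\<close> the error is the pairing of x with T n (e i), whose Q-form is
  at most the i-th term of the tail. Hence \<open>P n\<close> converges uniformly on balls of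
  H_0.\<close>

lemma cm_le_diff_P:
  assumes x: "cm_le x c" and c: "c \<ge> 0"
  shows "(norm (x - P n x))\<^sup>2 \<le> c * tail_trace n"
proof (rule norm_sq_le_if_partial_sums_le)
  fix N
  have "(\<Sum>i<N. (e i \<bullet> (x - P n x))\<^sup>2) \<le> (\<Sum>i<N. c * (if i < n then 0 else e_var i))"
  proof (intro sum_mono)
    fix i
    have "(e i \<bullet> (x - P n x))\<^sup>2 = (T n (e i) \<bullet> x)\<^sup>2"
      by (metis inner_diff_P inner_commute)
    also have "\<dots> \<le> c * (Q (T n (e i)) \<bullet> T n (e i))"
      using x by (simp add: cm_le_def)
    also have "\<dots> \<le> c * (if i < n then 0 else e_var i)"
      by (intro mult_left_mono Q_T_e_le c)
    finally show "(e i \<bullet> (x - P n x))\<^sup>2 \<le> c * (if i < n then 0 else e_var i)" .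
  qed
  also have "\<dots> = c * (\<Sum>i<N. if i < n then 0 else e_var i)"
    by (simp add: sum_distrib_left)
  also have "\<dots> \<le> c * tail_trace n"
    unfolding tail_trace_def
    by (intro mult_left_mono c sum_le_suminf summable_tail) (auto simp: e_var_nonneg)
  finally show "(\<Sum>i<N. (e i \<bullet> (x - P n x))\<^sup>2) \<le> c * tail_trace n" .
qed

lemma cm_le_norm: "cm_le x c \<Longrightarrow> c \<ge> 0 \<Longrightarrow> (norm x)\<^sup>2 \<le> c * tail_trace 0"
  using cm_le_diff_P[of x c 0] by (simp add: P_def)

lemma tail_trace_nonneg: "0 \<le> tail_trace n"
  unfolding tail_trace_def by (intro suminf_nonneg summable_tail) (simp add: e_var_nonneg)

lemma H0_topology_eq: "H0_topology Q = H0.mtopology"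
  by (simp add: H0_topology_def)

text \<open>As a map from H to H_0, \<open>R\<close> is nonexpansive, so preimages of H_0-open sets
  are open in H.\<close>

lemma measurable_R_H0:
  assumes "V \<in> borel_measurable N"
  shows "(\<lambda>s. R (V s)) \<in> N \<rightarrow>\<^sub>M borel_of (H0_topology Q)"
  unfolding borel_of_def
proof (rule measurable_measure_of)
  fix U assume "U \<in> {U. openin (H0_topology Q) U}"
  then have U: "openin H0.mtopology U" by (simp add: H0_topology_eq)
  have "open {y. R y \<in> U}"
    unfolding open_dist
  proof (intro ballI)
    fix x assume "x \<in> {y. R y \<in> U}"
    then obtain r where r: "r > 0" "H0.mball (R x) r \<subseteq> U"
      using U by (auto simp: H0.openin_mtopology)
    have "R y \<in> U" if "dist y x < r" for y
    proof -
      have "H0_norm Q (R x - R y) \<le> norm (x - y)" 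
        using H0_norm_R_le[of "x - y"] by (simp add: R.diff)
      then show ?thesis
        using r(2) that by (intro subsetD[OF r(2)]) (auto simp: R_in_H0 dist_norm norm_minus_commute)
    qed
    then show "\<exists>r>0. \<forall>y. dist y x < r \<longrightarrow> y \<in> {y. R y \<in> U}" using r(1) by auto
  qed
  then have "V -` {y. R y \<in> U} \<inter> space N \<in> sets N"
    using assms by (intro measurable_sets[of V N borel]) auto
  then show "(\<lambda>s. R (V s)) -` U \<inter> space N \<in> sets N" by (simp add: vimage_def)
qed (use openin_subset in \<open>force simp: H0_topology_eq R_in_H0\<close>)+

lemma H0_norm_bound: "\<exists>c>0. \<forall>x\<in>H0 Q. norm x \<le> c * H0_norm Q x"
proof -
  obtain c where "c > 0" "\<And>x. norm (R x) \<le> norm x * c"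
    using R.pos_bounded by blast
  then show ?thesis by (intro exI[of _ c]) (metis H0E mult.commute)
qed

text \<open>The inclusion of H_0 in H is continuous, which transfers measurability; the norm is
  measurable because its sublevel sets are preimages of H_0-balls around 0.\<close>

lemma measurable_H0_imp:
  assumes U: "U \<in> N \<rightarrow>\<^sub>M borel_of (H0_topology Q)"
  shows "U \<in> borel_measurable N" "(\<lambda>s. H0_norm Q (U s)) \<in> borel_measurable N"
    "s \<in> space N \<Longrightarrow> U s \<in> H0 Q"
proof -
  show UH: "s \<in> space N \<Longrightarrow> U s \<in> H0 Q" for s
    using measurable_space[OF U, of s] by (simp add: space_borel_of H0_topology_eq)
  obtain c where c: "c > 0" "\<And>x. x \<in> H0 Q \<Longrightarrow> norm x \<le> c * H0_norm Q x"
    using H0_norm_bound by blast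
  show "U \<in> borel_measurable N"
  proof (rule borel_measurableI)
    fix S :: "'h set" assume S: "open S"
    have "openin H0.mtopology (S \<inter> H0 Q)"
      unfolding H0.openin_mtopology
    proof (intro conjI allI impI)
      fix x assume x: "x \<in> S \<inter> H0 Q"
      then obtain r where r: "r > 0" "\<And>y. dist y x < r \<Longrightarrow> y \<in> S"
        using S unfolding open_dist by blast
      have "H0.mball x (r / c) \<subseteq> S \<inter> H0 Q"
      proof
        fix y assume y: "y \<in> H0.mball x (r / c)"
        then have "norm (x - y) \<le> c * H0_norm Q (x - y)" by (intro c(2) H0_diff) auto
        also have "\<dots> < r" using y c(1) by (simp add: field_simps)
        finally show "y \<in> S \<inter> H0 Q"
          using r(2)[of y] y by (auto simp: dist_norm norm_minus_commute)
      qed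
      then show "\<exists>r>0. H0.mball x r \<subseteq> S \<inter> H0 Q"
        using r(1) c(1) by (intro exI[of _ "r / c"]) auto
    qed auto
    then have "U -` (S \<inter> H0 Q) \<inter> space N \<in> sets N"
      by (intro measurable_borel_of_open[OF U]) (simp add: H0_topology_eq)
    moreover have "U -` (S \<inter> H0 Q) \<inter> space N = U -` S \<inter> space N"
      using UH by auto
    ultimately show "U -` S \<inter> space N \<in> sets N" by simp
  qed
  have "0 \<in> H0 Q" using R_in_H0[of 0] by (simp add: R.zero)
  show "(\<lambda>s. H0_norm Q (U s)) \<in> borel_measurable N"
    unfolding borel_measurable_iff_less
  proof
    fix a
    have "U -` H0.mball 0 a \<inter> space N \<in> sets N"
      by (rule measurable_borel_of_open[OF U]) (simp add: H0_topology_eq)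
    moreover have "U -` H0.mball 0 a \<inter> space N = {w \<in> space N. H0_norm Q (U w) < a}"
      using UH \<open>0 \<in> H0 Q\<close> by (auto simp: H0_norm_minus)
    ultimately show "{w \<in> space N. H0_norm Q (U w) < a} \<in> sets N" by simp
  qed
qed

end

section \<open>Paths of finite energy\<close>

lemma set_integral_interval_diff:
  fixes f :: "real \<Rightarrow> 'b::{banach, second_countable_topology}"
  assumes "set_integrable lborel {0..1} f" "0 \<le> a" "a \<le> b" "b \<le> 1"
  shows "(LINT s:{0..b}|lborel. f s) - (LINT s:{0..a}|lborel. f s) = (LINT s:{a<..b}|lborel. f s)"
proof -
  have "{0..b} = {0..a} \<union> {a<..b}" using assms by auto
  then have "(LINT s:{0..b}|lborel. f s) = (LINT s:{0..a} \<union> {a<..b}|lborel. f s)"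
    by simp
  also have "\<dots> = (LINT s:{0..a}|lborel. f s) + (LINT s:{a<..b}|lborel. f s)"
    by (rule set_integral_Un) (use assms in \<open>auto intro: set_integrable_subset\<close>)
  finally show ?thesis by simp
qed

lemma set_integrable_lborel_const:
  fixes c :: "'b::{banach, second_countable_topology}"
  shows "set_integrable lborel {a<..b} (\<lambda>_::real. c)" "set_integrable lborel {a..b} (\<lambda>_::real. c)"
  unfolding set_integrable_def
  by (intro integrable_scaleR_left integrable_real_indicator; cases "a \<le> b"; simp)+

lemma set_integral_singleton:
  fixes f :: "real \<Rightarrow> 'b::{banach, second_countable_topology}"
  shows "(LINT s:{a}|lborel. f s) = 0"
  unfolding set_lebesgue_integral_def
  by (intro integral_eq_zero_AE eventually_mono[OF AE_lborel_singleton[of a]]) auto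

text \<open>For a fixed weight l, Young's inequality is linear in A and B and passes through
  integrals; optimising over l afterwards recovers Cauchy-Schwarz. The best weight is |S| /
  A.\<close>

lemma sq_le_mult_if_Young:
  fixes S A B :: real
  assumes "\<And>l. l > 0 \<Longrightarrow> 2 * \<bar>S\<bar> \<le> l * A + B / l" "A \<ge> 0" "B \<ge> 0"
  shows "S\<^sup>2 \<le> A * B"
proof (cases "S = 0")
  case False
  define s where "s = \<bar>S\<bar>"
  have s: "s > 0" using False by (simp add: s_def)
  show ?thesis
  proof (cases "A = 0")
    \<comment> \<open>No best weight exists for A = 0; a large one already yields 2 s \<le> s, which
      is impossible for s > 0.\<close>
    case True
    have "2 * s \<le> B / ((B + 1) / s)"
      using assms(1)[of "(B + 1) / s"] s assms(3) True by (simp add: s_def)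
    also have "\<dots> = s * (B / (B + 1))" by simp
    also have "\<dots> \<le> s * 1" using s assms(3) by (intro mult_left_mono) auto
    finally show ?thesis using s by simp
  next
    case False
    then have A: "A > 0" using assms(2) by simp
    have "2 * s \<le> s / A * A + B / (s / A)"
      using assms(1)[of "s / A"] s A by (simp add: s_def)
    then have "s \<le> A * B / s" using A by (simp add: mult.commute)
    then have "s * s \<le> A * B" using s by (simp add: field_simps)
    then show ?thesis by (simp add: s_def power2_eq_square)
  qed
qed (use assms in simp)

lemma Young_if_sq_le_mult:
  fixes S A B :: real
  assumes "S\<^sup>2 \<le> A * B" "A \<ge> 0" "B \<ge> 0" "l > 0"
  shows "2 * S \<le> l * A + B / l"
proof -
  have "(2 * S)\<^sup>2 \<le> 4 * (A * B)" using assms(1) by (simp add: power_mult_distrib)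
  also have "\<dots> \<le> (l * A + B / l)\<^sup>2"
    using zero_le_power2[of "l * A - B / l"] assms(4) by (simp add: power2_eq_square field_simps)
  finally show ?thesis
    by (rule power2_le_imp_le) (use assms in auto)
qed

section \<open>Dyadic increments, densities and energy\<close>

definition incr :: "nat \<Rightarrow> nat \<Rightarrow> (real \<Rightarrow> 'a::real_vector) \<Rightarrow> 'a" where
  "incr n k F = F (real (Suc k) / 2 ^ n) - F (real k / 2 ^ n)"

lemma dyadic_in_unit: "k \<le> 2 ^ n \<Longrightarrow> real k / 2 ^ n \<in> {0..1}"
proof -
  assume "k \<le> 2 ^ n"
  then have "real k \<le> real (2 ^ n)" by (simp only: of_nat_le_iff)
  then show ?thesis by (simp add: divide_le_eq_1)
qed

lemma dyadic_bounds: "k < 2 ^ n \<Longrightarrow> real k / 2 ^ n \<in> {0..1} \<and> real (Suc k) / 2 ^ n \<in> {0..1}"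
  using dyadic_in_unit[of k n] dyadic_in_unit[of "Suc k" n] by auto

context covariance_basis
begin

text \<open>The majorant \<phi> of the squared H_0-norm is kept apart from U and tied to it by
  duality. Thus admissible U of the rate function and densities of the form R (V s) are treated
  alike.\<close>

definition has_density :: "(real \<Rightarrow> 'h) \<Rightarrow> (real \<Rightarrow> 'h) \<Rightarrow> (real \<Rightarrow> real) \<Rightarrow> bool" where
  "has_density F U \<phi> \<longleftrightarrow>
     set_integrable lborel {0..1} U \<and> set_integrable lborel {0..1} \<phi> \<and>
     (\<forall>s\<in>{0..1}. 0 \<le> \<phi> s \<and> cm_le (U s) (\<phi> s)) \<and>
     (\<forall>t\<in>{0..1}. F t = (LINT s:{0..t}|lborel. U s))"

definition has_energy :: "(real \<Rightarrow> 'h) \<Rightarrow> real \<Rightarrow> bool" where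
  "has_energy F B \<longleftrightarrow> (\<exists>U \<phi>. has_density F U \<phi> \<and> (LINT s:{0..1}|lborel. \<phi> s) \<le> B)"

text \<open>The integral of the squared H_0-norm of the slope of \<open>proj n F\<close>: squared
  slopes carry a factor (2^n)^2, and each cell has length 2^-n.\<close>

definition energy :: "nat \<Rightarrow> (real \<Rightarrow> 'h) \<Rightarrow> real" where
  "energy n F = 2 ^ n * (\<Sum>k<2^n. \<Sum>j<n. (h j \<bullet> incr n k F)\<^sup>2)"

lemma energy_nonneg: "0 \<le> energy n F"
  unfolding energy_def by (intro mult_nonneg_nonneg sum_nonneg) auto

lemma has_density_incr:
  assumes F: "has_density F U \<phi>" and ab: "0 \<le> a" "a \<le> b" "b \<le> 1" and l: "l > 0"
  shows "2 * (g \<bullet> (F b - F a)) \<le> l * (LINT s:{a<..b}|lborel. \<phi> s) + (b - a) * (Q g \<bullet> g) / l"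
proof -
  have U: "set_integrable lborel {a<..b} U" and \<phi>: "set_integrable lborel {a<..b} \<phi>"
    using F ab by (auto simp: has_density_def intro: set_integrable_subset)
  have "F b - F a = (LINT s:{a<..b}|lborel. U s)"
    using F ab set_integral_interval_diff[of U a b] by (simp add: has_density_def)
  moreover have "g \<bullet> (LINT s:{a<..b}|lborel. U s) = (LINT s:{a<..b}|lborel. g \<bullet> U s)"
    using integral_inner_right[of g lborel "\<lambda>s. indicator {a<..b} s *\<^sub>R U s"] U
    by (simp add: set_lebesgue_integral_def set_integrable_def)
  ultimately have "2 * (g \<bullet> (F b - F a)) = 2 * (LINT s:{a<..b}|lborel. g \<bullet> U s)"
    by simp
  also have "\<dots> = (LINT s:{a<..b}|lborel. 2 * (g \<bullet> U s))" by simp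
  also have "\<dots> \<le> (LINT s:{a<..b}|lborel. l * \<phi> s + (Q g \<bullet> g) / l)"
  proof (rule set_integral_mono)
    have "set_integrable lborel {a<..b} (\<lambda>s. g \<bullet> U s)"
      using integrable_inner_right[of g lborel "\<lambda>s. indicator {a<..b} s *\<^sub>R U s"] U
      by (simp add: set_integrable_def)
    then show "set_integrable lborel {a<..b} (\<lambda>s. 2 * (g \<bullet> U s))" by simp
    show "set_integrable lborel {a<..b} (\<lambda>s. l * \<phi> s + (Q g \<bullet> g) / l)"
      using \<phi> by (intro set_integral_add(1) set_integrable_lborel_const set_integrable_mult_right)
    fix s assume "s \<in> {a<..b}"
    then have "s \<in> {0..1}" using ab by auto
    then have "0 \<le> \<phi> s" "(g \<bullet> U s)\<^sup>2 \<le> \<phi> s * (Q g \<bullet> g)"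
      using F by (auto simp: has_density_def cm_le_def)
    then show "2 * (g \<bullet> U s) \<le> l * \<phi> s + (Q g \<bullet> g) / l"
      by (intro Young_if_sq_le_mult Q_inner_nonneg l)
  qed
  also have "\<dots> = l * (LINT s:{a<..b}|lborel. \<phi> s) + (LINT s:{a<..b}|lborel. (Q g \<bullet> g) / l)"
    using \<phi> by (subst set_integral_add(2)) (auto intro: set_integrable_lborel_const)
  also have "(LINT s:{a<..b}|lborel. (Q g \<bullet> g) / l) = (b - a) * (Q g \<bullet> g) / l"
    using ab by (simp add: set_lebesgue_integral_def)
  finally show ?thesis .
qed

text \<open>Cauchy-Schwarz in time, in dual form. It makes paths of finite energy Hoelder continuous
  of exponent 1/2; the Young estimate bounds a signed pairing, hence its use for both g and
  -g.\<close>

lemma has_density_cm_le_incr: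
  assumes F: "has_density F U \<phi>" and B: "(LINT s:{0..1}|lborel. \<phi> s) \<le> B"
    and ab: "0 \<le> a" "a \<le> b" "b \<le> 1"
  shows "cm_le (F b - F a) ((b - a) * B)"
  unfolding cm_le_def
proof
  fix g
  have \<phi>: "set_integrable lborel {0..1} \<phi>" "\<And>s. s \<in> {0..1} \<Longrightarrow> 0 \<le> \<phi> s"
    using F by (auto simp: has_density_def)
  have I: "(LINT s:{a<..b}|lborel. \<phi> s) \<le> B"
  proof -
    have "(LINT s:{a<..b}|lborel. \<phi> s) \<le> (LINT s:{0..1}|lborel. \<phi> s)"
      unfolding set_lebesgue_integral_def
    proof (rule integral_mono)
      have "set_integrable lborel {a<..b} \<phi>"
        using \<phi>(1) ab by (auto intro: set_integrable_subset)
      then show "integrable lborel (\<lambda>s. indicator {a<..b} s *\<^sub>R \<phi> s)" by (simp add: set_integrable_def)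
      show "indicator {a<..b} s *\<^sub>R \<phi> s \<le> indicator {0..1} s *\<^sub>R \<phi> s" for s
        using \<phi>(2)[of s] ab by (auto simp: indicator_def)
    qed (use \<phi>(1) in \<open>simp add: set_integrable_def\<close>)
    then show ?thesis using B by simp
  qed
  have I0: "0 \<le> (LINT s:{a<..b}|lborel. \<phi> s)"
    using \<phi>(2) ab unfolding set_lebesgue_integral_def
    by (intro integral_nonneg_AE) (auto simp: indicator_def)
  have "(g \<bullet> (F b - F a))\<^sup>2 \<le> B * ((b - a) * (Q g \<bullet> g))"
  proof (rule sq_le_mult_if_Young)
    fix l :: real assume l: "l > 0"
    have "2 * (g' \<bullet> (F b - F a)) \<le> l * B + (b - a) * (Q g' \<bullet> g') / l" for g'
      using has_density_incr[OF F ab l, of g'] mult_left_mono[OF I, of l] l by linarith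
    from this[of g] this[of "- g"]
    show "2 * \<bar>g \<bullet> (F b - F a)\<bar> \<le> l * B + (b - a) * (Q g \<bullet> g) / l"
      by (simp add: Q.neg abs_if)
  qed (use I I0 ab Q_inner_nonneg in auto)
  then show "(g \<bullet> (F b - F a))\<^sup>2 \<le> (b - a) * B * (Q g \<bullet> g)" by (simp add: mult_ac)
qed

text \<open>Jensen on every dyadic cell: among all paths with the same dyadic coordinates the
  projected polygon is the cheapest. The cell integrals of \<phi> telescope.\<close>

lemma has_density_energy_le:
  assumes F: "has_density F U \<phi>"
  shows "energy n F \<le> (LINT s:{0..1}|lborel. \<phi> s)"
proof -
  define \<Phi> where "\<Phi> k = (LINT s:{0..real k / 2 ^ n}|lborel. \<phi> s)" for k
  have \<phi>: "set_integrable lborel {0..1} \<phi>"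
    using F by (auto simp: has_density_def)
  have cell: "2 ^ n * (\<Sum>j<n. (h j \<bullet> incr n k F)\<^sup>2) \<le> \<Phi> (Suc k) - \<Phi> k" if k: "k < 2 ^ n" for k
  proof -
    let ?S = "\<Sum>j<n. (h j \<bullet> incr n k F)\<^sup>2" and ?a = "real k / 2 ^ n" and ?b = "real (Suc k) / 2 ^ n"
    have ab: "0 \<le> ?a" "?a \<le> ?b" "?b \<le> 1"
      using dyadic_bounds[OF k] by (auto intro: divide_right_mono)
    have d: "?b - ?a = 1 / 2 ^ n" by (simp add: field_simps)
    have "\<Phi> (Suc k) - \<Phi> k = (LINT s:{?a<..?b}|lborel. \<phi> s)"
      unfolding \<Phi>_def by (rule set_integral_interval_diff[OF \<phi> ab])
    \<comment> \<open>The weight l is the cell length 2^-n and the test vector has Q-form ?S, so the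
      second term equals ?S and is absorbed on the left.\<close>
    then have "2 * ?S \<le> (1 / 2 ^ n) * (\<Phi> (Suc k) - \<Phi> k) + (1 / 2 ^ n) * ?S / (1 / 2 ^ n)"
      using has_density_incr[OF F ab, of "1 / 2 ^ n" "\<Sum>j<n. (h j \<bullet> incr n k F) *\<^sub>R h j"]
      unfolding d h_combination(2) incr_def[of n k F, symmetric] h_combination(1) by simp
    then show ?thesis by (simp add: field_simps)
  qed
  have "energy n F = (\<Sum>k<2^n. 2 ^ n * (\<Sum>j<n. (h j \<bullet> incr n k F)\<^sup>2))"
    by (simp add: energy_def sum_distrib_left)
  also have "\<dots> \<le> (\<Sum>k<2^n. \<Phi> (Suc k) - \<Phi> k)"
    by (intro sum_mono cell) simp
  also have "\<dots> = \<Phi> (2 ^ n) - \<Phi> 0" by (rule sum_lessThan_telescope)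
  also have "\<Phi> 0 = 0"
    by (simp add: \<Phi>_def set_integral_singleton)
  also have "\<Phi> (2 ^ n) = (LINT s:{0..1}|lborel. \<phi> s)" by (simp add: \<Phi>_def)
  finally show ?thesis by simp
qed

lemma has_energy_energy_le: "has_energy F B \<Longrightarrow> energy n F \<le> B"
  unfolding has_energy_def using has_density_energy_le order_trans by blast

lemma has_energy_nonneg: "has_energy F B \<Longrightarrow> 0 \<le> B"
  using has_energy_energy_le[of F B 0] energy_nonneg[of 0 F] by simp

lemma has_energy_cm_le:
  "has_energy F B \<Longrightarrow> 0 \<le> a \<Longrightarrow> a \<le> b \<Longrightarrow> b \<le> 1 \<Longrightarrow> cm_le (F b - F a) ((b - a) * B)"
  unfolding has_energy_def using has_density_cm_le_incr by blast

lemma has_energy_0: "has_energy F B \<Longrightarrow> F 0 = 0"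
  by (auto simp: has_energy_def has_density_def set_integral_singleton)

lemma has_energy_cm_le_value:
  assumes "has_energy F B" "t \<in> {0..1}"
  shows "cm_le (F t) B"
proof -
  have "cm_le (F t) (t * B)"
    using has_energy_cm_le[OF assms(1), of 0 t] assms(2) has_energy_0[OF assms(1)] by simp
  moreover have "t * B * (Q g \<bullet> g) \<le> B * (Q g \<bullet> g)" for g
    using assms has_energy_nonneg Q_inner_nonneg by (intro mult_right_mono mult_left_le_one_le) auto
  ultimately show ?thesis unfolding cm_le_def by (meson order_trans)
qed

lemma has_energy_dist_sq:
  "has_energy F B \<Longrightarrow> 0 \<le> a \<Longrightarrow> a \<le> b \<Longrightarrow> b \<le> 1 \<Longrightarrow> (norm (F b - F a))\<^sup>2 \<le> (b - a) * B * tail_trace 0"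
  using has_energy_cm_le has_energy_nonneg by (intro cm_le_norm) auto

lemma has_density_R:
  assumes V: "V \<in> borel_measurable lborel"
    and B: "(\<integral>\<^sup>+s\<in>{0..1}. ennreal ((norm (V s))\<^sup>2) \<partial>lborel) \<le> ennreal B" "0 \<le> B"
    and F: "\<And>t. t \<in> {0..1} \<Longrightarrow> F t = (LINT s:{0..t}|lborel. R (V s))"
  shows "has_density F (\<lambda>s. R (V s)) (\<lambda>s. (norm (V s))\<^sup>2)"
    and "(LINT s:{0..1}|lborel. (norm (V s))\<^sup>2) \<le> B"
    and "set_integrable lborel {0..1} V"
proof -
  have [measurable]: "V \<in> borel_measurable borel" using V by simp
  have nn: "(\<integral>\<^sup>+s. ennreal (indicator {0..1} s * (norm (V s))\<^sup>2) \<partial>lborel) \<le> ennreal B"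
    using B(1) by (simp add: ennreal_mult'' ennreal_indicator mult.commute)
  have int2: "set_integrable lborel {0..1} (\<lambda>s. (norm (V s))\<^sup>2)"
    unfolding set_integrable_def using nn
    by (intro integrableI_bounded) (auto simp: abs_mult intro: le_less_trans)
  show "(LINT s:{0..1}|lborel. (norm (V s))\<^sup>2) \<le> B"
  proof -
    have "ennreal (LINT s:{0..1}|lborel. (norm (V s))\<^sup>2)
        = (\<integral>\<^sup>+s. ennreal (indicator {0..1} s * (norm (V s))\<^sup>2) \<partial>lborel)"
      using int2 unfolding set_integrable_def set_lebesgue_integral_def
      by (subst nn_integral_eq_integral) auto
    then show ?thesis using nn B(2) by (metis ennreal_le_iff)
  qed
  have "set_integrable lborel {0..1} (\<lambda>s. 1 + (norm (V s))\<^sup>2)"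
    using int2 by (intro set_integral_add(1) set_integrable_lborel_const)
  then show intV: "set_integrable lborel {0..1} V"
  proof (rule set_integrable_bound)
    show "set_borel_measurable lborel {0..1} V" by (simp add: set_borel_measurable_def)
    have "norm (V s) \<le> 1 + (norm (V s))\<^sup>2" for s
      using zero_le_power2[of "norm (V s) - 1"] norm_ge_zero[of "V s"]
      unfolding power2_eq_square by (simp add: algebra_simps del: norm_ge_zero)
    then show "AE x in lborel. x \<in> {0..1} \<longrightarrow> norm (V x) \<le> norm (1 + (norm (V x))\<^sup>2)"
      by (intro AE_I2 impI) (metis abs_ge_self order_trans real_norm_def)
  qed
  have "set_integrable lborel {0..1} (\<lambda>s. R (V s))"
    using integrable_bounded_linear[OF bounded_linear_R intV[unfolded set_integrable_def]]
    by (simp add: set_integrable_def R.scaleR)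
  then show "has_density F (\<lambda>s. R (V s)) (\<lambda>s. (norm (V s))\<^sup>2)"
    using int2 F by (auto simp: has_density_def cm_le_R)
qed

lemma wiener_rate_le:
  assumes V: "V \<in> borel_measurable lborel"
    and B: "(\<integral>\<^sup>+s\<in>{0..1}. ennreal ((norm (V s))\<^sup>2) \<partial>lborel) \<le> ennreal B" "0 \<le> B"
    and F: "\<And>t. t \<in> {0..1} \<Longrightarrow> F t = (LINT s:{0..t}|lborel. R (V s))"
  shows "wiener_rate Q F \<le> ennreal (B / 2)"
  unfolding wiener_rate_def
proof (rule INF_lower2)
  let ?U = "\<lambda>s. R (V s)"
  have le: "(\<integral>\<^sup>+s\<in>{0..1}. ennreal ((H0_norm Q (?U s))\<^sup>2) \<partial>lborel) \<le> ennreal B"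
  proof -
    have "(\<integral>\<^sup>+s\<in>{0..1}. ennreal ((H0_norm Q (?U s))\<^sup>2) \<partial>lborel)
        \<le> (\<integral>\<^sup>+s\<in>{0..1}. ennreal ((norm (V s))\<^sup>2) \<partial>lborel)"
      by (intro nn_integral_mono mult_right_mono ennreal_leI power_mono H0_norm_R_le H0_norm_nonneg) auto
    then show ?thesis using B(1) by simp
  qed
  show "?U \<in> {U \<in> L2_H0 Q. \<forall>t\<in>{0..1}. F t = (LINT s:{0..t}|lborel. U s)}"
    using le F measurable_R_H0[OF measurable_restrict_space1[OF V]]
    by (auto simp: L2_H0_def intro: le_less_trans)
  have "(\<integral>\<^sup>+s\<in>{0..1}. ennreal ((H0_norm Q (?U s))\<^sup>2) \<partial>lborel) / 2 \<le> ennreal B / 2"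
    by (intro divide_right_mono_ennreal le)
  also have "\<dots> = ennreal (B / 2)" using B(2) by (simp add: ennreal_divide_numeral)
  finally show "(\<integral>\<^sup>+s\<in>{0..1}. ennreal ((H0_norm Q (?U s))\<^sup>2) \<partial>lborel) / 2 \<le> ennreal (B / 2)" .
qed

text \<open>A strict bound supplies an admissible U whether or not the infimum is attained; the
  squared H_0-norm of U then serves as \<phi>.\<close>

lemma has_energy_if_wiener_rate_less:
  assumes "wiener_rate Q F < c"
  shows "\<exists>B. has_energy F B \<and> ennreal (B / 2) < c"
proof -
  obtain U where U: "U \<in> L2_H0 Q" "\<And>t. t \<in> {0..1} \<Longrightarrow> F t = (LINT s:{0..t}|lborel. U s)"
    and c: "(\<integral>\<^sup>+s\<in>{0..1}. ennreal ((H0_norm Q (U s))\<^sup>2) \<partial>lborel) / 2 < c"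
    using assms unfolding wiener_rate_def INF_less_iff by auto
  have mU: "U \<in> restrict_space lborel {0..1} \<rightarrow>\<^sub>M borel_of (H0_topology Q)"
    and fin: "(\<integral>\<^sup>+s\<in>{0..1}. ennreal ((H0_norm Q (U s))\<^sup>2) \<partial>lborel) < \<infinity>"
    using U(1) by (auto simp: L2_H0_def)
  note mU' = measurable_H0_imp[OF mU]
  let ?\<phi> = "\<lambda>s. (H0_norm Q (U s))\<^sup>2"
  have UH: "U s \<in> H0 Q" if "s \<in> {0..1}" for s
    using mU'(3)[of s] that by (simp add: space_restrict_space)
  have "?\<phi> \<in> borel_measurable (restrict_space lborel {0..1})"
    using mU'(2) by measurable
  then have [measurable]: "(\<lambda>s. indicator {0..1} s * ?\<phi> s) \<in> borel_measurable borel"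
    by (subst (asm) borel_measurable_restrict_space_iff) auto
  have [measurable]: "(\<lambda>s. indicator {0..1} s *\<^sub>R U s) \<in> borel_measurable borel"
    using mU'(1) by (subst (asm) borel_measurable_restrict_space_iff) auto
  have nn: "(\<integral>\<^sup>+s. ennreal (indicator {0..1} s *\<^sub>R ?\<phi> s) \<partial>lborel)
      = (\<integral>\<^sup>+s\<in>{0..1}. ennreal ((H0_norm Q (U s))\<^sup>2) \<partial>lborel)"
    by (intro nn_integral_cong) (auto simp: indicator_def)
  have \<phi>: "set_integrable lborel {0..1} ?\<phi>"
    unfolding set_integrable_def using fin nn
    by (intro integrableI_bounded) (auto simp: abs_mult)
  obtain k where k: "k > 0" "\<And>x. x \<in> H0 Q \<Longrightarrow> norm x \<le> k * H0_norm Q x"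
    using H0_norm_bound by blast
  have "set_integrable lborel {0..1} (\<lambda>s. k * (1 + ?\<phi> s))"
    using \<phi> by (intro set_integrable_mult_right set_integral_add(1) set_integrable_lborel_const)
  then have intU: "set_integrable lborel {0..1} U"
  proof (rule set_integrable_bound)
    show "set_borel_measurable lborel {0..1} U" by (simp add: set_borel_measurable_def)
    have "norm (U s) \<le> norm (k * (1 + ?\<phi> s))" if "s \<in> {0..1}" for s
    proof -
      have "H0_norm Q (U s) \<le> 1 + ?\<phi> s"
        using zero_le_power2[of "H0_norm Q (U s) - 1"] H0_norm_nonneg[of "U s"] 
        by (simp add: power2_eq_square algebra_simps)
      then have "k * H0_norm Q (U s) \<le> k * (1 + ?\<phi> s)" using k(1) by simp
      then show ?thesis using k(2)[OF UH[OF that]] by simp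
    qed
    then show "AE x in lborel. x \<in> {0..1} \<longrightarrow> norm (U x) \<le> norm (k * (1 + ?\<phi> x))" by simp
  qed
  let ?B = "LINT s:{0..1}|lborel. ?\<phi> s"
  have "has_density F U ?\<phi>"
    using intU \<phi> U(2) cm_le_H0_norm UH by (auto simp: has_density_def)
  then have "has_energy F ?B" by (auto simp: has_energy_def)
  moreover have "ennreal ?B = (\<integral>\<^sup>+s\<in>{0..1}. ennreal ((H0_norm Q (U s))\<^sup>2) \<partial>lborel)"
    using \<phi> nn unfolding set_integrable_def set_lebesgue_integral_def
    by (subst nn_integral_eq_integral[symmetric]) auto
  then have "ennreal (?B / 2) < c"
    using c has_energy_nonneg[OF \<open>has_energy F ?B\<close>] ennreal_divide_numeral[of ?B "num.Bit0 num.One"]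
    by simp
  ultimately show ?thesis by blast
qed

end

section \<open>Dyadic polygons\<close>

definition clamp01 :: "real \<Rightarrow> real" where
  "clamp01 x = max 0 (min 1 x)"

lemma clamp01_simps: "x \<le> 0 \<Longrightarrow> clamp01 x = 0" "1 \<le> x \<Longrightarrow> clamp01 x = 1"
    "0 \<le> x \<Longrightarrow> x \<le> 1 \<Longrightarrow> clamp01 x = x"
  by (auto simp: clamp01_def)

lemma continuous_on_clamp01 [continuous_intros]:
  "continuous_on S f \<Longrightarrow> continuous_on S (\<lambda>x. clamp01 (f x))"
  unfolding clamp01_def by (intro continuous_intros)

text \<open>The weight of cell k is the fraction of it covered by [0, t]. In this form linearity in
  F and continuity in t are immediate, and the integral of a step function takes the same
  shape.\<close>

definition polygon :: "nat \<Rightarrow> (real \<Rightarrow> 'a::real_vector) \<Rightarrow> real \<Rightarrow> 'a" where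
  "polygon n F t = F 0 + (\<Sum>k<2^n. clamp01 (2 ^ n * t - real k) *\<^sub>R incr n k F)"

lemma continuous_on_polygon:
  fixes F :: "real \<Rightarrow> 'a::real_normed_vector"
  shows "continuous_on S (polygon n F)"
  unfolding polygon_def[abs_def] by (intro continuous_intros)

lemma exists_dyadic_cell:
  assumes "t \<in> {0..1}"
  obtains k where "k < 2 ^ n" "real k / 2 ^ n \<le> t" "t \<le> real (Suc k) / 2 ^ n"
proof (cases "t = 1")
  \<comment> \<open>Rounding down would give k = 2^n, one past the last cell.\<close>
  case True
  have "real (Suc (2 ^ n - 1)) = 2 ^ n" by simp
  moreover have "real (2 ^ n - 1) \<le> 2 ^ n" by (simp add: of_nat_diff)
  ultimately show ?thesis
    using True by (intro that[of "2 ^ n - 1"]) (auto simp: divide_le_eq_1)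
next
  case False
  define k where "k = nat \<lfloor>2 ^ n * t\<rfloor>"
  have t: "0 \<le> t" "t < 1" using assms False by auto
  have k: "real k \<le> 2 ^ n * t" "2 ^ n * t < real k + 1"
    using t by (simp_all add: k_def)
  have "2 ^ n * t < 2 ^ n" using t by simp
  then have "real k < 2 ^ n" by (rule le_less_trans[OF k(1)])
  then have "k < 2 ^ n" by simp
  then show ?thesis
    using k by (intro that[of k]) (auto simp: field_simps)
qed

lemma sum_incr: "(\<Sum>k<l. incr n k F) = F (real l / 2 ^ n) - F 0"
  unfolding incr_def by (subst sum_lessThan_telescope[where f = "\<lambda>k. F (real k / 2 ^ n)"]) simp

lemma polygon_cell:
  assumes "k < 2 ^ n" "real k / 2 ^ n \<le> t" "t \<le> real (Suc k) / 2 ^ n"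
  shows "polygon n F t = F (real k / 2 ^ n) + (2 ^ n * t - real k) *\<^sub>R incr n k F"
proof -
  have t: "real k \<le> 2 ^ n * t" "2 ^ n * t \<le> real k + 1"
    using assms(2,3) by (simp_all add: field_simps)
  have "(\<Sum>i<2^n. clamp01 (2 ^ n * t - real i) *\<^sub>R incr n i F)
      = (\<Sum>i<Suc k. clamp01 (2 ^ n * t - real i) *\<^sub>R incr n i F)"
    using assms(1) t by (intro sum.mono_neutral_right) (auto simp: clamp01_simps)
  also have "\<dots> = (\<Sum>i<k. clamp01 (2 ^ n * t - real i) *\<^sub>R incr n i F)
      + (2 ^ n * t - real k) *\<^sub>R incr n k F"
    using t by (simp add: clamp01_simps)
  also have "(\<Sum>i<k. clamp01 (2 ^ n * t - real i) *\<^sub>R incr n i F) = (\<Sum>i<k. incr n i F)"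
    using t by (intro sum.cong) (auto simp: clamp01_simps)
  finally show ?thesis by (simp add: polygon_def sum_incr)
qed

lemma polygon_dyadic:
  assumes "l \<le> 2 ^ n"
  shows "polygon n F (real l / 2 ^ n) = F (real l / 2 ^ n)"
proof -
  have "(\<Sum>i<2^n. clamp01 (2 ^ n * (real l / 2 ^ n) - real i) *\<^sub>R incr n i F) = (\<Sum>i<l. incr n i F)"
    using assms by (intro sum.mono_neutral_cong_right) (auto simp: clamp01_simps)
  then show ?thesis by (simp add: polygon_def sum_incr)
qed

lemma polygon_dyadic_coarse:
  assumes "l \<le> 2 ^ n" "n \<le> m"
  shows "polygon m F (real l / 2 ^ n) = F (real l / 2 ^ n)"
proof -
  have "real l / 2 ^ n = real (l * 2 ^ (m - n)) / 2 ^ m"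
  proof -
    have "(2::real) ^ m = 2 ^ n * 2 ^ (m - n)"
      using assms(2) by (simp flip: power_add)
    then show ?thesis by simp
  qed
  moreover have "l * 2 ^ (m - n) \<le> 2 ^ n * 2 ^ (m - n)"
    using assms(1) by (rule mult_right_mono) simp
  then have "l * 2 ^ (m - n) \<le> 2 ^ m"
    using assms(2) by (simp flip: power_add)
  ultimately show ?thesis using polygon_dyadic[of "l * 2 ^ (m - n)" m F] by simp
qed

text \<open>On a cell the polygon is a convex combination of the two end values, and balls are
  convex. With x = 0 this bounds a polygon by its nodes.\<close>

lemma norm_polygon_diff_le:
  fixes F :: "real \<Rightarrow> 'a::real_normed_vector"
  assumes "k < 2 ^ n" "real k / 2 ^ n \<le> t" "t \<le> real (Suc k) / 2 ^ n"
    and "norm (x - F (real k / 2 ^ n)) \<le> d" "norm (x - F (real (Suc k) / 2 ^ n)) \<le> d"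
  shows "norm (x - polygon n F t) \<le> d"
proof -
  define \<theta> where "\<theta> = 2 ^ n * t - real k"
  have \<theta>: "0 \<le> \<theta>" "\<theta> \<le> 1"
    using assms(2,3) by (simp_all add: \<theta>_def field_simps)
  have "x - polygon n F t = (1 - \<theta>) *\<^sub>R (x - F (real k / 2 ^ n)) + \<theta> *\<^sub>R (x - F (real (Suc k) / 2 ^ n))"
    unfolding polygon_cell[OF assms(1-3)] \<theta>_def[symmetric] incr_def
    by (simp add: algebra_simps del: of_nat_Suc)
  also have "norm \<dots> \<le> (1 - \<theta>) * d + \<theta> * d"
    using \<theta> assms(4,5) by (intro norm_triangle_le add_mono) (auto intro: mult_left_mono)
  finally show ?thesis by (simp add: algebra_simps)
qed

lemma polygon_tendsto:
  fixes F :: "real \<Rightarrow> 'a::real_normed_vector"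
  assumes F: "continuous_on {0..1} F" and t: "t \<in> {0..1}"
  shows "(\<lambda>n. polygon n F t) \<longlonglongrightarrow> F t"
proof (rule LIMSEQ_I)
  fix r :: real assume r: "r > 0"
  then obtain d where d: "d > 0" "\<And>x. x \<in> {0..1} \<Longrightarrow> dist x t < d \<Longrightarrow> dist (F x) (F t) < r / 2"
    using F t unfolding continuous_on_iff by (metis half_gt_zero)
  obtain N where N: "(1/2) ^ N < d"
    using d(1) real_arch_pow_inv[of d "1/2"] by auto
  have "norm (polygon n F t - F t) < r" if n: "n \<ge> N" for n
  proof -
    obtain k where k: "k < 2 ^ n" "real k / 2 ^ n \<le> t" "t \<le> real (Suc k) / 2 ^ n"
      using exists_dyadic_cell[OF t] .
    have "real (Suc k) / 2 ^ n - real k / 2 ^ n = (1/2) ^ n" by (simp add: field_simps)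
    also have "\<dots> \<le> (1/2) ^ N" using n by (simp add: power_decreasing)
    finally have c: "real (Suc k) / 2 ^ n - real k / 2 ^ n < d" using N by simp
    have "dist (F (real k / 2 ^ n)) (F t) < r / 2"
      by (rule d(2)) (use dyadic_bounds[OF k(1)] c k(2,3) in \<open>auto simp: dist_real_def\<close>)
    moreover have "dist (F (real (Suc k) / 2 ^ n)) (F t) < r / 2"
      by (rule d(2)) (use dyadic_bounds[OF k(1)] c k(2,3) in \<open>auto simp: dist_real_def\<close>)
    ultimately have "norm (F t - polygon n F t) \<le> r / 2"
      by (intro norm_polygon_diff_le[OF k]) (auto simp: dist_norm norm_minus_commute)
    then show ?thesis using r by (simp add: norm_minus_commute)
  qed
  then show "\<exists>N. \<forall>n\<ge>N. norm (polygon n F t - F t) < r" by blast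
qed

lemma measure_dyadic_cell:
  assumes t: "t \<in> {0..1}" and k: "k < 2 ^ n"
  shows "measure lborel ({0..t} \<inter> {real k / 2 ^ n<..real (Suc k) / 2 ^ n}) = clamp01 (2 ^ n * t - real k) / 2 ^ n"
proof -
  have *: "{0..t} \<inter> {a<..b} = {a<..min t b}" if "0 \<le> a" for a b :: real
    using that by auto
  have "{0..t} \<inter> {real k / 2 ^ n<..real (Suc k) / 2 ^ n} = {real k / 2 ^ n<..min t (real (Suc k) / 2 ^ n)}"
    by (rule *) simp
  moreover have "measure lborel {a<..b} = max 0 (b - a)" for a b :: real
    by (cases "a \<le> b") auto
  ultimately have "measure lborel ({0..t} \<inter> {real k / 2 ^ n<..real (Suc k) / 2 ^ n})
      = max 0 (min t (real (Suc k) / 2 ^ n) - real k / 2 ^ n)"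
    by simp
  also have "\<dots> = clamp01 (2 ^ n * t - real k) / 2 ^ n"
    by (auto simp: clamp01_def min_def max_def field_simps)
  finally show ?thesis .
qed

section \<open>Projected paths and their step densities\<close>

context covariance_basis
begin

definition proj :: "nat \<Rightarrow> (real \<Rightarrow> 'h) \<Rightarrow> real \<Rightarrow> 'h" where
  "proj n F t = P n (polygon n F t)"

lemma continuous_on_proj: "continuous_on S (proj n F)"
  unfolding proj_def[abs_def]
  by (intro P.continuous_on continuous_on_polygon)

text \<open>Finer polygons interpolate the coarser nodes and \<open>P m\<close> preserves pairings
  with the first m vectors \<open>h j\<close>; hence finer projections keep all coarser
  coordinates.\<close>

lemma h_incr_proj:
  assumes "n \<le> m" "j < n" "k < 2 ^ n"
  shows "h j \<bullet> incr n k (proj m F) = h j \<bullet> incr n k F"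
proof -
  have "h j \<bullet> proj m F (real l / 2 ^ n) = h j \<bullet> F (real l / 2 ^ n)" if "l \<le> 2 ^ n" for l
    unfolding proj_def polygon_dyadic_coarse[OF that assms(1)]
    using assms by (intro h_inner_P) simp
  then show ?thesis
    using assms(3) by (simp add: incr_def inner_diff_right del: of_nat_Suc)
qed

text \<open>An \<open>R\<close>-preimage of the slope of \<open>proj n F\<close> on cell k;
  densities are kept in H, where L2 arguments are available.\<close>

definition step_val :: "nat \<Rightarrow> nat \<Rightarrow> (real \<Rightarrow> 'h) \<Rightarrow> 'h" where
  "step_val n k F = 2 ^ n *\<^sub>R R (\<Sum>j<n. (h j \<bullet> incr n k F) *\<^sub>R h j)"

definition step :: "nat \<Rightarrow> (real \<Rightarrow> 'h) \<Rightarrow> real \<Rightarrow> 'h" where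
  "step n F s = (\<Sum>k<2^n. indicator {real k / 2 ^ n<..real (Suc k) / 2 ^ n} s *\<^sub>R step_val n k F)"

lemma measurable_step [measurable]: "step n F \<in> borel_measurable borel"
  unfolding step_def[abs_def] by measurable

lemma norm_step_val: "(norm (step_val n k F))\<^sup>2 = (2 ^ n)\<^sup>2 * (\<Sum>j<n. (h j \<bullet> incr n k F)\<^sup>2)"
  using h_combination(2)[of "incr n k F" n]
  by (simp add: step_val_def power_mult_distrib Q_inner_self)

lemma R_step_val: "R (step_val n k F) = 2 ^ n *\<^sub>R P n (incr n k F)"
  by (simp add: step_val_def R.scaleR R.sum R_R Q.sum Q.scaleR P_def)

lemma norm_step:
  "ennreal ((norm (step n F s))\<^sup>2)
    = (\<Sum>k<2^n. ennreal ((norm (step_val n k F))\<^sup>2) * indicator {real k / 2 ^ n<..real (Suc k) / 2 ^ n} s)"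
proof (cases "\<exists>k<2^n. s \<in> {real k / 2 ^ n<..real (Suc k) / 2 ^ n}")
  case True
  then obtain k where k: "k < 2 ^ n" "s \<in> {real k / 2 ^ n<..real (Suc k) / 2 ^ n}" by blast
  have uniq: "i = k" if "s \<in> {real i / 2 ^ n<..real (Suc i) / 2 ^ n}" for i
  proof -
    have "real i < 2 ^ n * s" "2 ^ n * s \<le> real i + 1" "real k < 2 ^ n * s" "2 ^ n * s \<le> real k + 1"
      using that k(2) by (auto simp: field_simps)
    then have "real i < real k + 1" "real k < real i + 1" by linarith+
    then show ?thesis by linarith
  qed
  then have *: "indicator {real i / 2 ^ n<..real (Suc i) / 2 ^ n} s = (if i = k then 1 else 0::real)"
    "indicator {real i / 2 ^ n<..real (Suc i) / 2 ^ n} s = (if i = k then 1 else 0::ennreal)" for i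
    using k(2) uniq[of i] unfolding indicator_def of_bool_def by metis+
  show ?thesis
    using k(1) unfolding step_def * by (simp add: if_distrib[where f = "\<lambda>a. a *\<^sub>R _"] if_distrib[where f = "\<lambda>a. _ * a"] cong: if_cong)
next
  case False
  then have "\<And>i. i < 2 ^ n \<Longrightarrow> indicator {real i / 2 ^ n<..real (Suc i) / 2 ^ n} s = (0::real)"
    "\<And>i. i < 2 ^ n \<Longrightarrow> indicator {real i / 2 ^ n<..real (Suc i) / 2 ^ n} s = (0::ennreal)"
    by (auto simp: indicator_def)
  then show ?thesis by (simp add: step_def)
qed

lemma nn_integral_step:
  "(\<integral>\<^sup>+s\<in>{0..1}. ennreal ((norm (step n F s))\<^sup>2) \<partial>lborel) \<le> ennreal (energy n F)"
proof -
  have "(\<integral>\<^sup>+s\<in>{0..1}. ennreal ((norm (step n F s))\<^sup>2) \<partial>lborel)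
      \<le> (\<integral>\<^sup>+s. ennreal ((norm (step n F s))\<^sup>2) \<partial>lborel)"
    by (intro nn_integral_mono) (auto simp: indicator_def)
  also have "\<dots> = (\<Sum>k<2^n. ennreal ((norm (step_val n k F))\<^sup>2) * emeasure lborel {real k / 2 ^ n<..real (Suc k) / 2 ^ n})"
    unfolding norm_step by (subst nn_integral_sum) (auto simp: nn_integral_cmult_indicator)
  also have "\<dots> = (\<Sum>k<2^n. ennreal (2 ^ n * (\<Sum>j<n. (h j \<bullet> incr n k F)\<^sup>2)))"
  proof (intro sum.cong refl)
    fix k
    have "emeasure lborel {real k / 2 ^ n<..real (Suc k) / 2 ^ n} = ennreal (1 / 2 ^ n)"
      by (subst emeasure_lborel_Ioc) (auto simp: divide_right_mono field_simps)
    moreover have "(norm (step_val n k F))\<^sup>2 * (1 / 2 ^ n) = 2 ^ n * (\<Sum>j<n. (h j \<bullet> incr n k F)\<^sup>2)"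
      unfolding norm_step_val by (simp add: power2_eq_square[of "2 ^ n"])
    ultimately show "ennreal ((norm (step_val n k F))\<^sup>2) * emeasure lborel {real k / 2 ^ n<..real (Suc k) / 2 ^ n}
        = ennreal (2 ^ n * (\<Sum>j<n. (h j \<bullet> incr n k F)\<^sup>2))"
      by (metis ennreal_mult'' zero_le_divide_1_iff zero_le_numeral zero_le_power)
  qed
  also have "\<dots> = ennreal (energy n F)"
    unfolding energy_def sum_distrib_left by (intro sum_ennreal) (auto intro!: sum_nonneg)
  finally show ?thesis .
qed

text \<open>The part of cell k inside [0, t] has length 2^-n times its clamp weight, and the 2^n in
  the slope cancels the mesh.\<close>

lemma integral_step:
  assumes F: "F 0 = 0" and t: "t \<in> {0..1}"
  shows "proj n F t = (LINT s:{0..t}|lborel. R (step n F s))"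
proof -
  have int: "integrable lborel (indicator ({0..t} \<inter> {real k / 2 ^ n<..real (Suc k) / 2 ^ n}) :: real \<Rightarrow> real)" for k
  proof (rule integrable_real_indicator)
    have "emeasure lborel ({0..t} \<inter> {real k / 2 ^ n<..real (Suc k) / 2 ^ n}) \<le> emeasure lborel {0..t}"
      by (intro emeasure_mono) auto
    also have "\<dots> < \<infinity>" using t by simp
    finally show "emeasure lborel ({0..t} \<inter> {real k / 2 ^ n<..real (Suc k) / 2 ^ n}) < \<infinity>" .
  qed simp
  have "(LINT s:{0..t}|lborel. R (step n F s))
      = (LINT s|lborel. (\<Sum>k<2^n. indicator ({0..t} \<inter> {real k / 2 ^ n<..real (Suc k) / 2 ^ n}) s *\<^sub>R R (step_val n k F)))"
    unfolding set_lebesgue_integral_def step_def R.sum R.scaleR scaleR_sum_right indicator_inter_arith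
      scaleR_scaleR ..
  also have "\<dots> = (\<Sum>k<2^n. (LINT s|lborel. indicator ({0..t} \<inter> {real k / 2 ^ n<..real (Suc k) / 2 ^ n}) s *\<^sub>R R (step_val n k F)))"
    by (intro Bochner_Integration.integral_sum integrable_scaleR_left int)
  also have "\<dots> = (\<Sum>k<2^n. measure lborel ({0..t} \<inter> {real k / 2 ^ n<..real (Suc k) / 2 ^ n}) *\<^sub>R R (step_val n k F))"
    by (intro sum.cong refl) (simp add: integral_scaleR_left[OF int] del: of_nat_Suc)
  also have "\<dots> = (\<Sum>k<2^n. clamp01 (2 ^ n * t - real k) *\<^sub>R P n (incr n k F))"
    by (intro sum.cong refl) (simp only: lessThan_iff measure_dyadic_cell[OF t], simp add: R_step_val)
  also have "\<dots> = proj n F t"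
    by (simp add: proj_def polygon_def F P.sum P.scaleR)
  finally show ?thesis by simp
qed

lemma wiener_rate_proj_le:
  assumes "F 0 = 0"
  shows "wiener_rate Q (proj n F) \<le> ennreal (energy n F / 2)"
proof (rule wiener_rate_le[OF _ nn_integral_step energy_nonneg])
  show "proj n F t = (LINT s:{0..t}|lborel. R (step n F s))" if "t \<in> {0..1}" for t
    by (rule integral_step[of F t n, OF assms that])
qed simp

lemma polygon_diff_P: "polygon n (\<lambda>t. F t - P n (F t)) t = polygon n F t - proj n F t"
proof -
  have "incr n k (\<lambda>t. F t - P n (F t)) = incr n k F - P n (incr n k F)" for k
    by (simp add: incr_def P.diff)
  then show ?thesis
    by (simp add: polygon_def proj_def P.add P.sum P.scaleR scaleR_diff_right sum_subtractf)
qed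

text \<open>The first term is the interpolation error in time, from Hoelder continuity over one
  cell; the second is the truncation error of \<open>P n\<close>, estimated at the two nodes and
  carried to t by convexity.\<close>

lemma has_energy_norm_diff_proj:
  assumes F: "has_energy F B" and t: "t \<in> {0..1}"
  shows "norm (F t - proj n F t) \<le> sqrt (B * tail_trace 0 / 2 ^ n) + sqrt (B * tail_trace n)"
proof -
  obtain k where k: "k < 2 ^ n" "real k / 2 ^ n \<le> t" "t \<le> real (Suc k) / 2 ^ n"
    using exists_dyadic_cell[OF t] .
  note kb = dyadic_bounds[OF k(1)]
  have B: "B \<ge> 0" by (rule has_energy_nonneg[OF F])
  have d: "real (Suc k) / 2 ^ n - real k / 2 ^ n = 1 / 2 ^ n" by (simp add: field_simps)
  have le: "norm (F b - F a) \<le> sqrt (B * tail_trace 0 / 2 ^ n)"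
    if "0 \<le> a" "a \<le> b" "b \<le> 1" "b - a \<le> 1 / 2 ^ n" for a b
  proof (rule real_le_rsqrt)
    have "(norm (F b - F a))\<^sup>2 \<le> (b - a) * (B * tail_trace 0)"
      using has_energy_dist_sq[OF F that(1-3)] by (simp add: mult.assoc)
    also have "\<dots> \<le> (1 / 2 ^ n) * (B * tail_trace 0)"
      using that B tail_trace_nonneg by (intro mult_right_mono) auto
    finally show "(norm (F b - F a))\<^sup>2 \<le> B * tail_trace 0 / 2 ^ n" by simp
  qed
  have 1: "norm (F t - polygon n F t) \<le> sqrt (B * tail_trace 0 / 2 ^ n)"
  proof (rule norm_polygon_diff_le[OF k])
    show "norm (F t - F (real k / 2 ^ n)) \<le> sqrt (B * tail_trace 0 / 2 ^ n)"
      using kb t k d by (intro le) auto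
    show "norm (F t - F (real (Suc k) / 2 ^ n)) \<le> sqrt (B * tail_trace 0 / 2 ^ n)"
      using kb t k d by (subst norm_minus_commute, intro le) auto
  qed
  have "norm (0 - (x - P n x)) \<le> sqrt (B * tail_trace n)" if "cm_le x B" for x
    using cm_le_diff_P[OF that B, of n] unfolding diff_0 norm_minus_cancel by (rule real_le_rsqrt)
  then have "norm (0 - polygon n (\<lambda>t. F t - P n (F t)) t) \<le> sqrt (B * tail_trace n)"
    using has_energy_cm_le_value[OF F] kb by (intro norm_polygon_diff_le[OF k]) blast+
  then have 2: "norm (polygon n F t - proj n F t) \<le> sqrt (B * tail_trace n)"
    by (simp add: polygon_diff_P norm_minus_commute)
  have "F t - proj n F t = (F t - polygon n F t) + (polygon n F t - proj n F t)" by simp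
  then show ?thesis using norm_triangle_le[of "F t - polygon n F t" "polygon n F t - proj n F t"] 1 2 by simp
qed

end

section \<open>Level sets of the rate function\<close>

context covariance_basis
begin

lemma step_energy:
  assumes F: "F 0 = 0"
  shows "has_density (proj n F) (\<lambda>s. R (step n F s)) (\<lambda>s. (norm (step n F s))\<^sup>2)"
    "(LINT s:{0..1}|lborel. (norm (step n F s))\<^sup>2) \<le> energy n F"
    "set_integrable lborel {0..1} (step n F)"
    "set_integrable lborel {0..1} (\<lambda>s. (norm (step n F s))\<^sup>2)"
proof -
  note * = has_density_R[of "step n F" "energy n F" "proj n F", OF _ nn_integral_step energy_nonneg integral_step[of F, OF F]]
  show 1: "has_density (proj n F) (\<lambda>s. R (step n F s)) (\<lambda>s. (norm (step n F s))\<^sup>2)"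
    and "(LINT s:{0..1}|lborel. (norm (step n F s))\<^sup>2) \<le> energy n F"
    and "set_integrable lborel {0..1} (step n F)"
    by (rule *; simp)+
  show "set_integrable lborel {0..1} (\<lambda>s. (norm (step n F s))\<^sup>2)"
    using 1 by (simp add: has_density_def)
qed

lemma energy_cong:
  "(\<And>j k. j < n \<Longrightarrow> k < 2 ^ n \<Longrightarrow> h j \<bullet> incr n k F = h j \<bullet> incr n k G) \<Longrightarrow> energy n F = energy n G"
  unfolding energy_def by (intro arg_cong2[where f = "(*)"] sum.cong refl) auto

lemma energy_proj: "n \<le> m \<Longrightarrow> energy n (proj m F) = energy n F"
  by (intro energy_cong h_incr_proj)

text \<open>The projection at level m has the same coordinates at level n as F, and the energy of
  its density is at most \<open>energy m F\<close>.\<close>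

lemma energy_mono:
  assumes "F 0 = 0" "n \<le> m"
  shows "energy n F \<le> energy m F"
  using has_density_energy_le[OF step_energy(1)[of F, OF assms(1)], of n m] step_energy(2)[of F m, OF assms(1)]
    energy_proj[OF assms(2), of F] by simp

text \<open>The midpoint of two projections still interpolates \<open>F\<close> at the coarser level, so its energy is
  bounded below; the parallelogram law then controls the distance of the densities.\<close>

lemma step_diff_energy:
  assumes F: "F 0 = 0" and mn: "n \<le> m"
  shows "(\<integral>\<^sup>+s\<in>{0..1}. ennreal ((norm (step m F s - step n F s))\<^sup>2) \<partial>lborel)
    \<le> ennreal (2 * (energy m F - energy n F))"
proof -
  let ?a = "\<lambda>s. (norm (step m F s))\<^sup>2" and ?b = "\<lambda>s. (norm (step n F s))\<^sup>2"
  define V where "V s = (1/2) *\<^sub>R (step m F s + step n F s)" for s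
  define G where "G t = (1/2) *\<^sub>R (proj m F t + proj n F t)" for t
  have [measurable]: "V \<in> borel_measurable borel" unfolding V_def[abs_def] by measurable
  note Im = step_energy[of F m, OF F] and In = step_energy[of F n, OF F]
  have par: "(norm (x + y))\<^sup>2 + (norm (x - y))\<^sup>2 = 2 * (norm x)\<^sup>2 + 2 * (norm y)\<^sup>2" for x y :: 'h
    by (simp add: power2_norm_eq_inner inner_add_left inner_add_right inner_diff_left inner_diff_right
        inner_commute)
  have V2: "4 * (norm (V s))\<^sup>2 = (norm (step m F s + step n F s))\<^sup>2" for s
    by (simp add: V_def power2_eq_square)
  have intab: "set_integrable lborel {0..1} (\<lambda>s. 2 * ?a s + 2 * ?b s)"
    using Im(4) In(4) by (intro set_integral_add(1)) auto
  have iV: "set_integrable lborel {0..1} (\<lambda>s. (norm (V s))\<^sup>2)"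
    using intab
  proof (rule set_integrable_bound)
    have "(norm (V s))\<^sup>2 \<le> 2 * ?a s + 2 * ?b s" for s
      using V2[of s] par[of "step m F s" "step n F s"] zero_le_power2[of "norm (step m F s - step n F s)"]
        zero_le_power2[of "norm (V s)"] by linarith
    then show "AE s in lborel. s \<in> {0..1} \<longrightarrow> norm ((norm (V s))\<^sup>2) \<le> norm (2 * ?a s + 2 * ?b s)"
      by simp
  qed (simp add: set_borel_measurable_def)
  have dV: "has_density G (\<lambda>s. R (V s)) (\<lambda>s. (norm (V s))\<^sup>2)"
    unfolding has_density_def
  proof (intro conjI ballI iV cm_le_R)
    have iR: "set_integrable lborel {0..1} (\<lambda>s. R (step k F s))" for k
      using step_energy(1)[of F k, OF F] by (simp add: has_density_def)
    have RV: "R (V s) = (1/2) *\<^sub>R R (step m F s) + (1/2) *\<^sub>R R (step n F s)" for s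
      by (simp add: V_def R.scaleR R.add scaleR_add_right)
    show "set_integrable lborel {0..1} (\<lambda>s. R (V s))"
      unfolding RV using iR by (intro set_integral_add(1) set_integrable_scaleR_right)
    show "G t = (LINT s:{0..t}|lborel. R (V s))" if t: "t \<in> {0..1}" for t
    proof -
      have iRt: "set_integrable lborel {0..t} (\<lambda>s. R (step k F s))" for k
        using t by (intro set_integrable_subset[OF iR]) auto
      have "(LINT s:{0..t}|lborel. R (V s))
          = (1/2) *\<^sub>R (LINT s:{0..t}|lborel. R (step m F s)) + (1/2) *\<^sub>R (LINT s:{0..t}|lborel. R (step n F s))"
        unfolding RV using iRt by (subst set_integral_add(2)) auto
      then show ?thesis
        by (simp add: G_def integral_step[of F t, OF F t] scaleR_add_right)
    qed
  qed auto
  have "energy n F = energy n G"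
  proof (rule energy_cong)
    fix j k :: nat assume jk: "j < n" "k < 2 ^ n"
    have "incr n k G = (1/2) *\<^sub>R (incr n k (proj m F) + incr n k (proj n F))"
      by (simp add: incr_def G_def algebra_simps)
    then show "h j \<bullet> incr n k F = h j \<bullet> incr n k G"
      using h_incr_proj[OF mn jk, of F] h_incr_proj[OF order_refl jk, of F]
      by (simp add: inner_add_right)
  qed
  then have low: "energy n F \<le> (LINT s:{0..1}|lborel. (norm (V s))\<^sup>2)"
    using has_density_energy_le[OF dV, of n] by simp
  have diff: "(norm (step m F s - step n F s))\<^sup>2 = 2 * ?a s + 2 * ?b s - 4 * (norm (V s))\<^sup>2" for s
    using par[of "step m F s" "step n F s"] by (simp add: V2)
  have id: "set_integrable lborel {0..1} (\<lambda>s. (norm (step m F s - step n F s))\<^sup>2)"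
    unfolding diff using intab iV by (intro set_integral_diff(1)) auto
  have "(LINT s:{0..1}|lborel. (norm (step m F s - step n F s))\<^sup>2)
      = 2 * (LINT s:{0..1}|lborel. ?a s) + 2 * (LINT s:{0..1}|lborel. ?b s) - 4 * (LINT s:{0..1}|lborel. (norm (V s))\<^sup>2)"
    unfolding diff using Im(4) In(4) intab iV by (simp add: set_integral_diff set_integral_add)
  \<comment> \<open>The bound is 2 E_m + 2 E_n - 4 E_n with E_n = \<open>energy n F\<close>.\<close>
  also have "\<dots> \<le> 2 * (energy m F - energy n F)"
    using low Im(2) In(2) by simp
  finally have le: "(LINT s:{0..1}|lborel. (norm (step m F s - step n F s))\<^sup>2) \<le> 2 * (energy m F - energy n F)" .
  have "(\<integral>\<^sup>+s\<in>{0..1}. ennreal ((norm (step m F s - step n F s))\<^sup>2) \<partial>lborel)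
      = (\<integral>\<^sup>+s. ennreal (indicator {0..1} s *\<^sub>R (norm (step m F s - step n F s))\<^sup>2) \<partial>lborel)"
    by (intro nn_integral_cong) (auto simp: indicator_def)
  also have "\<dots> = ennreal (LINT s:{0..1}|lborel. (norm (step m F s - step n F s))\<^sup>2)"
    using id unfolding set_integrable_def set_lebesgue_integral_def
    by (intro nn_integral_eq_integral) auto
  also have "\<dots> \<le> ennreal (2 * (energy m F - energy n F))" by (rule ennreal_leI[OF le])
  finally show ?thesis .
qed

text \<open>A Riesz-Fischer argument: increasing bounded energies make the step densities Cauchy in
  L2, and a fast subsequence converges almost everywhere. The kernel hypothesis is essential: for Q
  = 0 all energies vanish, whatever F is.\<close>

lemma ex_density_if_energy_le:
  assumes F: "continuous_on {0..1} F" "F 0 = 0"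
    and ker: "\<And>t z. t \<in> {0..1} \<Longrightarrow> Q z = 0 \<Longrightarrow> F t \<bullet> z = 0"
    and B: "\<And>n. energy n F \<le> B"
  obtains V where "V \<in> borel_measurable borel"
    "(\<integral>\<^sup>+s\<in>{0..1}. ennreal ((norm (V s))\<^sup>2) \<partial>lborel) \<le> ennreal B"
    "\<And>t. t \<in> {0..1} \<Longrightarrow> F t = (LINT s:{0..t}|lborel. R (V s))"
proof -
  have B0: "0 \<le> B" using energy_nonneg[of 0 F] B[of 0] by simp
  have inc: "incseq (\<lambda>n. energy n F)"
    using energy_mono[of F, OF F(2)] by (simp add: incseq_def)
  obtain L where L: "(\<lambda>n. energy n F) \<longlonglongrightarrow> L"
    using incseq_convergent[OF inc, of B] B by blast
  have Lge: "energy n F \<le> L" for n by (rule incseq_le[OF inc L])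
  have "\<exists>N. \<forall>n\<ge>N. L - energy n F < (1/4) ^ k / 2" for k :: nat
  proof -
    obtain N where N: "\<And>n. n \<ge> N \<Longrightarrow> norm (energy n F - L) < (1/4) ^ k / 2"
      using LIMSEQ_D[OF L, of "(1/4) ^ k / 2"] by auto
    have "L - energy n F < (1/4) ^ k / 2" if "n \<ge> N" for n
      using N[OF that] Lge[of n] by (simp only: real_norm_def)
    then show ?thesis by blast
  qed
  then obtain N where N: "\<And>k n. n \<ge> N k \<Longrightarrow> L - energy n F < (1/4) ^ k / 2" by metis
  \<comment> \<open>Summing makes r monotone and at least N k; adding k makes it unbounded.\<close>
  define r where "r k = (\<Sum>i\<le>k. N i) + k" for k
  have rN: "r k \<ge> N k" for k
    unfolding r_def by (rule trans_le_add1) (rule member_le_sum[of k]; simp)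
  have rmono: "r k \<le> r l" if "k \<le> l" for k l
    unfolding r_def using that by (intro add_mono sum_mono2) auto
  have rge: "k \<le> r k" for k by (simp add: r_def)
  define v where "v k = step (r k) F" for k
  have [measurable]: "v k \<in> borel_measurable borel" for k by (simp add: v_def)
  have vdiff: "(\<integral>\<^sup>+s\<in>{0..1}. ennreal ((norm (v l s - v k s))\<^sup>2) \<partial>lborel) \<le> ennreal ((1/4) ^ k)"
    if "k \<le> l" for k l
  proof -
    have "2 * (energy (r l) F - energy (r k) F) \<le> (1/4) ^ k"
      using N[OF rN[of k]] Lge[of "r l"] by simp
    then show ?thesis
      unfolding v_def by (intro order_trans[OF step_diff_energy[of F, OF F(2) rmono[OF that]]] ennreal_leI)
  qed
  have vn: "(\<integral>\<^sup>+s\<in>{0..1}. ennreal ((norm (v k s))\<^sup>2) \<partial>lborel) \<le> ennreal B" for k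
    unfolding v_def by (rule order_trans[OF nn_integral_step ennreal_leI[OF B]])
  \<comment> \<open>Young with weight 2^k turns the L2 bound 4^-k into the summable L1 bound
    2^-k.\<close>
  have L1: "(\<integral>\<^sup>+s\<in>{0..1}. ennreal (norm (v (Suc k) s - v k s)) \<partial>lborel) \<le> ennreal ((1/2) ^ k)" for k
  proof -
    have "(\<integral>\<^sup>+s\<in>{0..1}. ennreal (norm (v (Suc k) s - v k s)) \<partial>lborel)
        \<le> (\<integral>\<^sup>+s. ennreal (2 ^ k / 2) * (ennreal ((norm (v (Suc k) s - v k s))\<^sup>2) * indicator {0..1} s)
            + ennreal ((1/2) ^ k / 2) * indicator {0..1} s \<partial>lborel)"
    proof (intro nn_integral_mono)
      fix s
      have "norm (v (Suc k) s - v k s) \<le> 2 ^ k / 2 * (norm (v (Suc k) s - v k s))\<^sup>2 + (1/2) ^ k / 2"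
      proof -
        define x where "x = norm (v (Suc k) s - v k s)"
        have "0 \<le> (2 ^ k * x - 1)\<^sup>2" by simp
        then have "2 * (2 ^ k * x) \<le> 2 ^ k * (2 ^ k * x\<^sup>2) + 1"
          by (simp add: power2_eq_square algebra_simps)
        then have "x \<le> 2 ^ k / 2 * x\<^sup>2 + (1/2) ^ k / 2"
          by (simp add: field_simps)
        then show ?thesis by (simp add: x_def)
      qed
      then show "ennreal (norm (v (Suc k) s - v k s)) * indicator {0..1} s
          \<le> ennreal (2 ^ k / 2) * (ennreal ((norm (v (Suc k) s - v k s))\<^sup>2) * indicator {0..1} s)
            + ennreal ((1/2) ^ k / 2) * indicator {0..1} s"
        by (cases "s \<in> {0..1}") (auto simp flip: ennreal_mult'' ennreal_plus intro: ennreal_leI)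
    qed
    also have "\<dots> = ennreal (2 ^ k / 2) * (\<integral>\<^sup>+s\<in>{0..1}. ennreal ((norm (v (Suc k) s - v k s))\<^sup>2) \<partial>lborel)
        + ennreal ((1/2) ^ k / 2)"
      by (subst nn_integral_add) (auto simp: nn_integral_cmult nn_integral_cmult_indicator)
    also have "\<dots> \<le> ennreal (2 ^ k / 2) * ennreal ((1/4) ^ k) + ennreal ((1/2) ^ k / 2)"
      by (intro add_right_mono mult_left_mono vdiff) auto
    also have "\<dots> = ennreal ((1/2) ^ k)"
    proof -
      have "(2::real) ^ k / 2 * (1/4) ^ k + (1/2) ^ k / 2 = (1/2) ^ k"
        by (simp add: power_divide field_simps flip: power_mult_distrib)
      then show ?thesis by (simp flip: ennreal_mult'' ennreal_plus)
    qed
    finally show ?thesis .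
  qed
  have conv: "AE s in lborel. s \<in> {0..1} \<longrightarrow> convergent (\<lambda>k. v k s)"
  proof -
    have "(\<integral>\<^sup>+s. (\<Sum>k. ennreal (norm (v (Suc k) s - v k s)) * indicator {0..1} s) \<partial>lborel)
        = (\<Sum>k. \<integral>\<^sup>+s\<in>{0..1}. ennreal (norm (v (Suc k) s - v k s)) \<partial>lborel)"
      by (intro nn_integral_suminf) measurable
    also have "\<dots> \<le> (\<Sum>k. ennreal ((1/2) ^ k))"
      by (intro suminf_le L1) auto
    also have "\<dots> = ennreal (\<Sum>k. (1/2) ^ k)"
      by (intro suminf_ennreal2) auto
    also have "\<dots> < \<infinity>" by simp
    finally have "AE s in lborel. (\<Sum>k. ennreal (norm (v (Suc k) s - v k s)) * indicator {0..1} s) \<noteq> \<infinity>"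
      by (intro nn_integral_noteq_infinite) auto
    then show ?thesis
    proof eventually_elim
      case (elim s)
      show ?case
      proof
        assume "s \<in> {0..1}"
        then have "(\<Sum>k. ennreal (norm (v (Suc k) s - v k s))) \<noteq> \<top>"
          using elim by simp
        then have "summable (\<lambda>k. norm (v (Suc k) s - v k s))"
          by (intro summable_suminf_not_top) auto
        then have "summable (\<lambda>k. v (Suc k) s - v k s)"
          by (rule summable_norm_cancel)
        then have "convergent (\<lambda>n. \<Sum>k<n. v (Suc k) s - v k s)"
          by (simp add: summable_iff_convergent)
        then have "convergent (\<lambda>n. (\<Sum>k<n. v (Suc k) s - v k s) + v 0 s)"
          by (intro convergent_add convergent_const)
        then show "convergent (\<lambda>k. v k s)"
          by (simp add: sum_lessThan_telescope[of "\<lambda>k. v k s"])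
      qed
    qed
  qed
  define V where "V s = lim (\<lambda>k. v k s)" for s
  have [measurable]: "V \<in> borel_measurable borel"
    unfolding V_def[abs_def] by measurable
  have lim: "AE s in lborel. s \<in> {0..1} \<longrightarrow> (\<lambda>k. v k s) \<longlonglongrightarrow> V s"
    using conv by eventually_elim (simp add: V_def convergent_LIMSEQ_iff)
  \<comment> \<open>Used with x = 0 for the energy bound on V and with x = v k for the rate of
    convergence.\<close>
  have Fatou: "(\<integral>\<^sup>+s\<in>{0..1}. ennreal ((norm (V s - x s))\<^sup>2) \<partial>lborel) \<le> C"
    if [measurable]: "x \<in> borel_measurable borel"
      and C: "\<And>l. l \<ge> k \<Longrightarrow> (\<integral>\<^sup>+s\<in>{0..1}. ennreal ((norm (v l s - x s))\<^sup>2) \<partial>lborel) \<le> C" for x C k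
  proof -
    have "(\<integral>\<^sup>+s\<in>{0..1}. ennreal ((norm (V s - x s))\<^sup>2) \<partial>lborel)
        = (\<integral>\<^sup>+s. liminf (\<lambda>l. ennreal ((norm (v (l + k) s - x s))\<^sup>2) * indicator {0..1} s) \<partial>lborel)"
    proof (rule nn_integral_cong_AE, use lim in eventually_elim)
      case (elim s)
      show ?case
      proof (cases "s \<in> {0..1}")
        case True
        then have "(\<lambda>l. v (l + k) s) \<longlonglongrightarrow> V s" using elim by (intro LIMSEQ_ignore_initial_segment) blast
        then have "liminf (\<lambda>l. ennreal ((norm (v (l + k) s - x s))\<^sup>2)) = ennreal ((norm (V s - x s))\<^sup>2)"
          by (intro lim_imp_Liminf[OF sequentially_bot] tendsto_intros)
        then show ?thesis using True by simp
      qed (simp add: Liminf_const)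
    qed
    also have "\<dots> \<le> liminf (\<lambda>l. \<integral>\<^sup>+s\<in>{0..1}. ennreal ((norm (v (l + k) s - x s))\<^sup>2) \<partial>lborel)"
      by (intro nn_integral_liminf) measurable
    also have "\<dots> \<le> liminf (\<lambda>l. C)"
      by (intro Liminf_mono always_eventually allI C) simp
    also have "\<dots> = C" by (simp add: Liminf_const)
    finally show ?thesis .
  qed
  have VB: "(\<integral>\<^sup>+s\<in>{0..1}. ennreal ((norm (V s))\<^sup>2) \<partial>lborel) \<le> ennreal B"
    using Fatou[of "\<lambda>_. 0" 0 "ennreal B"] vn by simp
  define G where "G t = (LINT s:{0..t}|lborel. R (V s))" for t
  have dG: "has_density G (\<lambda>s. R (V s)) (\<lambda>s. (norm (V s))\<^sup>2)"
    by (rule has_density_R(1)[OF _ VB B0]) (simp_all add: G_def)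
  have Gdiff: "norm (G t - proj (r k) F t) \<le> sqrt ((1/4) ^ k * tail_trace 0)" if t: "t \<in> {0..1}" for k t
  proof -
    define D where "D t = (LINT s:{0..t}|lborel. R (V s - v k s))" for t
    have VD: "(\<integral>\<^sup>+s\<in>{0..1}. ennreal ((norm (V s - v k s))\<^sup>2) \<partial>lborel) \<le> ennreal ((1/4) ^ k)"
      by (rule Fatou[of _ k]) (auto intro: vdiff)
    have "has_energy D ((1/4) ^ k)"
      unfolding has_energy_def
      using has_density_R(1,2)[of "\<lambda>s. V s - v k s" "(1/4) ^ k" D] VD by (auto simp: D_def)
    then have "cm_le (D t) ((1/4) ^ k)" using t by (rule has_energy_cm_le_value)
    then have "(norm (D t))\<^sup>2 \<le> (1/4) ^ k * tail_trace 0" by (rule cm_le_norm) simp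
    moreover have "D t = G t - proj (r k) F t"
    proof -
      have "set_integrable lborel {0..t} (\<lambda>s. R (V s))" "set_integrable lborel {0..t} (\<lambda>s. R (v k s))"
        using dG step_energy(1)[of F "r k", OF F(2)] t
        by (auto simp: has_density_def v_def intro: set_integrable_subset)
      then have "D t = (LINT s:{0..t}|lborel. R (V s)) - (LINT s:{0..t}|lborel. R (v k s))"
        unfolding D_def R.diff by (rule set_integral_diff(2))
      then show ?thesis by (simp add: G_def v_def integral_step[of F t, OF F(2) t])
    qed
    ultimately show ?thesis by (metis real_le_rsqrt)
  qed
  have "F t = G t" if t: "t \<in> {0..1}" for t
  proof -
    have "(\<lambda>k. sqrt ((1/4) ^ k * tail_trace 0)) \<longlonglongrightarrow> sqrt (0 * tail_trace 0)"
      by (intro tendsto_intros LIMSEQ_realpow_zero) auto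
    then have "(\<lambda>k. G t - proj (r k) F t) \<longlonglongrightarrow> 0"
      by (intro Lim_null_comparison[OF always_eventually[OF allI[OF Gdiff[OF t]]]]) simp
    then have "(\<lambda>k. G t - (G t - proj (r k) F t)) \<longlonglongrightarrow> G t - 0"
      by (intro tendsto_intros)
    then have lim1: "(\<lambda>k. proj (r k) F t) \<longlonglongrightarrow> G t" by simp
    \<comment> \<open>The two limits are compared along each \<open>e i\<close>: once r k > i,
      \<open>P (r k)\<close> does not change the pairing of \<open>e i\<close> with vectors
      orthogonal to the kernel of Q.\<close>
    have "e i \<bullet> (F t - G t) = 0" for i
    proof -
      have "(\<lambda>k. proj (r k) F t \<bullet> e i) \<longlonglongrightarrow> G t \<bullet> e i"
        by (intro tendsto_intros lim1)
      moreover have "(\<lambda>k. proj (r k) F t \<bullet> e i) \<longlonglongrightarrow> F t \<bullet> e i"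
      proof (rule Lim_transform_eventually)
        have "filterlim r at_top sequentially"
          by (rule filterlim_at_top_mono[OF filterlim_ident]) (simp add: rge)
        then have "(\<lambda>k. polygon (r k) F t) \<longlonglongrightarrow> F t"
          by (rule filterlim_compose[OF polygon_tendsto[OF F(1) t]])
        then show "(\<lambda>k. polygon (r k) F t \<bullet> e i) \<longlonglongrightarrow> F t \<bullet> e i"
          by (intro tendsto_intros)
        have "polygon n F t \<bullet> z = 0" if "Q z = 0" for n z
        proof -
          have "incr n k F \<bullet> z = 0" if "k < 2 ^ n" for k
            using ker[OF _ \<open>Q z = 0\<close>] dyadic_bounds[OF that] by (simp add: incr_def inner_diff_left del: of_nat_Suc)
          then show ?thesis by (simp add: polygon_def F(2) inner_sum_left)
        qed
        then have "polygon (r k) F t \<bullet> e i = proj (r k) F t \<bullet> e i" if "k > i" for k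
          unfolding proj_def using that rge[of k] by (intro inner_P_e_eq[symmetric]) auto
        then show "\<forall>\<^sub>F k in sequentially. polygon (r k) F t \<bullet> e i = proj (r k) F t \<bullet> e i"
          by (rule eventually_mono[OF eventually_gt_at_top[of i]])
      qed
      ultimately have "G t \<bullet> e i = F t \<bullet> e i" by (rule LIMSEQ_unique)
      then show ?thesis by (simp add: inner_diff_right inner_commute)
    qed
    then show ?thesis using eq_0_if_orthogonal_e[of "F t - G t"] by simp
  qed
  then show ?thesis
    by (intro that[of V]) (auto simp: VB G_def)
qed

text \<open>Each condition on the right survives pointwise limits of paths, so lower semicontinuity
  of the rate function can be read off; the existence of a density yields the converse.\<close>

lemma wiener_rate_le_iff:
  assumes F: "continuous_on {0..1} F" and C: "0 \<le> C"
  shows "wiener_rate Q F \<le> ennreal C \<longleftrightarrow>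
    F 0 = 0 \<and> (\<forall>t\<in>{0..1}. \<forall>z. Q z = 0 \<longrightarrow> F t \<bullet> z = 0) \<and> (\<forall>n. energy n F \<le> 2 * C)"
proof
  assume le: "wiener_rate Q F \<le> ennreal C"
  \<comment> \<open>Near-minimisers suffice, since the slack d is removed afterwards in the bound on
    each energy.\<close>
  have ex: "\<exists>B. has_energy F B \<and> B / 2 < C + d" if "d > 0" for d
  proof -
    have "wiener_rate Q F < ennreal (C + d)"
      using le that C by (meson ennreal_lessI le_less_trans less_add_same_cancel1 add_pos_nonneg add.commute add_nonneg_pos)
    then obtain B where B: "has_energy F B" "ennreal (B / 2) < ennreal (C + d)"
      using has_energy_if_wiener_rate_less by blast
    then show ?thesis
      using has_energy_nonneg[OF B(1)] by (auto simp: ennreal_less_iff)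
  qed
  then obtain B where B: "has_energy F B" by (meson zero_less_one)
  have "energy n F \<le> 2 * C" for n
  proof (rule field_le_epsilon)
    fix d :: real assume "d > 0"
    then obtain B where "has_energy F B" "B / 2 < C + d / 2" using ex[of "d / 2"] by auto
    then show "energy n F \<le> 2 * C + d" using has_energy_energy_le[of F B n] by simp
  qed
  then show "F 0 = 0 \<and> (\<forall>t\<in>{0..1}. \<forall>z. Q z = 0 \<longrightarrow> F t \<bullet> z = 0) \<and> (\<forall>n. energy n F \<le> 2 * C)"
    using has_energy_0[OF B] cm_le_orthogonal_kernel[OF has_energy_cm_le_value[OF B]] by blast
next
  assume R: "F 0 = 0 \<and> (\<forall>t\<in>{0..1}. \<forall>z. Q z = 0 \<longrightarrow> F t \<bullet> z = 0) \<and> (\<forall>n. energy n F \<le> 2 * C)"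
  then obtain V where V: "V \<in> borel_measurable borel"
    "(\<integral>\<^sup>+s\<in>{0..1}. ennreal ((norm (V s))\<^sup>2) \<partial>lborel) \<le> ennreal (2 * C)"
    "\<And>t. t \<in> {0..1} \<Longrightarrow> F t = (LINT s:{0..t}|lborel. R (V s))"
    using ex_density_if_energy_le[OF F, of "2 * C"] by blast
  then show "wiener_rate Q F \<le> ennreal C"
    using wiener_rate_le[of V "2 * C" F] C by simp
qed

lemma has_energy_if_wiener_rate_le:
  assumes "wiener_rate Q F \<le> ennreal C" "0 \<le> C" "d > 0"
  shows "has_energy F (2 * C + d)"
proof -
  have "wiener_rate Q F < ennreal (C + d / 2)"
    using assms by (intro le_less_trans[OF assms(1)] ennreal_lessI) auto
  then obtain B where B: "has_energy F B" "ennreal (B / 2) < ennreal (C + d / 2)"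
    using has_energy_if_wiener_rate_less by blast
  then have "B \<le> 2 * C + d"
    using has_energy_nonneg[OF B(1)] by (auto simp: ennreal_less_iff)
  then show ?thesis using B(1) unfolding has_energy_def by (meson order_trans)
qed

end

section \<open>Exponential moments of Gaussian functionals\<close>

lemma nn_integral_normal_density: "\<sigma> > 0 \<Longrightarrow> (\<integral>\<^sup>+x. ennreal (normal_density \<mu> \<sigma> x) \<partial>lborel) = 1"
  using prob_space.emeasure_space_1[OF prob_space_normal_density[of \<sigma> \<mu>]]
  by (simp add: emeasure_density)

lemma nn_integral_std_normal_exp:
  "(\<integral>\<^sup>+z. ennreal (exp (a * z)) \<partial>std_normal_distribution) = ennreal (exp (a\<^sup>2 / 2))"
proof -
  have "std_normal_density z * exp (a * z) = exp (a\<^sup>2 / 2) * normal_density a 1 z" for z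
  proof -
    have "- (z\<^sup>2 / 2) + a * z = a\<^sup>2 / 2 + - ((z - a)\<^sup>2 / 2)"
      by (simp add: power2_eq_square field_simps)
    then have "exp (- (z\<^sup>2 / 2)) * exp (a * z) = exp (a\<^sup>2 / 2) * exp (- ((z - a)\<^sup>2 / 2))"
      by (simp flip: exp_add)
    then show ?thesis by (simp add: normal_density_def)
  qed
  then have "(\<integral>\<^sup>+z. ennreal (exp (a * z)) \<partial>std_normal_distribution)
      = (\<integral>\<^sup>+z. ennreal (exp (a\<^sup>2 / 2)) * ennreal (normal_density a 1 z) \<partial>lborel)"
    by (subst nn_integral_density) (auto simp flip: ennreal_mult'')
  also have "\<dots> = ennreal (exp (a\<^sup>2 / 2))"
    by (subst nn_integral_cmult) (auto simp: nn_integral_normal_density)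
  finally show ?thesis .
qed

lemma nn_integral_std_normal_exp_square:
  assumes "s < 1"
  shows "(\<integral>\<^sup>+z. ennreal (exp (s * z\<^sup>2 / 2)) \<partial>std_normal_distribution) = ennreal (1 / sqrt (1 - s))"
proof -
  let ?\<sigma> = "1 / sqrt (1 - s)"
  have "std_normal_density z * exp (s * z\<^sup>2 / 2) = ?\<sigma> * normal_density 0 ?\<sigma> z" for z
  proof -
    have "- (z\<^sup>2 / 2) + s * z\<^sup>2 / 2 = - (z\<^sup>2 * (1 - s) / 2)"
      by (simp add: field_simps)
    then have "exp (- (z\<^sup>2 / 2)) * exp (s * z\<^sup>2 / 2) = exp (- (z\<^sup>2 * (1 - s) / 2))"
      by (simp flip: exp_add)
    moreover have "sqrt (2 * pi / (1 - s)) = sqrt (2 * pi) * ?\<sigma>"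
      by (simp add: real_sqrt_divide)
    ultimately show ?thesis using assms by (simp add: normal_density_def power_divide)
  qed
  then have "(\<integral>\<^sup>+z. ennreal (exp (s * z\<^sup>2 / 2)) \<partial>std_normal_distribution)
      = (\<integral>\<^sup>+z. ennreal ?\<sigma> * ennreal (normal_density 0 ?\<sigma> z) \<partial>lborel)"
    using assms by (subst nn_integral_density) (auto simp flip: ennreal_mult)
  also have "\<dots> = ennreal ?\<sigma>"
    using assms by (subst nn_integral_cmult) (auto simp: nn_integral_normal_density)
  finally show ?thesis .
qed

section \<open>Exponential moments, Chernoff bounds and tilting\<close>

context prob_space
begin

text \<open>Uniqueness of characteristic functions on the line identifies the law of X with that of
  a scaled standard normal, whose moment generating function is explicit.\<close>

lemma nn_integral_exp_if_gaussian_char: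
  fixes X :: "'a \<Rightarrow> real"
  assumes X [measurable]: "X \<in> borel_measurable M" and v: "v \<ge> 0"
    and char: "\<And>a. (LINT \<omega>|M. exp (\<i> * complex_of_real (a * X \<omega>))) = exp (- complex_of_real (a\<^sup>2 * v / 2))"
  shows "(\<integral>\<^sup>+\<omega>. ennreal (exp (a * X \<omega>)) \<partial>M) = ennreal (exp (a\<^sup>2 * v / 2))"
proof -
  interpret G: real_distribution std_normal_distribution
    by (rule real_dist_normal_dist)
  \<comment> \<open>An image measure instead of a normal density covers v = 0.\<close>
  let ?N = "distr std_normal_distribution borel (\<lambda>z. sqrt v * z)"
  have "distr M borel X = ?N"
  proof (rule Levy_uniqueness)
    show "real_distribution (distr M borel X)" by (rule real_distribution_distr) simp
    show "real_distribution ?N" by (rule G.real_distribution_distr) simp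
    show "char (distr M borel X) = char ?N"
    proof
      fix t
      have "char (distr M borel X) t = exp (- complex_of_real (t\<^sup>2 * v / 2))"
        using char[of t] by (simp add: char_def integral_distr mult.commute)
      moreover have "char ?N t = char std_normal_distribution (t * sqrt v)"
        by (simp add: char_def integral_distr mult.assoc)
      moreover have "\<dots> = complex_of_real (exp (- ((t * sqrt v)\<^sup>2) / 2))"
        by (simp add: char_std_normal_distribution)
      moreover have "(t * sqrt v)\<^sup>2 = t\<^sup>2 * v" using v by (simp add: power_mult_distrib)
      ultimately show "char (distr M borel X) t = char ?N t"
        by (simp add: exp_of_real[symmetric])
    qed
  qed
  then have "(\<integral>\<^sup>+x. ennreal (exp (a * x)) \<partial>distr M borel X) = (\<integral>\<^sup>+x. ennreal (exp (a * x)) \<partial>?N)"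
    by simp
  then have "(\<integral>\<^sup>+\<omega>. ennreal (exp (a * X \<omega>)) \<partial>M)
      = (\<integral>\<^sup>+z. ennreal (exp ((a * sqrt v) * z)) \<partial>std_normal_distribution)"
    by (simp add: nn_integral_distr mult.assoc)
  also have "\<dots> = ennreal (exp ((a * sqrt v)\<^sup>2 / 2))"
    by (rule nn_integral_std_normal_exp)
  also have "(a * sqrt v)\<^sup>2 = a\<^sup>2 * v" using v by (simp add: power_mult_distrib)
  finally show ?thesis .
qed

text \<open>Each factor \<open>exp (c \<xi>\<^sup>2 / 2)\<close> is linearised as a Gaussian mixture of exponentials \<open>exp (\<surd>c z \<xi>)\<close>, so only the
  moment generating function of linear combinations enters.\<close>

lemma nn_integral_exp_sum_squares_aux:
  fixes \<xi> :: "'i \<Rightarrow> 'a \<Rightarrow> real"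
  assumes J: "finite J" and [measurable]: "\<And>i. \<xi> i \<in> borel_measurable M"
    and mgf: "\<And>y. (\<integral>\<^sup>+\<omega>. ennreal (exp (\<Sum>i\<in>J. y i * \<xi> i \<omega>)) \<partial>M) \<le> ennreal (exp ((\<Sum>i\<in>J. (y i)\<^sup>2) / 2))"
    and c: "0 \<le> c" "c < 1" and S: "finite S" "S \<subseteq> J"
  shows "(\<integral>\<^sup>+\<omega>. ennreal (exp (c / 2 * (\<Sum>i\<in>S. (\<xi> i \<omega>)\<^sup>2) + (\<Sum>i\<in>J - S. y i * \<xi> i \<omega>))) \<partial>M)
    \<le> ennreal ((1 / sqrt (1 - c)) ^ card S * exp ((\<Sum>i\<in>J - S. (y i)\<^sup>2) / 2))"
  using S
proof (induction S arbitrary: y rule: finite_induct)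
  case empty
  then show ?case using mgf by simp
next
  case (insert j S)
  interpret G: prob_space std_normal_distribution
    by (rule prob_space_normal_density) simp
  interpret pair_sigma_finite std_normal_distribution M ..
  \<comment> \<open>Coordinate j leaves the squares and joins the linear part with the random weight
    \<open>sqrt c * z\<close>; the induction therefore needs y arbitrary.\<close>
  let ?K = "(1 / sqrt (1 - c)) ^ card S" and ?y = "\<lambda>z. y(j := sqrt c * z)"
  let ?Y = "\<Sum>i\<in>J - insert j S. (y i)\<^sup>2"
  have jS: "J - S = insert j (J - insert j S)" "j \<notin> J - insert j S" "finite (J - insert j S)"
    using insert J by auto
  have lin: "(\<Sum>i\<in>J - S. ?y z i * \<xi> i \<omega>) = sqrt c * z * \<xi> j \<omega> + (\<Sum>i\<in>J - insert j S. y i * \<xi> i \<omega>)" for z \<omega>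
    unfolding jS(1) by (subst sum.insert[OF jS(3,2)]) (auto intro!: sum.cong)
  have sq: "(\<Sum>i\<in>J - S. (?y z i)\<^sup>2) = c * z\<^sup>2 + ?Y" for z
    unfolding jS(1) using c by (subst sum.insert[OF jS(3,2)]) (auto intro!: sum.cong simp: power_mult_distrib)
  have "ennreal (exp (c / 2 * (\<Sum>i\<in>insert j S. (\<xi> i \<omega>)\<^sup>2) + (\<Sum>i\<in>J - insert j S. y i * \<xi> i \<omega>)))
      = (\<integral>\<^sup>+z. ennreal (exp (c / 2 * (\<Sum>i\<in>S. (\<xi> i \<omega>)\<^sup>2) + (\<Sum>i\<in>J - S. ?y z i * \<xi> i \<omega>))) \<partial>std_normal_distribution)"
    for \<omega>
  proof -
    have "(\<integral>\<^sup>+z. ennreal (exp (c / 2 * (\<Sum>i\<in>S. (\<xi> i \<omega>)\<^sup>2) + (\<Sum>i\<in>J - S. ?y z i * \<xi> i \<omega>))) \<partial>std_normal_distribution)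
        = (\<integral>\<^sup>+z. ennreal (exp (c / 2 * (\<Sum>i\<in>S. (\<xi> i \<omega>)\<^sup>2) + (\<Sum>i\<in>J - insert j S. y i * \<xi> i \<omega>)))
            * ennreal (exp ((sqrt c * \<xi> j \<omega>) * z)) \<partial>std_normal_distribution)"
      unfolding lin by (intro nn_integral_cong) (simp add: exp_add mult_ac flip: ennreal_mult'')
    also have "\<dots> = ennreal (exp (c / 2 * (\<Sum>i\<in>S. (\<xi> i \<omega>)\<^sup>2) + (\<Sum>i\<in>J - insert j S. y i * \<xi> i \<omega>)))
        * ennreal (exp ((sqrt c * \<xi> j \<omega>)\<^sup>2 / 2))"
      by (subst nn_integral_cmult) (auto simp: nn_integral_std_normal_exp)
    also have "\<dots> = ennreal (exp (c / 2 * (\<Sum>i\<in>insert j S. (\<xi> i \<omega>)\<^sup>2) + (\<Sum>i\<in>J - insert j S. y i * \<xi> i \<omega>)))"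
      using insert c by (simp add: power_mult_distrib distrib_left exp_add mult_ac flip: ennreal_mult'')
    finally show ?thesis by simp
  qed
  then have "(\<integral>\<^sup>+\<omega>. ennreal (exp (c / 2 * (\<Sum>i\<in>insert j S. (\<xi> i \<omega>)\<^sup>2) + (\<Sum>i\<in>J - insert j S. y i * \<xi> i \<omega>))) \<partial>M)
      = (\<integral>\<^sup>+\<omega>. (\<integral>\<^sup>+z. ennreal (exp (c / 2 * (\<Sum>i\<in>S. (\<xi> i \<omega>)\<^sup>2) + (\<Sum>i\<in>J - S. ?y z i * \<xi> i \<omega>))) \<partial>std_normal_distribution) \<partial>M)"
    by simp
  also have "\<dots> = (\<integral>\<^sup>+z. (\<integral>\<^sup>+\<omega>. ennreal (exp (c / 2 * (\<Sum>i\<in>S. (\<xi> i \<omega>)\<^sup>2) + (\<Sum>i\<in>J - S. ?y z i * \<xi> i \<omega>))) \<partial>M) \<partial>std_normal_distribution)"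
    unfolding lin by (intro Fubini') measurable
  also have "\<dots> \<le> (\<integral>\<^sup>+z. ennreal (?K * exp (?Y / 2)) * ennreal (exp (c * z\<^sup>2 / 2)) \<partial>std_normal_distribution)"
  proof (intro nn_integral_mono)
    fix z
    have "(\<integral>\<^sup>+\<omega>. ennreal (exp (c / 2 * (\<Sum>i\<in>S. (\<xi> i \<omega>)\<^sup>2) + (\<Sum>i\<in>J - S. ?y z i * \<xi> i \<omega>))) \<partial>M)
        \<le> ennreal (?K * exp ((\<Sum>i\<in>J - S. (?y z i)\<^sup>2) / 2))"
      by (rule insert.IH) (use insert.prems in auto)
    also have "\<dots> = ennreal (?K * exp (?Y / 2)) * ennreal (exp (c * z\<^sup>2 / 2))"
      unfolding sq using c by (simp add: add_divide_distrib exp_add mult_ac flip: ennreal_mult'')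
    finally show "(\<integral>\<^sup>+\<omega>. ennreal (exp (c / 2 * (\<Sum>i\<in>S. (\<xi> i \<omega>)\<^sup>2) + (\<Sum>i\<in>J - S. ?y z i * \<xi> i \<omega>))) \<partial>M)
        \<le> ennreal (?K * exp (?Y / 2)) * ennreal (exp (c * z\<^sup>2 / 2))" .
  qed
  \<comment> \<open>Integrating out z is where c < 1 enters; each square costs a factor
    \<open>1 / sqrt (1 - c)\<close>.\<close>
  also have "\<dots> = ennreal (?K * exp (?Y / 2)) * ennreal (1 / sqrt (1 - c))"
    using c by (subst nn_integral_cmult) (auto simp: nn_integral_std_normal_exp_square)
  also have "\<dots> = ennreal ((1 / sqrt (1 - c)) ^ card (insert j S) * exp (?Y / 2))"
    using insert c by (simp add: mult_ac flip: ennreal_mult'')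
  finally show ?case .
qed

lemma nn_integral_exp_sum_squares:
  fixes \<xi> :: "'i \<Rightarrow> 'a \<Rightarrow> real"
  assumes "finite J" "\<And>i. \<xi> i \<in> borel_measurable M"
    and "\<And>y. (\<integral>\<^sup>+\<omega>. ennreal (exp (\<Sum>i\<in>J. y i * \<xi> i \<omega>)) \<partial>M) \<le> ennreal (exp ((\<Sum>i\<in>J. (y i)\<^sup>2) / 2))"
    and "0 \<le> c" "c < 1"
  shows "(\<integral>\<^sup>+\<omega>. ennreal (exp (c / 2 * (\<Sum>i\<in>J. (\<xi> i \<omega>)\<^sup>2))) \<partial>M) \<le> ennreal ((1 / sqrt (1 - c)) ^ card J)"
  using nn_integral_exp_sum_squares_aux[OF assms assms(1) order_refl] by simp

text \<open>The case c = 1/2 for one coordinate, which explains the constants 4 and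
  \<open>sqrt 2\<close>. Only an upper bound on the moment generating function is assumed, so r may
  exceed the variance.\<close>

lemma nn_integral_exp_square:
  fixes \<xi> :: "'a \<Rightarrow> real"
  assumes [measurable]: "\<xi> \<in> borel_measurable M" and r: "r > 0"
    and mgf: "\<And>y. (\<integral>\<^sup>+\<omega>. ennreal (exp (y * \<xi> \<omega>)) \<partial>M) \<le> ennreal (exp (y\<^sup>2 * r / 2))"
  shows "(\<integral>\<^sup>+\<omega>. ennreal (exp ((\<xi> \<omega>)\<^sup>2 / (4 * r))) \<partial>M) \<le> ennreal (sqrt 2)"
proof -
  have "(\<integral>\<^sup>+\<omega>. ennreal (exp ((1/2) / 2 * (\<Sum>i\<in>{()}. (\<xi> \<omega> / sqrt r)\<^sup>2))) \<partial>M)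
      \<le> ennreal ((1 / sqrt (1 - 1/2)) ^ card {()})"
  proof (rule nn_integral_exp_sum_squares)
    fix y :: "unit \<Rightarrow> real"
    show "(\<integral>\<^sup>+\<omega>. ennreal (exp (\<Sum>i\<in>{()}. y i * (\<xi> \<omega> / sqrt r))) \<partial>M) \<le> ennreal (exp ((\<Sum>i\<in>{()}. (y i)\<^sup>2) / 2))"
      using mgf[of "y () / sqrt r"] r by (simp add: power_divide)
  qed auto
  then show ?thesis
    using r by (simp add: power_divide real_sqrt_divide field_simps)
qed

lemma nn_integral_Chernoff:
  assumes [measurable]: "f \<in> borel_measurable M"
    and le: "(\<integral>\<^sup>+\<omega>. ennreal (exp (f \<omega>)) \<partial>M) \<le> ennreal B" "0 \<le> B"
  shows "prob {\<omega>\<in>space M. f \<omega> \<ge> a} \<le> B * exp (- a)"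
proof -
  have "emeasure M {\<omega>\<in>space M. f \<omega> \<ge> a} = (\<integral>\<^sup>+\<omega>. indicator {\<omega>\<in>space M. f \<omega> \<ge> a} \<omega> \<partial>M)"
    by simp
  also have "\<dots> \<le> (\<integral>\<^sup>+\<omega>. ennreal (exp (- a)) * ennreal (exp (f \<omega>)) \<partial>M)"
    by (intro nn_integral_mono) (auto simp: indicator_def one_ennreal_def[symmetric] ennreal_1[symmetric]
        simp del: ennreal_1 simp flip: ennreal_mult'' exp_add intro!: ennreal_leI)
  also have "\<dots> \<le> ennreal (exp (- a)) * ennreal B"
    by (subst nn_integral_cmult) (auto intro: mult_left_mono le)
  finally have "ennreal (prob {\<omega>\<in>space M. f \<omega> \<ge> a}) \<le> ennreal (B * exp (- a))"
    using le(2) by (simp add: emeasure_eq_measure mult.commute flip: ennreal_mult'')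
  then show ?thesis using le(2) by (simp add: ennreal_le_iff)
qed

text \<open>Under the tilt \<open>exp (\<Sum>i. a i * \<xi> i / \<surd>\<epsilon>)\<close> the vector \<open>\<surd>\<epsilon> \<xi>\<close> concentrates at \<open>a\<close>.\<close>

lemma gaussian_vector_lower_bound:
  fixes \<xi> :: "'i \<Rightarrow> 'a \<Rightarrow> real" and a \<kappa> :: "'i \<Rightarrow> real"
  assumes J: "finite J" and [measurable]: "\<And>i. \<xi> i \<in> borel_measurable M"
    and mgf: "\<And>y. (\<integral>\<^sup>+\<omega>. ennreal (exp (\<Sum>i\<in>J. y i * \<xi> i \<omega>)) \<partial>M) = ennreal (exp ((\<Sum>i\<in>J. (y i)\<^sup>2 * \<kappa> i) / 2))"
    and \<kappa>: "\<And>i. i \<in> J \<Longrightarrow> 0 \<le> \<kappa> i \<and> \<kappa> i \<le> 1 \<and> \<kappa> i * a i = a i"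
    and pos: "\<epsilon> > 0" "\<delta> > 0"
    and small: "2 * card J * exp (- \<delta>\<^sup>2 / (2 * \<epsilon>)) \<le> 1 / 2"
  shows "prob {\<omega>\<in>space M. \<forall>i\<in>J. \<bar>sqrt \<epsilon> * \<xi> i \<omega> - a i\<bar> \<le> \<delta>}
    \<ge> 1 / 2 * exp (- ((\<Sum>i\<in>J. (a i)\<^sup>2) / 2 + \<delta> * (\<Sum>i\<in>J. \<bar>a i\<bar>)) / \<epsilon>)"
proof -
  define A where "A = (\<Sum>i\<in>J. (a i)\<^sup>2)"
  define A1 where "A1 = (\<Sum>i\<in>J. \<bar>a i\<bar>)"
  define \<theta> where "\<theta> \<omega> = (\<Sum>i\<in>J. a i / sqrt \<epsilon> * \<xi> i \<omega>)" for \<omega>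
  define good where "good = {\<omega>\<in>space M. \<forall>i\<in>J. \<bar>sqrt \<epsilon> * \<xi> i \<omega> - a i\<bar> \<le> \<delta>}"
  define bad where "bad i = {\<omega>\<in>space M. \<bar>sqrt \<epsilon> * \<xi> i \<omega> - a i\<bar> > \<delta>}" for i
  define Z where "Z = exp (A / (2 * \<epsilon>))"
  have [measurable]: "\<theta> \<in> borel_measurable M" unfolding \<theta>_def[abs_def] by measurable
  have [measurable]: "good \<in> sets M" unfolding good_def using J by measurable
  have [measurable]: "bad i \<in> sets M" for i unfolding bad_def by measurable
  have EZ: "(\<integral>\<^sup>+\<omega>. ennreal (exp (\<theta> \<omega>)) \<partial>M) = ennreal Z"
  proof -
    \<comment> \<open>Here \<kappa> i is a variance, and \<open>\<kappa> i * a i = a i\<close>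
      forces a i = 0 unless it equals 1; no tilt is spent on a degenerate coordinate.\<close>
    have "(\<Sum>i\<in>J. (a i / sqrt \<epsilon>)\<^sup>2 * \<kappa> i) = A / \<epsilon>"
      unfolding A_def sum_divide_distrib using \<kappa> pos
      by (intro sum.cong refl) (simp add: power_divide power2_eq_square mult.assoc mult.commute[of _ "\<kappa> _"])
    then show ?thesis unfolding \<theta>_def using mgf[of "\<lambda>i. a i / sqrt \<epsilon>"] by (simp add: Z_def mult.commute)
  qed
  have tilt: "(\<integral>\<^sup>+\<omega>. ennreal (exp (\<theta> \<omega> + y * (sqrt \<epsilon> * \<xi> j \<omega> - a j))) \<partial>M) \<le> ennreal (Z * exp (\<epsilon> * y\<^sup>2 / 2))"
    if j: "j \<in> J" for j y
  proof -
    let ?y = "\<lambda>i. a i / sqrt \<epsilon> + (if i = j then y * sqrt \<epsilon> else 0)"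
    have lin: "(\<Sum>i\<in>J. ?y i * \<xi> i \<omega>) = \<theta> \<omega> + y * sqrt \<epsilon> * \<xi> j \<omega>" for \<omega>
      using J j by (simp add: \<theta>_def distrib_right sum.distrib if_distrib[where f = "\<lambda>x. x * _"] cong: if_cong)
    have "(\<Sum>i\<in>J. (?y i)\<^sup>2 * \<kappa> i)
        = (\<Sum>i\<in>J. (a i)\<^sup>2 / \<epsilon> + (if i = j then 2 * a i * y + \<kappa> i * y\<^sup>2 * \<epsilon> else 0))"
    proof (intro sum.cong refl)
      fix i assume i: "i \<in> J"
      have s: "sqrt \<epsilon> * sqrt \<epsilon> = \<epsilon>" "sqrt \<epsilon> \<noteq> 0" using pos by auto
      have k: "\<kappa> i * a i = a i" using \<kappa>[OF i] by simp
      have "(a i / sqrt \<epsilon>)\<^sup>2 * \<kappa> i = a i * (\<kappa> i * a i) / (sqrt \<epsilon> * sqrt \<epsilon>)"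
        by (simp add: power2_eq_square)
      then have 1: "(a i / sqrt \<epsilon>)\<^sup>2 * \<kappa> i = (a i)\<^sup>2 / \<epsilon>"
        unfolding k s by (simp add: power2_eq_square)
      have "(a i / sqrt \<epsilon> + y * sqrt \<epsilon>)\<^sup>2 * \<kappa> i
          = (a i / sqrt \<epsilon>)\<^sup>2 * \<kappa> i + 2 * (\<kappa> i * a i) * y + \<kappa> i * y\<^sup>2 * (sqrt \<epsilon> * sqrt \<epsilon>)"
      proof -
        have "(b / q + y * q)\<^sup>2 * k = (b / q)\<^sup>2 * k + 2 * (k * b) * y + k * y\<^sup>2 * (q * q)"
          if "q \<noteq> 0" for b q k :: real
          using that by (simp add: power2_eq_square field_simps)
        then show ?thesis using s(2) by blast
      qed
      then have 2: "(a i / sqrt \<epsilon> + y * sqrt \<epsilon>)\<^sup>2 * \<kappa> i = (a i)\<^sup>2 / \<epsilon> + 2 * a i * y + \<kappa> i * y\<^sup>2 * \<epsilon>"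
        unfolding 1 k s .
      show "(?y i)\<^sup>2 * \<kappa> i = (a i)\<^sup>2 / \<epsilon> + (if i = j then 2 * a i * y + \<kappa> i * y\<^sup>2 * \<epsilon> else 0)"
        using 1 2 by auto
    qed
    also have "\<dots> = A / \<epsilon> + (2 * a j * y + \<kappa> j * y\<^sup>2 * \<epsilon>)"
      using J j by (simp add: sum.distrib A_def sum_divide_distrib)
    finally have sq: "(\<Sum>i\<in>J. (?y i)\<^sup>2 * \<kappa> i) = A / \<epsilon> + (2 * a j * y + \<kappa> j * y\<^sup>2 * \<epsilon>)" .
    have "(\<integral>\<^sup>+\<omega>. ennreal (exp (\<theta> \<omega> + y * (sqrt \<epsilon> * \<xi> j \<omega> - a j))) \<partial>M)
        = (\<integral>\<^sup>+\<omega>. ennreal (exp (- y * a j)) * ennreal (exp (\<Sum>i\<in>J. ?y i * \<xi> i \<omega>)) \<partial>M)"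
      unfolding lin by (intro nn_integral_cong) (simp add: right_diff_distrib mult_ac flip: ennreal_mult'' exp_add)
    also have "\<dots> = ennreal (exp (- y * a j)) * ennreal (exp ((A / \<epsilon> + (2 * a j * y + \<kappa> j * y\<^sup>2 * \<epsilon>)) / 2))"
      by (subst nn_integral_cmult) (auto simp: mgf sq)
    also have "\<dots> = ennreal (exp (A / (2 * \<epsilon>) + \<kappa> j * y\<^sup>2 * \<epsilon> / 2))"
    proof -
      have "- y * a j + (A / \<epsilon> + (2 * a j * y + \<kappa> j * y\<^sup>2 * \<epsilon>)) / 2 = A / (2 * \<epsilon>) + \<kappa> j * y\<^sup>2 * \<epsilon> / 2"
        by (simp add: add_divide_distrib)
      then show ?thesis by (simp only: exp_ge_zero flip: ennreal_mult'' exp_add)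
    qed
    also have "\<dots> \<le> ennreal (exp (A / (2 * \<epsilon>) + \<epsilon> * y\<^sup>2 / 2))"
    proof -
      have "\<kappa> j * (y\<^sup>2 * \<epsilon>) \<le> 1 * (y\<^sup>2 * \<epsilon>)"
        using \<kappa>[OF j] pos by (intro mult_right_mono) auto
      then show ?thesis by (intro ennreal_leI) (simp add: mult_ac)
    qed
    finally show ?thesis by (simp add: Z_def exp_add)
  qed
  have bad_le: "(\<integral>\<^sup>+\<omega>. ennreal (exp (\<theta> \<omega>)) * indicator (bad j) \<omega> \<partial>M) \<le> ennreal (2 * Z * exp (- \<delta>\<^sup>2 / (2 * \<epsilon>)))"
    if j: "j \<in> J" for j
  proof -
    \<comment> \<open>This y minimises - y \<delta> + \<epsilon> y^2 / 2, with value - \<delta>^2 /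
      (2 \<epsilon>).\<close>
    define y where "y = \<delta> / \<epsilon>"
    have y: "y > 0" using pos by (simp add: y_def)
    let ?x = "\<lambda>\<omega>. sqrt \<epsilon> * \<xi> j \<omega> - a j"
    have "(\<integral>\<^sup>+\<omega>. ennreal (exp (\<theta> \<omega>)) * indicator (bad j) \<omega> \<partial>M)
        \<le> (\<integral>\<^sup>+\<omega>. ennreal (exp (- y * \<delta>)) * ennreal (exp (\<theta> \<omega> + y * ?x \<omega>))
            + ennreal (exp (- y * \<delta>)) * ennreal (exp (\<theta> \<omega> + (- y) * ?x \<omega>)) \<partial>M)"
    proof (intro nn_integral_mono)
      fix \<omega> assume "\<omega> \<in> space M"
      have "exp (\<theta> \<omega>) \<le> exp (- y * \<delta> + (\<theta> \<omega> + y * ?x \<omega>)) + exp (- y * \<delta> + (\<theta> \<omega> + (- y) * ?x \<omega>))"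
        if "\<bar>?x \<omega>\<bar> > \<delta>"
      proof (cases "?x \<omega> \<ge> 0")
        case True
        then have "y * \<delta> \<le> y * ?x \<omega>" using that y by (intro mult_left_mono) auto
        then have "exp (\<theta> \<omega>) \<le> exp (- y * \<delta> + (\<theta> \<omega> + y * ?x \<omega>))" by simp
        then show ?thesis by (smt (verit) exp_gt_zero)
      next
        case False
        then have "y * \<delta> \<le> y * (- ?x \<omega>)" using that y by (intro mult_left_mono) auto
        then have "exp (\<theta> \<omega>) \<le> exp (- y * \<delta> + (\<theta> \<omega> + (- y) * ?x \<omega>))"
          unfolding exp_le_cancel_iff mult_minus_left mult_minus_right by linarith
        then show ?thesis by (smt (verit) exp_gt_zero)
      qed
      then show "ennreal (exp (\<theta> \<omega>)) * indicator (bad j) \<omega> \<le> ennreal (exp (- y * \<delta>)) * ennreal (exp (\<theta> \<omega> + y * ?x \<omega>))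
            + ennreal (exp (- y * \<delta>)) * ennreal (exp (\<theta> \<omega> + (- y) * ?x \<omega>))"
        by (cases "\<omega> \<in> bad j") (auto simp: bad_def intro!: ennreal_leI simp flip: ennreal_mult'' ennreal_plus exp_add)
    qed
    also have "\<dots> = ennreal (exp (- y * \<delta>)) * (\<integral>\<^sup>+\<omega>. ennreal (exp (\<theta> \<omega> + y * ?x \<omega>)) \<partial>M)
        + ennreal (exp (- y * \<delta>)) * (\<integral>\<^sup>+\<omega>. ennreal (exp (\<theta> \<omega> + (- y) * ?x \<omega>)) \<partial>M)"
      by (subst nn_integral_add) (auto simp: nn_integral_cmult)
    also have "\<dots> \<le> ennreal (exp (- y * \<delta>)) * ennreal (Z * exp (\<epsilon> * y\<^sup>2 / 2))
        + ennreal (exp (- y * \<delta>)) * ennreal (Z * exp (\<epsilon> * (- y)\<^sup>2 / 2))"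
      by (intro add_mono mult_left_mono tilt j) auto
    also have "\<dots> = ennreal (2 * Z * exp (- y * \<delta> + \<epsilon> * y\<^sup>2 / 2))"
    proof -
      have gen: "ennreal a * ennreal b + ennreal a * ennreal c = ennreal (a * b + a * c)"
        if "0 \<le> a" "0 \<le> b" "0 \<le> c" for a b c :: real
        using that by (simp flip: ennreal_mult'' ennreal_plus)
      have "2 * Z * exp (- y * \<delta> + \<epsilon> * y\<^sup>2 / 2)
          = exp (- y * \<delta>) * (Z * exp (\<epsilon> * y\<^sup>2 / 2)) + exp (- y * \<delta>) * (Z * exp (\<epsilon> * (- y)\<^sup>2 / 2))"
        unfolding exp_add power2_minus by simp
      then show ?thesis by (subst gen) (auto simp: Z_def)
    qed
    also have "- y * \<delta> + \<epsilon> * y\<^sup>2 / 2 = - \<delta>\<^sup>2 / (2 * \<epsilon>)"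
      using pos by (simp add: y_def power2_eq_square field_simps)
    finally show ?thesis .
  qed
  have split: "exp (\<theta> \<omega>) \<le> exp ((A + \<delta> * A1) / \<epsilon>)" if "\<omega> \<in> good" for \<omega>
  proof -
    have "\<theta> \<omega> = (\<Sum>i\<in>J. a i * (sqrt \<epsilon> * \<xi> i \<omega>)) / \<epsilon>"
      unfolding \<theta>_def sum_divide_distrib
    proof (intro sum.cong refl)
      fix i
      have "sqrt \<epsilon> * sqrt \<epsilon> = \<epsilon>" "sqrt \<epsilon> \<noteq> 0" using pos by auto
      then show "a i / sqrt \<epsilon> * \<xi> i \<omega> = a i * (sqrt \<epsilon> * \<xi> i \<omega>) / \<epsilon>"
        using pos by (simp add: field_simps)
    qed
    also have "\<dots> \<le> (\<Sum>i\<in>J. (a i)\<^sup>2 + \<delta> * \<bar>a i\<bar>) / \<epsilon>"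
    proof (intro divide_right_mono sum_mono)
      fix i assume i: "i \<in> J"
      have "a i * (sqrt \<epsilon> * \<xi> i \<omega> - a i) \<le> \<bar>a i\<bar> * \<bar>sqrt \<epsilon> * \<xi> i \<omega> - a i\<bar>"
        by (metis abs_ge_self abs_mult)
      also have "\<dots> \<le> \<bar>a i\<bar> * \<delta>"
        using that i by (intro mult_left_mono) (auto simp: good_def)
      finally show "a i * (sqrt \<epsilon> * \<xi> i \<omega>) \<le> (a i)\<^sup>2 + \<delta> * \<bar>a i\<bar>"
        by (simp add: right_diff_distrib power2_eq_square mult_ac)
    qed (use pos in simp)
    also have "\<dots> = (A + \<delta> * A1) / \<epsilon>"
      by (simp add: A_def A1_def sum.distrib sum_distrib_left)
    finally show ?thesis by simp
  qed
  \<comment> \<open>The total tilted mass is split: on the good event the tilt is bounded pointwise,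
    and off it some coordinate is bad.\<close>
  have "ennreal Z \<le> (\<integral>\<^sup>+\<omega>. ennreal (exp ((A + \<delta> * A1) / \<epsilon>)) * indicator good \<omega>
      + (\<Sum>j\<in>J. ennreal (exp (\<theta> \<omega>)) * indicator (bad j) \<omega>) \<partial>M)"
    unfolding EZ[symmetric]
  proof (intro nn_integral_mono)
    fix \<omega> assume \<omega>: "\<omega> \<in> space M"
    show "ennreal (exp (\<theta> \<omega>)) \<le> ennreal (exp ((A + \<delta> * A1) / \<epsilon>)) * indicator good \<omega>
      + (\<Sum>j\<in>J. ennreal (exp (\<theta> \<omega>)) * indicator (bad j) \<omega>)"
    proof (cases "\<omega> \<in> good")
      case True
      then have "ennreal (exp (\<theta> \<omega>)) \<le> ennreal (exp ((A + \<delta> * A1) / \<epsilon>)) * indicator good \<omega>"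
        using split by (simp add: ennreal_leI)
      then show ?thesis by (rule order_trans) simp
    next
      case False
      then obtain j where j: "j \<in> J" "\<omega> \<in> bad j"
        using \<omega> by (auto simp: good_def bad_def not_le)
      have "ennreal (exp (\<theta> \<omega>)) * indicator (bad j) \<omega> \<le> (\<Sum>j\<in>J. ennreal (exp (\<theta> \<omega>)) * indicator (bad j) \<omega>)"
        by (rule member_le_sum[OF j(1)]) (auto simp: J)
      then show ?thesis using j(2) False by simp
    qed
  qed
  also have "\<dots> = ennreal (exp ((A + \<delta> * A1) / \<epsilon>)) * emeasure M good
      + (\<Sum>j\<in>J. \<integral>\<^sup>+\<omega>. ennreal (exp (\<theta> \<omega>)) * indicator (bad j) \<omega> \<partial>M)"
  proof -
    have "(\<integral>\<^sup>+\<omega>. (\<Sum>j\<in>J. ennreal (exp (\<theta> \<omega>)) * indicator (bad j) \<omega>) \<partial>M)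
        = (\<Sum>j\<in>J. \<integral>\<^sup>+\<omega>. ennreal (exp (\<theta> \<omega>)) * indicator (bad j) \<omega> \<partial>M)"
      by (rule nn_integral_sum) measurable
    moreover have "(\<integral>\<^sup>+\<omega>. ennreal (exp ((A + \<delta> * A1) / \<epsilon>)) * indicator good \<omega> \<partial>M)
        = ennreal (exp ((A + \<delta> * A1) / \<epsilon>)) * emeasure M good"
      by (rule nn_integral_cmult_indicator) measurable
    moreover have "(\<integral>\<^sup>+\<omega>. ennreal (exp ((A + \<delta> * A1) / \<epsilon>)) * indicator good \<omega>
          + (\<Sum>j\<in>J. ennreal (exp (\<theta> \<omega>)) * indicator (bad j) \<omega>) \<partial>M)
        = (\<integral>\<^sup>+\<omega>. ennreal (exp ((A + \<delta> * A1) / \<epsilon>)) * indicator good \<omega> \<partial>M)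
          + (\<integral>\<^sup>+\<omega>. (\<Sum>j\<in>J. ennreal (exp (\<theta> \<omega>)) * indicator (bad j) \<omega>) \<partial>M)"
      by (rule nn_integral_add) measurable
    ultimately show ?thesis by simp
  qed
  also have "\<dots> \<le> ennreal (exp ((A + \<delta> * A1) / \<epsilon>)) * emeasure M good
      + (\<Sum>j\<in>J. ennreal (2 * Z * exp (- \<delta>\<^sup>2 / (2 * \<epsilon>))))"
    by (intro add_left_mono sum_mono bad_le)
  also have "\<dots> = ennreal (exp ((A + \<delta> * A1) / \<epsilon>) * prob good + card J * (2 * Z * exp (- \<delta>\<^sup>2 / (2 * \<epsilon>))))"
    by (simp add: emeasure_eq_measure Z_def ennreal_of_nat_eq_real_of_nat flip: ennreal_mult'' ennreal_plus)
  finally have "Z \<le> exp ((A + \<delta> * A1) / \<epsilon>) * prob good + card J * (2 * Z * exp (- \<delta>\<^sup>2 / (2 * \<epsilon>)))"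
    by (subst (asm) ennreal_le_iff) (auto simp: Z_def intro!: add_nonneg_nonneg)
  \<comment> \<open>The hypothesis \<open>small\<close> leaves at most half of the tilted mass to
    the bad events.\<close>
  moreover have "card J * (2 * Z * exp (- \<delta>\<^sup>2 / (2 * \<epsilon>))) \<le> Z * (1 / 2)"
  proof -
    have "Z * (2 * card J * exp (- \<delta>\<^sup>2 / (2 * \<epsilon>))) \<le> Z * (1 / 2)"
      by (intro mult_left_mono small) (simp add: Z_def)
    then show ?thesis by (simp add: mult_ac)
  qed
  ultimately have "Z / 2 \<le> exp ((A + \<delta> * A1) / \<epsilon>) * prob good" by simp
  then have "Z / 2 * exp (- ((A + \<delta> * A1) / \<epsilon>)) \<le> prob good"
    by (simp add: exp_minus field_simps)
  moreover have "Z / 2 * exp (- ((A + \<delta> * A1) / \<epsilon>)) = 1 / 2 * exp (- (A / 2 + \<delta> * A1) / \<epsilon>)"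
    using pos by (simp add: Z_def field_simps flip: exp_add)
  ultimately show ?thesis by (simp add: good_def A_def A1_def)
qed

end

text \<open>Convexity of exp with weights proportional to \<open>r i\<close> combines the
  coordinates without any independence among them. The bound \<open>sqrt 2\<close> is the same for
  all n, so Fatou carries it to the norm. The weights are divided by \<open>r i\<close>, whence the
  strict positivity.\<close>

lemma (in covariance_basis) gaussian_tail:
  assumes M: "prob_space M" and X [measurable]: "X \<in> borel_measurable M"
    and r: "\<And>i. 0 < r i" "\<And>n. (\<Sum>i<n. r i) \<le> \<tau>"
    and mgf: "\<And>i y. (\<integral>\<^sup>+\<omega>. ennreal (exp (y * (e i \<bullet> X \<omega>))) \<partial>M) \<le> ennreal (exp (y\<^sup>2 * r i / 2))"
    and \<rho>: "0 \<le> \<rho>"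
  shows "measure M {\<omega>\<in>space M. norm (X \<omega>) > \<rho>} \<le> sqrt 2 * exp (- \<rho>\<^sup>2 / (4 * \<tau>))"
proof -
  interpret prob_space M by fact
  have \<tau>: "\<tau> > 0" using r(1)[of 0] r(2)[of 1] by simp
  have fin: "(\<integral>\<^sup>+\<omega>. ennreal (exp ((\<Sum>i<n. (e i \<bullet> X \<omega>)\<^sup>2) / (4 * \<tau>))) \<partial>M) \<le> ennreal (sqrt 2)" for n
  proof (cases "n = 0")
    case True
    have "ennreal 1 \<le> ennreal (sqrt 2)" by (intro ennreal_leI) simp
    then show ?thesis using True emeasure_space_1 by simp
  next
    case False
    define Rn where "Rn = (\<Sum>i<n. r i)"
    have Rn: "Rn > 0" using False r(1) by (auto simp: Rn_def intro!: sum_pos)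
    define p where "p i = r i / Rn" for i
    have p: "p i \<ge> 0" for i using Rn r(1)[of i] by (simp add: p_def)
    have sp: "(\<Sum>i<n. p i) = 1" using Rn by (simp add: p_def Rn_def flip: sum_divide_distrib)
    have "exp ((\<Sum>i<n. (e i \<bullet> x)\<^sup>2) / (4 * \<tau>)) \<le> (\<Sum>i<n. p i * exp ((e i \<bullet> x)\<^sup>2 / (4 * r i)))" for x
    proof -
      have "exp ((\<Sum>i<n. (e i \<bullet> x)\<^sup>2) / (4 * \<tau>)) \<le> exp ((\<Sum>i<n. (e i \<bullet> x)\<^sup>2) / (4 * Rn))"
        using Rn r(2)[of n] \<tau> by (auto simp: Rn_def intro!: divide_left_mono sum_nonneg)
      also have "(\<Sum>i<n. (e i \<bullet> x)\<^sup>2) / (4 * Rn) = (\<Sum>i<n. p i *\<^sub>R ((e i \<bullet> x)\<^sup>2 / (4 * r i)))"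
        unfolding sum_divide_distrib p_def using r(1) Rn
        by (intro sum.cong refl) (simp add: less_imp_neq[symmetric])
      also have "exp \<dots> \<le> (\<Sum>i<n. p i * exp ((e i \<bullet> x)\<^sup>2 / (4 * r i)))"
        by (rule convex_on_sum[OF _ _ _ sp])
          (use p False convex_on_exp[of 1] in \<open>auto simp: lessThan_empty_iff\<close>)
      finally show ?thesis .
    qed
    then have "(\<integral>\<^sup>+\<omega>. ennreal (exp ((\<Sum>i<n. (e i \<bullet> X \<omega>)\<^sup>2) / (4 * \<tau>))) \<partial>M)
        \<le> (\<integral>\<^sup>+\<omega>. ennreal (\<Sum>i<n. p i * exp ((e i \<bullet> X \<omega>)\<^sup>2 / (4 * r i))) \<partial>M)"
      by (intro nn_integral_mono ennreal_leI)
    also have "\<dots> = (\<integral>\<^sup>+\<omega>. (\<Sum>i<n. ennreal (p i) * ennreal (exp ((e i \<bullet> X \<omega>)\<^sup>2 / (4 * r i)))) \<partial>M)"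
      by (intro nn_integral_cong) (simp add: p sum_nonneg flip: ennreal_mult'' sum_ennreal)
    also have "\<dots> = (\<Sum>i<n. ennreal (p i) * (\<integral>\<^sup>+\<omega>. ennreal (exp ((e i \<bullet> X \<omega>)\<^sup>2 / (4 * r i))) \<partial>M))"
      by (subst nn_integral_sum) (auto simp: nn_integral_cmult)
    also have "\<dots> \<le> (\<Sum>i<n. ennreal (p i) * ennreal (sqrt 2))"
      by (intro sum_mono mult_left_mono nn_integral_exp_square mgf r(1)) auto
    also have "\<dots> = ennreal (\<Sum>i<n. p i) * ennreal (sqrt 2)"
      by (simp add: p sum_distrib_right flip: sum_ennreal)
    finally show ?thesis by (simp add: sp)
  qed
  have "(\<integral>\<^sup>+\<omega>. ennreal (exp ((norm (X \<omega>))\<^sup>2 / (4 * \<tau>))) \<partial>M)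
      = (\<integral>\<^sup>+\<omega>. liminf (\<lambda>n. ennreal (exp ((\<Sum>i<n. (e i \<bullet> X \<omega>)\<^sup>2) / (4 * \<tau>)))) \<partial>M)"
  proof (intro nn_integral_cong)
    fix \<omega>
    have "(\<lambda>n. ennreal (exp ((\<Sum>i<n. (e i \<bullet> X \<omega>)\<^sup>2) / (4 * \<tau>)))) \<longlonglongrightarrow> ennreal (exp ((norm (X \<omega>))\<^sup>2 / (4 * \<tau>)))"
      using \<tau> by (intro tendsto_intros Parseval_e) auto
    then show "ennreal (exp ((norm (X \<omega>))\<^sup>2 / (4 * \<tau>)))
        = liminf (\<lambda>n. ennreal (exp ((\<Sum>i<n. (e i \<bullet> X \<omega>)\<^sup>2) / (4 * \<tau>))))"
      by (rule lim_imp_Liminf[OF sequentially_bot, symmetric])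
  qed
  also have "\<dots> \<le> liminf (\<lambda>n. \<integral>\<^sup>+\<omega>. ennreal (exp ((\<Sum>i<n. (e i \<bullet> X \<omega>)\<^sup>2) / (4 * \<tau>))) \<partial>M)"
    by (intro nn_integral_liminf) measurable
  also have "\<dots> \<le> liminf (\<lambda>n::nat. ennreal (sqrt 2))"
    by (intro Liminf_mono always_eventually allI fin)
  finally have "(\<integral>\<^sup>+\<omega>. ennreal (exp ((norm (X \<omega>))\<^sup>2 / (4 * \<tau>))) \<partial>M) \<le> ennreal (sqrt 2)"
    by (simp add: Liminf_const)
  then have "prob {\<omega>\<in>space M. (norm (X \<omega>))\<^sup>2 / (4 * \<tau>) \<ge> \<rho>\<^sup>2 / (4 * \<tau>)} \<le> sqrt 2 * exp (- (\<rho>\<^sup>2 / (4 * \<tau>)))"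
    by (intro nn_integral_Chernoff) auto
  moreover have "prob {\<omega>\<in>space M. norm (X \<omega>) > \<rho>} \<le> prob {\<omega>\<in>space M. (norm (X \<omega>))\<^sup>2 / (4 * \<tau>) \<ge> \<rho>\<^sup>2 / (4 * \<tau>)}"
    using \<tau> \<rho> by (intro finite_measure_mono) (auto intro!: divide_right_mono power_mono)
  ultimately show ?thesis by simp
qed

section \<open>Exponential approximation of the Wiener process\<close>

text \<open>Following \<open>t\<close> through the dyadic cells to its left, two consecutive approximations differ by at most
  one increment of the finer level.\<close>

lemma dyadic_chaining:
  fixes F :: "real \<Rightarrow> 'a::real_normed_vector"
  assumes F: "continuous_on {0..1} F"
    and incr: "\<And>m k. m \<ge> n \<Longrightarrow> k < 2 ^ m \<Longrightarrow> norm (incr m k F) \<le> \<eta> * (3/4) ^ (m - n)"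
    and t: "t \<in> {0..1}"
  shows "norm (F t - polygon n F t) \<le> 4 * \<eta>"
\<comment> \<open>Rounding 1 down gives 2^m, outside the cells; there the polygon is exact
  anyway.\<close>
proof (cases "t = 1")
  case True
  have "\<eta> \<ge> 0" using order_trans[OF norm_ge_zero incr[of n 0]] by simp
  moreover have "polygon n F 1 = F 1" using polygon_dyadic[of "2 ^ n" n F] by simp
  ultimately show ?thesis using True by simp
next
  case False
  have t: "0 \<le> t" "t < 1" using t False by auto
  define k where "k m = nat \<lfloor>2 ^ m * t\<rfloor>" for m
  have k: "real (k m) \<le> 2 ^ m * t" "2 ^ m * t < real (k m) + 1" for m
    using t by (simp_all add: k_def)
  have klt: "k m < 2 ^ m" for m
  proof -
    have "2 ^ m * t < 2 ^ m" using t by simp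
    then have "real (k m) < 2 ^ m" by (rule le_less_trans[OF k(1)])
    then show ?thesis by simp
  qed
  define x where "x m = F (real (k m) / 2 ^ m)" for m
  have step: "norm (x (Suc m) - x m) \<le> \<eta> * (3/4) ^ (Suc m - n)" if m: "m \<ge> n" for m
  proof -
    have "real (k (Suc m)) < 2 * real (k m) + 2" "2 * real (k m) < real (k (Suc m)) + 1"
      using k[of m] k[of "Suc m"] by (simp_all add: mult.assoc)
    then have "k (Suc m) = 2 * k m \<or> k (Suc m) = Suc (2 * k m)" by linarith
    then show ?thesis
    proof
      assume "k (Suc m) = 2 * k m"
      then have "x (Suc m) = x m" by (simp add: x_def)
      then show ?thesis using incr[of "Suc m" 0] m by (auto intro: order_trans[OF norm_ge_zero])
    next
      assume s: "k (Suc m) = Suc (2 * k m)"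
      then have "x (Suc m) - x m = incr (Suc m) (2 * k m) F"
        by (simp add: x_def incr_def)
      then show ?thesis using incr[of "Suc m" "2 * k m"] m klt[of "Suc m"] s by simp
    qed
  qed
  \<comment> \<open>The powers of 3/4 from exponent 1 on sum to 3. One further \<eta> reaches the
    right end of the cell, giving 4 \<eta> in total.\<close>
  have part: "norm (x (n + j) - x n) \<le> 3 * \<eta> * (1 - (3/4) ^ j)" for j
  proof (induction j)
    case (Suc j)
    have "norm (x (n + Suc j) - x n) \<le> norm (x (Suc (n + j)) - x (n + j)) + norm (x (n + j) - x n)"
      using norm_triangle_ineq[of "x (Suc (n + j)) - x (n + j)" "x (n + j) - x n"] by simp
    also have "\<dots> \<le> \<eta> * (3/4) ^ (Suc (n + j) - n) + 3 * \<eta> * (1 - (3/4) ^ j)"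
      by (intro add_mono step Suc) simp
    also have "\<dots> = 3 * \<eta> * (1 - (3/4) ^ Suc j)"
      by (simp add: algebra_simps Suc_diff_le)
    finally show ?case .
  qed simp
  have \<eta>: "\<eta> \<ge> 0" using order_trans[OF norm_ge_zero incr[of n 0]] by simp
  have "(\<lambda>m. real (k m) / 2 ^ m) \<longlonglongrightarrow> t"
  proof (rule LIMSEQ_I)
    fix r :: real assume "r > 0"
    then obtain N where N: "(1/2) ^ N < r"
      using real_arch_pow_inv[of r "1/2"] by auto
    have "norm (real (k m) / 2 ^ m - t) < r" if "m \<ge> N" for m
    proof -
      have "t - real (k m) / 2 ^ m \<le> (1/2) ^ m" "real (k m) / 2 ^ m \<le> t"
      proof -
        have "t \<le> (real (k m) + 1) / 2 ^ m" "real (k m) / 2 ^ m \<le> t"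
          using k[of m] by (simp_all add: field_simps)
        then show "t - real (k m) / 2 ^ m \<le> (1/2) ^ m" "real (k m) / 2 ^ m \<le> t"
          by (simp_all add: add_divide_distrib power_one_over)
      qed
      moreover have "(1/2::real) ^ m \<le> (1/2) ^ N" using that by (simp add: power_decreasing)
      ultimately show ?thesis using N unfolding real_norm_def by linarith
    qed
    then show "\<exists>N. \<forall>m\<ge>N. norm (real (k m) / 2 ^ m - t) < r" by blast
  qed
  then have "x \<longlonglongrightarrow> F t"
    unfolding x_def using t dyadic_bounds[OF klt]
    by (intro continuous_on_tendsto_compose[OF F]) auto
  then have "(\<lambda>j. x (n + j) - x n) \<longlonglongrightarrow> F t - x n"
    by (intro tendsto_intros LIMSEQ_ignore_initial_segment[of x _ n, unfolded add.commute[of _ n]])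
  then have "norm (F t - x n) \<le> 3 * \<eta>"
  proof (rule Lim_norm_ubound[rotated, OF _ always_eventually])
    have "norm (x (n + j) - x n) \<le> 3 * \<eta>" for j
    proof -
      have "3 * \<eta> * (1 - (3/4) ^ j) \<le> 3 * \<eta> * 1"
        using \<eta> by (intro mult_left_mono) auto
      then show ?thesis using part[of j] by simp
    qed
    then show "\<forall>j. norm (x (n + j) - x n) \<le> 3 * \<eta>" ..
  qed simp
  moreover have "norm (F t - F (real (Suc (k n)) / 2 ^ n)) \<le> norm (F t - x n) + norm (incr n (k n) F)"
    using norm_triangle_ineq4[of "F t - x n" "incr n (k n) F"] by (simp add: incr_def x_def)
  moreover have "norm (incr n (k n) F) \<le> \<eta>" using incr[OF order_refl klt] by simp
  ultimately show ?thesis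
    using k[of n] \<eta> by (intro norm_polygon_diff_le[OF klt[of n]]) (auto simp: field_simps x_def simp del: of_nat_Suc)
qed

lemma sum_half_powers_le: "(\<Sum>i<N. (1/2::real) ^ i) \<le> 2"
  using sum_le_suminf[of "\<lambda>i. (1/2::real) ^ i" "{..<N}"] suminf_geometric[of "1/2::real"] by simp

text \<open>Bernoulli gives (9/8)^j \<ge> 1 + j/8, so K \<ge> 16 yields at least 2 j extra in the
  exponent; exp (-2) \<le> 1/4 then beats the factor 2^j and leaves a geometric series.\<close>

lemma chaining_series_le:
  fixes K :: real
  assumes "K \<ge> 16"
  shows "summable (\<lambda>j. 2 ^ j * exp (- K * (9/8) ^ j))" "(\<Sum>j. 2 ^ j * exp (- K * (9/8) ^ j)) \<le> 2 * exp (- K)"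
proof -
  have le: "2 ^ j * exp (- K * (9/8) ^ j) \<le> exp (- K) * (1/2) ^ j" for j :: nat
  proof -
    have "1 + real j * (1/8) \<le> (1 + 1/8 :: real) ^ j" by (rule Bernoulli_inequality) simp
    then have "K * (1 + real j / 8) \<le> K * (9/8) ^ j" using assms by (intro mult_left_mono) auto
    moreover have "real j * 16 \<le> real j * K" using assms by (intro mult_left_mono) auto
    ultimately have "- K * (9/8) ^ j \<le> - K + real j * (- 2)" by (simp add: algebra_simps)
    then have "exp (- K * (9/8) ^ j) \<le> exp (- K) * exp (- 2) ^ j"
      by (simp flip: exp_add exp_of_nat_mult)
    also have "\<dots> \<le> exp (- K) * (1/4) ^ j"
    proof (intro mult_left_mono power_mono)
      have "(2::real) \<le> exp 1" using exp_ge_add_one_self[of 1] by simp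
      then have "2 * 2 \<le> exp (1::real) * exp 1" by (intro mult_mono) auto
      then have "4 \<le> exp (2::real)" by (simp flip: exp_add)
      then show "exp (- 2) \<le> (1/4::real)" by (simp add: exp_minus field_simps)
    qed auto
    finally have "2 ^ j * exp (- K * (9/8) ^ j) \<le> 2 ^ j * (exp (- K) * (1/4) ^ j)"
      by (intro mult_left_mono) auto
    also have "\<dots> = exp (- K) * (1/2) ^ j"
      by (simp add: power_divide field_simps flip: power_mult_distrib)
    finally show ?thesis .
  qed
  have s: "summable (\<lambda>j. exp (- K) * (1/2) ^ j)" by (intro summable_mult summable_geometric) simp
  show 1: "summable (\<lambda>j. 2 ^ j * exp (- K * (9/8) ^ j))"
    by (rule summable_comparison_test'[OF s, of 0]) (use le in auto)
  have "(\<Sum>j. 2 ^ j * exp (- K * (9/8) ^ j)) \<le> (\<Sum>j. exp (- K) * (1/2) ^ j)"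
    by (rule suminf_le[OF le 1 s])
  also have "\<dots> = 2 * exp (- K)" by (subst suminf_mult) (auto simp: suminf_geometric)
  finally show "(\<Sum>j. 2 ^ j * exp (- K * (9/8) ^ j)) \<le> 2 * exp (- K)" .
qed

lemma incr_scaleR: "incr n k (\<lambda>t. c *\<^sub>R F t) = c *\<^sub>R incr n k F"
  by (simp add: incr_def scaleR_diff_right)

section \<open>Coordinates of a path and the error of its projection\<close>

context covariance_basis
begin

lemma proj_scaleR: "proj n (\<lambda>t. c *\<^sub>R F t) t = c *\<^sub>R proj n F t"
  by (simp add: proj_def polygon_def incr_scaleR P.add P.sum P.scaleR scaleR_sum_right
      scaleR_add_right mult.commute)

lemma norm_diff_proj_le:
  assumes "continuous_on {0..1} F" "t \<in> {0..1}"
    and "\<And>m k. m \<ge> n \<Longrightarrow> k < 2 ^ m \<Longrightarrow> norm (incr m k F) \<le> \<eta> * (3/4) ^ (m - n)"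
    and "\<And>k. k \<le> 2 ^ n \<Longrightarrow> norm (F (real k / 2 ^ n) - P n (F (real k / 2 ^ n))) \<le> \<eta>"
  shows "norm (F t - proj n F t) \<le> 5 * \<eta>"
proof -
  obtain k where k: "k < 2 ^ n" "real k / 2 ^ n \<le> t" "t \<le> real (Suc k) / 2 ^ n"
    using exists_dyadic_cell[OF assms(2)] .
  have "norm (0 - polygon n (\<lambda>t. F t - P n (F t)) t) \<le> \<eta>"
    using assms(4)[of k] assms(4)[of "Suc k"] k(1)
    by (intro norm_polygon_diff_le[OF k]) (simp_all add: norm_minus_commute del: of_nat_Suc)
  then have 1: "norm (polygon n F t - proj n F t) \<le> \<eta>"
    by (simp add: polygon_diff_P norm_minus_commute)
  have 2: "norm (F t - polygon n F t) \<le> 4 * \<eta>"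
    by (rule dyadic_chaining[OF assms(1,3,2)])
  show ?thesis
    using norm_triangle_ineq[of "F t - polygon n F t" "polygon n F t - proj n F t"] 1 2 by simp
qed

definition coords :: "nat \<Rightarrow> (nat \<times> nat) set" where
  "coords n = {..<2 ^ n} \<times> {..<n}"

text \<open>The factor normalises the variance of a Wiener increment in direction \<open>h j\<close>
  to \<open>Q (h j) \<bullet> h j\<close>. The value 0 off the index set gives measurability for
  every i, as the moment lemmas require.\<close>

definition coord :: "nat \<Rightarrow> nat \<times> nat \<Rightarrow> (real \<Rightarrow> 'h) \<Rightarrow> real" where
  "coord n i F = (if i \<in> coords n then sqrt (2 ^ n) * (h (snd i) \<bullet> incr n (fst i) F) else 0)"

lemma finite_coords: "finite (coords n)"
  by (simp add: coords_def)

lemma sum_coord_sq: "(\<Sum>i\<in>coords n. (coord n i F)\<^sup>2) = energy n F"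
proof -
  have "(\<Sum>i\<in>coords n. (coord n i F)\<^sup>2) = (\<Sum>(k, j)\<in>coords n. 2 ^ n * (h j \<bullet> incr n k F)\<^sup>2)"
    by (intro sum.cong) (auto simp: coord_def power_mult_distrib)
  then show ?thesis
    by (simp add: coords_def energy_def sum_distrib_left flip: sum.cartesian_product)
qed

text \<open>\<open>proj n\<close> is linear in finitely many coordinates for paths starting at 0;
  the clamp weights lie in [0, 1], and the normalising factor is at least 1.\<close>

lemma norm_proj_diff_le:
  assumes "F 0 = 0" "G 0 = 0" and d: "\<And>i. i \<in> coords n \<Longrightarrow> \<bar>coord n i F - coord n i G\<bar> \<le> d" and "d \<ge> 0"
  shows "norm (proj n F t - proj n G t) \<le> d * (\<Sum>i\<in>coords n. norm (Q (h (snd i))))"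
proof -
  have "proj n F t - proj n G t
      = (\<Sum>k<2^n. clamp01 (2 ^ n * t - real k) *\<^sub>R P n (incr n k F - incr n k G))"
    using assms by (simp add: proj_def polygon_def P.add P.sum P.scaleR P.diff scaleR_diff_right sum_subtractf)
  also have "\<dots> = (\<Sum>(k, j)\<in>coords n. clamp01 (2 ^ n * t - real k) *\<^sub>R (h j \<bullet> (incr n k F - incr n k G)) *\<^sub>R Q (h j))"
    unfolding coords_def by (subst sum.cartesian_product[symmetric]) (simp add: P_def scaleR_sum_right)
  also have "norm \<dots> \<le> (\<Sum>i\<in>coords n. d * norm (Q (h (snd i))))"
  proof (rule sum_norm_le)
    fix i assume i: "i \<in> coords n"
    obtain k j where kj: "i = (k, j)" by (cases i)
    have "\<bar>h j \<bullet> (incr n k F - incr n k G)\<bar> \<le> sqrt (2 ^ n) * \<bar>h j \<bullet> (incr n k F - incr n k G)\<bar>"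
      using mult_right_mono[of 1 "sqrt (2 ^ n)" "\<bar>h j \<bullet> (incr n k F - incr n k G)\<bar>"] by simp
    also have "\<dots> = \<bar>coord n i F - coord n i G\<bar>"
      using i by (simp add: coord_def kj inner_diff_right abs_mult flip: right_diff_distrib)
    also have "\<dots> \<le> d" by (rule d[OF i])
    finally have "\<bar>h j \<bullet> (incr n k F - incr n k G)\<bar> \<le> d" .
    moreover have "0 \<le> clamp01 x" "clamp01 x \<le> 1" for x by (auto simp: clamp01_def)
    ultimately have "\<bar>clamp01 (2 ^ n * t - real k)\<bar> * (\<bar>h j \<bullet> (incr n k F - incr n k G)\<bar> * norm (Q (h j))) \<le> 1 * (d * norm (Q (h j)))"
      using assms(4) by (intro mult_mono mult_right_mono) auto
    then show "norm (case i of (k, j) \<Rightarrow> clamp01 (2 ^ n * t - real k) *\<^sub>R (h j \<bullet> (incr n k F - incr n k G)) *\<^sub>R Q (h j))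
        \<le> d * norm (Q (h (snd i)))"
      by (simp add: kj abs_mult mult.assoc)
  qed
  finally show ?thesis by (simp add: sum_distrib_left)
qed

end

section \<open>Gaussian tails and the exceptional event\<close>

locale wiener_basis = covariance_basis Q e + Q_Wiener_process M Q W
  for Q :: "'h::{real_inner, banach, second_countable_topology} \<Rightarrow> 'h"
    and e :: "nat \<Rightarrow> 'h" and M :: "'w measure" and W :: "real \<Rightarrow> 'w \<Rightarrow> 'h"
begin

lemma mgf_increment:
  assumes "0 \<le> s" "s \<le> t" "t \<le> 1"
  shows "(\<integral>\<^sup>+\<omega>. ennreal (exp (g \<bullet> (W t \<omega> - W s \<omega>))) \<partial>M) = ennreal (exp ((t - s) * (Q g \<bullet> g) / 2))"
proof -
  note G = gaussian_increments[OF assms]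
  have m [measurable]: "(\<lambda>\<omega>. W t \<omega> - W s \<omega>) \<in> borel_measurable M"
    using G by (simp add: gaussian_distributed_def)
  have "(\<integral>\<^sup>+\<omega>. ennreal (exp (1 * (g \<bullet> (W t \<omega> - W s \<omega>)))) \<partial>M) = ennreal (exp (1\<^sup>2 * ((t - s) * (Q g \<bullet> g)) / 2))"
  proof (rule nn_integral_exp_if_gaussian_char)
    show "(\<lambda>\<omega>. g \<bullet> (W t \<omega> - W s \<omega>)) \<in> borel_measurable M" by measurable
    show "0 \<le> (t - s) * (Q g \<bullet> g)" using assms Q_inner_nonneg by simp
    fix a :: real
    have "(LINT \<omega>|M. exp (\<i> * complex_of_real ((a *\<^sub>R g) \<bullet> (W t \<omega> - W s \<omega>))))
        = exp (\<i> * complex_of_real ((a *\<^sub>R g) \<bullet> 0) - complex_of_real (((t - s) *\<^sub>R Q (a *\<^sub>R g)) \<bullet> (a *\<^sub>R g) / 2))"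
      using G unfolding gaussian_distributed_def by blast
    moreover have "((t - s) *\<^sub>R Q (a *\<^sub>R g)) \<bullet> (a *\<^sub>R g) = a\<^sup>2 * ((t - s) * (Q g \<bullet> g))"
      by (simp add: Q.scaleR power2_eq_square mult_ac)
    ultimately show "(LINT \<omega>|M. exp (\<i> * complex_of_real (a * (g \<bullet> (W t \<omega> - W s \<omega>)))))
        = exp (- complex_of_real (a\<^sup>2 * ((t - s) * (Q g \<bullet> g)) / 2))"
      by (simp only: inner_scaleR_left[of a g] inner_zero_right of_real_0 mult_zero_right diff_0)
  qed
  then show ?thesis by simp
qed

abbreviation sample :: "'w \<Rightarrow> real \<Rightarrow> 'h" where "sample \<omega> \<equiv> (\<lambda>t. W t \<omega>)"

lemma measurable_incr [measurable]: "k < 2 ^ n \<Longrightarrow> (\<lambda>\<omega>. incr n k (sample \<omega>)) \<in> borel_measurable M"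
  unfolding incr_def using dyadic_bounds[of k n]
  by (intro borel_measurable_diff measurable_W) auto

lemma mgf_incr:
  "k < 2 ^ n \<Longrightarrow> (\<integral>\<^sup>+\<omega>. ennreal (exp (g \<bullet> incr n k (sample \<omega>))) \<partial>M) = ennreal (exp ((Q g \<bullet> g) / 2 ^ n / 2))"
proof -
  assume k: "k < 2 ^ n"
  have "real (Suc k) / 2 ^ n - real k / 2 ^ n = 1 / 2 ^ n" by (simp add: field_simps)
  then show ?thesis
    using mgf_increment[of "real k / 2 ^ n" "real (Suc k) / 2 ^ n" g] dyadic_bounds[OF k]
    by (simp add: incr_def divide_right_mono del: of_nat_Suc)
qed

text \<open>The one place where independence of the increments enters.\<close>

lemma mgf_sum_incr:
  "(\<integral>\<^sup>+\<omega>. ennreal (exp (\<Sum>k<2^n. g k \<bullet> incr n k (sample \<omega>))) \<partial>M)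
    = ennreal (exp ((\<Sum>k<2^n. Q (g k) \<bullet> g k) / 2 ^ n / 2))"
proof -
  define \<tau> where "\<tau> i = real i / 2 ^ n" for i
  have "indep_vars (\<lambda>_. borel) (\<lambda>i \<omega>. W (\<tau> (Suc i)) \<omega> - W (\<tau> i) \<omega>) {..<2 ^ n}"
  proof (rule indep_increments)
    show "\<tau> i \<in> {0..1}" if "i \<le> 2 ^ n" for i
      unfolding \<tau>_def by (rule dyadic_in_unit[OF that])
    show "\<tau> i \<le> \<tau> (Suc i)" for i by (simp add: \<tau>_def divide_right_mono)
  qed
  then have ind: "indep_vars (\<lambda>_. borel) (\<lambda>i \<omega>. incr n i (sample \<omega>)) {..<2 ^ n}"
    by (simp add: incr_def \<tau>_def)
  have "indep_vars (\<lambda>_. borel) (\<lambda>i \<omega>. ennreal (exp (g i \<bullet> incr n i (sample \<omega>)))) {..<2 ^ n}"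
    by (rule indep_vars_compose2[OF ind, of "\<lambda>i x. ennreal (exp (g i \<bullet> x))"]) measurable
  then have "(\<integral>\<^sup>+\<omega>. (\<Prod>i<2^n. ennreal (exp (g i \<bullet> incr n i (sample \<omega>)))) \<partial>M)
      = (\<Prod>i<2^n. \<integral>\<^sup>+\<omega>. ennreal (exp (g i \<bullet> incr n i (sample \<omega>))) \<partial>M)"
    by (intro indep_vars_nn_integral) auto
  moreover have "(\<Prod>i<2^n. ennreal (exp (g i \<bullet> incr n i (sample \<omega>))))
      = ennreal (exp (\<Sum>k<2^n. g k \<bullet> incr n k (sample \<omega>)))" for \<omega>
    by (simp add: exp_sum prod_ennreal)
  moreover have "(\<Prod>i<2^n. \<integral>\<^sup>+\<omega>. ennreal (exp (g i \<bullet> incr n i (sample \<omega>))) \<partial>M)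
      = (\<Prod>i<2^n. ennreal (exp ((Q (g i) \<bullet> g i) / 2 ^ n / 2)))"
    by (intro prod.cong mgf_incr) auto
  moreover have "\<dots> = ennreal (exp ((\<Sum>k<2^n. Q (g k) \<bullet> g k) / 2 ^ n / 2))"
    by (simp add: prod_ennreal sum_divide_distrib flip: exp_sum)
  ultimately show ?thesis by simp
qed

text \<open>The 2 pays for the perturbation of the variances by powers of 1/2 in
  \<open>increment_tail\<close>.\<close>

definition \<tau>0 :: real where "\<tau>0 = tail_trace 0 + 2"

text \<open>Variances along \<open>e i\<close> may vanish while \<open>gaussian_tail\<close> needs
  positive bounds; adding (1/2)^i repairs this at a summable cost.\<close>

lemma increment_tail:
  assumes k: "k < 2 ^ m" and \<rho>: "0 \<le> \<rho>"
  shows "prob {\<omega>\<in>space M. norm (incr m k (sample \<omega>)) > \<rho>} \<le> sqrt 2 * exp (- \<rho>\<^sup>2 * 2 ^ m / (4 * \<tau>0))"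
proof -
  let ?r = "\<lambda>i. (e_var i + (1/2) ^ i) / 2 ^ m"
  have "prob {\<omega>\<in>space M. norm (incr m k (sample \<omega>)) > \<rho>} \<le> sqrt 2 * exp (- \<rho>\<^sup>2 / (4 * (\<tau>0 / 2 ^ m)))"
  proof (rule gaussian_tail[OF prob_space_axioms _ _ _ _ \<rho>, where r = ?r])
    show "0 < ?r i" for i using e_var_nonneg[of i] by (simp add: add_nonneg_pos)
    show "(\<Sum>i<n. ?r i) \<le> \<tau>0 / 2 ^ m" for n
    proof -
      have "(\<Sum>i<n. e_var i + (1/2) ^ i) \<le> \<tau>0"
        using sum_tail_le[of 0 n] sum_half_powers_le[of n] by (simp add: sum.distrib \<tau>0_def)
      then show ?thesis by (simp add: divide_right_mono flip: sum_divide_distrib)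
    qed
    fix i and y :: real
    have "(\<integral>\<^sup>+\<omega>. ennreal (exp (y * (e i \<bullet> incr m k (sample \<omega>)))) \<partial>M) = ennreal (exp (y\<^sup>2 * e_var i / 2 ^ m / 2))"
      using mgf_incr[OF k, of "y *\<^sub>R e i"] by (simp add: Q.scaleR e_var_def power2_eq_square mult.assoc)
    also have "\<dots> \<le> ennreal (exp (y\<^sup>2 * ?r i / 2))"
      by (intro ennreal_leI) (simp add: divide_right_mono mult_left_mono)
    finally show "(\<integral>\<^sup>+\<omega>. ennreal (exp (y * (e i \<bullet> incr m k (sample \<omega>)))) \<partial>M) \<le> ennreal (exp (y\<^sup>2 * ?r i / 2))" .
  qed (use k in measurable)
  then show ?thesis by (simp add: field_simps)
qed

text \<open>Here the perturbation carries an extra (1/2)^n so that the sum still tends to 0.\<close>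

definition \<tau>1 :: "nat \<Rightarrow> real" where "\<tau>1 n = tail_trace n + 2 * (1/2) ^ n"

lemma \<tau>1_pos: "\<tau>1 n > 0"
  unfolding \<tau>1_def using tail_trace_nonneg[of n] by (simp add: add_nonneg_pos)

lemma \<tau>0_pos: "\<tau>0 > 0"
  unfolding \<tau>0_def using tail_trace_nonneg[of 0] by simp

lemma \<tau>1_tendsto: "\<tau>1 \<longlonglongrightarrow> 0"
proof -
  have "(\<lambda>n. tail_trace n + 2 * (1/2) ^ n) \<longlonglongrightarrow> 0 + 2 * 0"
    by (intro tendsto_intros tail_trace_tendsto_0 LIMSEQ_realpow_zero) auto
  then show ?thesis by (simp add: \<tau>1_def[abs_def])
qed

text \<open>Paired with \<open>e i\<close>, the error is a Gaussian increment from time 0 in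
  direction T n (e i), whose variance lies below the i-th term of the tail.\<close>

lemma projection_tail:
  assumes t: "t \<in> {0..1}" and \<rho>: "0 \<le> \<rho>"
  shows "prob {\<omega>\<in>space M. norm (W t \<omega> - P n (W t \<omega>)) > \<rho>} \<le> sqrt 2 * exp (- \<rho>\<^sup>2 / (4 * \<tau>1 n))"
proof (rule gaussian_tail[OF prob_space_axioms _ _ _ _ \<rho>])
  let ?r = "\<lambda>i. (if i < n then 0 else e_var i) + (1/2) ^ i * (1/2) ^ n"
  have [measurable]: "W t \<in> borel_measurable M" by (rule measurable_W[OF t])
  have [measurable]: "P n \<in> borel_measurable borel"
    by (intro borel_measurable_continuous_onI P.continuous_on continuous_on_id)
  show "(\<lambda>\<omega>. W t \<omega> - P n (W t \<omega>)) \<in> borel_measurable M" by measurable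
  show "0 < ?r i" for i using e_var_nonneg[of i] by (simp add: add_nonneg_pos)
  show "(\<Sum>i<N. ?r i) \<le> \<tau>1 n" for N
  proof -
    have "(\<Sum>i<N. (1/2::real) ^ i * (1/2) ^ n) \<le> 2 * (1/2) ^ n"
      using sum_half_powers_le[of N] by (simp flip: sum_distrib_right)
    then show ?thesis using sum_tail_le[of n N] by (simp add: sum.distrib \<tau>1_def)
  qed
  fix i and y :: real
  have "(\<integral>\<^sup>+\<omega>. ennreal (exp (y * (e i \<bullet> (W t \<omega> - P n (W t \<omega>))))) \<partial>M)
      = (\<integral>\<^sup>+\<omega>. ennreal (exp ((y *\<^sub>R T n (e i)) \<bullet> (W t \<omega> - W 0 \<omega>))) \<partial>M)"
  proof (intro nn_integral_cong)
    fix \<omega> assume "\<omega> \<in> space M"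
    then show "ennreal (exp (y * (e i \<bullet> (W t \<omega> - P n (W t \<omega>))))) = ennreal (exp ((y *\<^sub>R T n (e i)) \<bullet> (W t \<omega> - W 0 \<omega>)))"
      using inner_diff_P[of "W t \<omega>" n "e i"] W_0 by (simp add: inner_commute)
  qed
  also have "\<dots> = ennreal (exp (t * (y\<^sup>2 * (Q (T n (e i)) \<bullet> T n (e i))) / 2))"
    using t by (subst mgf_increment) (auto simp: Q.scaleR power2_eq_square mult_ac)
  also have "\<dots> \<le> ennreal (exp (y\<^sup>2 * ?r i / 2))"
  proof -
    have "t * (y\<^sup>2 * (Q (T n (e i)) \<bullet> T n (e i))) \<le> 1 * (y\<^sup>2 * ?r i)"
    proof (intro mult_mono mult_nonneg_nonneg mult_left_mono)
      have "Q (T n (e i)) \<bullet> T n (e i) \<le> (if i < n then 0 else e_var i)" by (rule Q_T_e_le)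
      also have "\<dots> \<le> ?r i" by simp
      finally show "Q (T n (e i)) \<bullet> T n (e i) \<le> ?r i" .
    qed (use t Q_inner_nonneg in auto)
    then show ?thesis by (intro ennreal_leI) simp
  qed
  finally show "(\<integral>\<^sup>+\<omega>. ennreal (exp (y * (e i \<bullet> (W t \<omega> - P n (W t \<omega>))))) \<partial>M) \<le> ennreal (exp (y\<^sup>2 * ?r i / 2))" .
qed

text \<open>A union bound over all increments of level m \<ge> n exceeding \<eta> (3/4)^(m - n), and
  over the truncation errors at the 2^n + 1 nodes.\<close>

lemma residual_event:
  assumes \<eta>: "\<eta> > 0" and K: "\<eta>\<^sup>2 * 2 ^ n / (4 * \<tau>0) \<ge> 16"
  obtains Bad where "Bad \<in> sets M"
    "prob Bad \<le> sqrt 2 * (2 * 2 ^ n * exp (- (\<eta>\<^sup>2 * 2 ^ n / (4 * \<tau>0))) + (2 ^ n + 1) * exp (- \<eta>\<^sup>2 / (4 * \<tau>1 n)))"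
    "\<And>\<omega> t. \<omega> \<in> space M - Bad \<Longrightarrow> t \<in> {0..1} \<Longrightarrow> norm (W t \<omega> - proj n (sample \<omega>) t) \<le> 5 * \<eta>"
proof -
  define K where "K = \<eta>\<^sup>2 * 2 ^ n / (4 * \<tau>0)"
  define A where "A j k = {\<omega>\<in>space M. norm (incr (n + j) k (sample \<omega>)) > \<eta> * (3/4) ^ j}" for j k
  define A' where "A' j = (\<Union>k<2 ^ (n + j). A j k)" for j
  define C where "C k = {\<omega>\<in>space M. norm (W (real k / 2 ^ n) \<omega> - P n (W (real k / 2 ^ n) \<omega>)) > \<eta>}" for k
  define C' where "C' = (\<Union>k\<le>2 ^ n. C k)"
  have Am: "A j k \<in> sets M" if "k < 2 ^ (n + j)" for j k
    unfolding A_def using measurable_incr[OF that] by measurable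
  then have A'm: "A' j \<in> sets M" for j unfolding A'_def by auto
  note kb = dyadic_in_unit[of _ n]
  have [measurable]: "P n \<in> borel_measurable borel"
    by (intro borel_measurable_continuous_onI P.continuous_on continuous_on_id)
  have Cm: "C k \<in> sets M" if "k \<le> 2 ^ n" for k
    unfolding C_def using measurable_W[OF kb[OF that]] by measurable
  then have C'm: "C' \<in> sets M" unfolding C'_def by auto
  have pA: "prob (A' j) \<le> sqrt 2 * 2 ^ n * (2 ^ j * exp (- K * (9/8) ^ j))" for j
  proof -
    have "prob (A' j) \<le> (\<Sum>k<2 ^ (n + j). prob (A j k))"
      unfolding A'_def by (intro finite_measure_subadditive_finite) (auto intro: Am)
    also have "\<dots> \<le> (\<Sum>k<(2::nat) ^ (n + j). sqrt 2 * exp (- (\<eta> * (3/4) ^ j)\<^sup>2 * 2 ^ (n + j) / (4 * \<tau>0)))"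
      unfolding A_def using \<eta> by (intro sum_mono increment_tail) auto
    \<comment> \<open>The ratio 3/4 is summable along the chain, yet its square times 2 is 9/8 > 1:
      thresholds shrink more slowly than standard deviations, so the exponent grows with j and
      outweighs the number of cells.\<close>
    also have "- (\<eta> * (3/4) ^ j)\<^sup>2 * 2 ^ (n + j) / (4 * \<tau>0) = - K * (9/8) ^ j"
    proof -
      have "((3/4::real) ^ j)\<^sup>2 * 2 ^ j = (9/8) ^ j"
        by (simp add: power2_eq_square flip: power_mult_distrib)
      then show ?thesis
        by (simp add: K_def power_mult_distrib power_add mult_ac)
    qed
    finally show ?thesis by (simp add: power_add mult_ac)
  qed
  have "prob (\<Union>j. A' j) \<le> (\<Sum>j. prob (A' j))"
  proof (rule finite_measure_subadditive_countably)
    show "range A' \<subseteq> sets M" using A'm by auto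
    show "summable (\<lambda>j. prob (A' j))"
      by (rule summable_comparison_test'[OF summable_mult[OF chaining_series_le(1)], of K 0 _ "sqrt 2 * 2 ^ n"])
        (use K pA in \<open>auto simp: K_def\<close>)
  qed
  also have "\<dots> \<le> (\<Sum>j. sqrt 2 * 2 ^ n * (2 ^ j * exp (- K * (9/8) ^ j)))"
  proof (rule suminf_le[OF pA])
    show s: "summable (\<lambda>j. sqrt 2 * 2 ^ n * (2 ^ j * exp (- K * (9/8) ^ j)))"
      using K by (intro summable_mult chaining_series_le(1)) (simp add: K_def)
    show "summable (\<lambda>j. prob (A' j))"
      by (rule summable_comparison_test'[OF s, of 0]) (use pA in auto)
  qed
  also have "\<dots> = sqrt 2 * 2 ^ n * (\<Sum>j. 2 ^ j * exp (- K * (9/8) ^ j))"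
    using K by (intro suminf_mult chaining_series_le(1)) (simp add: K_def)
  also have "\<dots> \<le> sqrt 2 * 2 ^ n * (2 * exp (- K))"
    using K by (intro mult_left_mono chaining_series_le(2)) (auto simp: K_def)
  finally have 1: "prob (\<Union>j. A' j) \<le> sqrt 2 * 2 ^ n * (2 * exp (- K))" .
  have "prob C' \<le> (\<Sum>k\<le>2 ^ n. prob (C k))"
    unfolding C'_def by (intro finite_measure_subadditive_finite) (auto intro: Cm)
  also have "\<dots> \<le> (\<Sum>k\<le>(2::nat) ^ n. sqrt 2 * exp (- \<eta>\<^sup>2 / (4 * \<tau>1 n)))"
    unfolding C_def using \<eta> kb by (intro sum_mono projection_tail) auto
  finally have 2: "prob C' \<le> (2 ^ n + 1) * (sqrt 2 * exp (- \<eta>\<^sup>2 / (4 * \<tau>1 n)))"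
    by (simp add: algebra_simps)
  show ?thesis
  proof (rule that[of "(\<Union>j. A' j) \<union> C'"])
    show "(\<Union>j. A' j) \<union> C' \<in> sets M" using A'm C'm by auto
    have "prob ((\<Union>j. A' j) \<union> C') \<le> prob (\<Union>j. A' j) + prob C'"
      using A'm C'm by (intro measure_Un_le) auto
    also have "\<dots> \<le> sqrt 2 * (2 * 2 ^ n * exp (- K) + (2 ^ n + 1) * exp (- \<eta>\<^sup>2 / (4 * \<tau>1 n)))"
      using 1 2 by (simp add: algebra_simps)
    finally show "prob ((\<Union>j. A' j) \<union> C') \<le> sqrt 2 * (2 * 2 ^ n * exp (- (\<eta>\<^sup>2 * 2 ^ n / (4 * \<tau>0)))
        + (2 ^ n + 1) * exp (- \<eta>\<^sup>2 / (4 * \<tau>1 n)))" by (simp add: K_def)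
    fix \<omega> t assume \<omega>: "\<omega> \<in> space M - ((\<Union>j. A' j) \<union> C')" and t: "t \<in> {0..1::real}"
    show "norm (W t \<omega> - proj n (sample \<omega>) t) \<le> 5 * \<eta>"
    proof (rule norm_diff_proj_le[OF _ t])
      show "continuous_on {0..1} (sample \<omega>)" using \<omega> continuous_W by auto
      show "norm (incr m k (sample \<omega>)) \<le> \<eta> * (3/4) ^ (m - n)" if "m \<ge> n" "k < 2 ^ m" for m k
      proof -
        have "\<omega> \<notin> A (m - n) k"
          using \<omega> that by (auto simp: A'_def)
        then show ?thesis using \<omega> that(1) by (auto simp: A_def not_less)
      qed
      show "norm (W (real k / 2 ^ n) \<omega> - P n (W (real k / 2 ^ n) \<omega>)) \<le> \<eta>" if "k \<le> 2 ^ n" for k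
        using \<omega> that by (auto simp: C'_def C_def not_less)
    qed
  qed
qed

text \<open>Scaling replaces \<eta> by \<eta> / sqrt \<epsilon>, so both exponents gain 1 /
  \<epsilon>, while a large n makes 2^n and 1 / \<tau>1 n as large as K demands. The threshold for n
  is uniform in \<epsilon>.\<close>

lemma residual_exponentially_small:
  assumes \<delta>: "\<delta> > 0" and K: "K > 0"
  shows "\<exists>n0. \<forall>n\<ge>n0. \<exists>B>0. \<forall>\<epsilon>\<in>{0<..1}. \<exists>Bad\<in>sets M. prob Bad \<le> B * exp (- K / \<epsilon>) \<and>
    (\<forall>\<omega>\<in>space M - Bad. \<forall>t\<in>{0..1}. norm (sqrt \<epsilon> *\<^sub>R W t \<omega> - sqrt \<epsilon> *\<^sub>R proj n (sample \<omega>) t) \<le> \<delta>)"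
proof -
  define \<eta> where "\<eta> = \<delta> / 5"
  have \<eta>: "\<eta> > 0" using \<delta> by (simp add: \<eta>_def)
  \<comment> \<open>The bound 16 is the one required by the chaining series.\<close>
  define K' where "K' = max K 16"
  have "\<exists>n1. \<forall>n\<ge>n1. \<eta>\<^sup>2 * 2 ^ n / (4 * \<tau>0) \<ge> K'"
  proof -
    obtain n1 where n1: "K' * (4 * \<tau>0) / \<eta>\<^sup>2 < 2 ^ n1"
      using real_arch_pow[of 2] by auto
    have "\<eta>\<^sup>2 * 2 ^ n / (4 * \<tau>0) \<ge> K'" if "n \<ge> n1" for n
    proof -
      have "K' * (4 * \<tau>0) / \<eta>\<^sup>2 \<le> 2 ^ n"
        by (rule less_imp_le[OF less_le_trans[OF n1 power_increasing[OF that]]]) simp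
      then show ?thesis using \<eta> \<tau>0_pos by (simp add: field_simps)
    qed
    then show ?thesis by blast
  qed
  then obtain n1 where n1: "\<And>n. n \<ge> n1 \<Longrightarrow> \<eta>\<^sup>2 * 2 ^ n / (4 * \<tau>0) \<ge> K'" by blast
  have "\<forall>\<^sub>F n in sequentially. \<tau>1 n < \<eta>\<^sup>2 / (4 * K')"
    using \<tau>1_tendsto by (rule order_tendstoD) (use \<eta> in \<open>simp add: K'_def\<close>)
  then obtain n2 where n2: "\<And>n. n \<ge> n2 \<Longrightarrow> \<tau>1 n < \<eta>\<^sup>2 / (4 * K')"
    unfolding eventually_sequentially by blast
  have K'0: "K' > 0" by (simp add: K'_def)
  show ?thesis
  proof (intro exI[of _ "max n1 n2"] allI impI)
    fix n assume n: "max n1 n2 \<le> n"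
    have a: "\<eta>\<^sup>2 * 2 ^ n / (4 * \<tau>0) \<ge> K'" using n1 n by simp
    have b: "\<eta>\<^sup>2 / (4 * \<tau>1 n) \<ge> K'"
      using n2[of n] n \<tau>1_pos[of n] K'0 by (simp add: field_simps)
    define B where "B = sqrt 2 * (2 * 2 ^ n + (2 ^ n + 1))"
    show "\<exists>B>0. \<forall>\<epsilon>\<in>{0<..1}. \<exists>Bad\<in>sets M. prob Bad \<le> B * exp (- K / \<epsilon>) \<and>
      (\<forall>\<omega>\<in>space M - Bad. \<forall>t\<in>{0..1}. norm (sqrt \<epsilon> *\<^sub>R W t \<omega> - sqrt \<epsilon> *\<^sub>R proj n (sample \<omega>) t) \<le> \<delta>)"
    proof (intro exI[of _ B] conjI ballI)
      show "B > 0" unfolding B_def by (intro mult_pos_pos add_pos_pos) auto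
      fix \<epsilon> :: real assume "\<epsilon> \<in> {0<..1}"
      then have \<epsilon>: "0 < \<epsilon>" "\<epsilon> \<le> 1" by auto
      let ?\<eta> = "\<eta> / sqrt \<epsilon>"
      have sq: "?\<eta>\<^sup>2 = \<eta>\<^sup>2 / \<epsilon>" using \<epsilon> by (simp add: power_divide)
      have a': "?\<eta>\<^sup>2 * 2 ^ n / (4 * \<tau>0) \<ge> K' / \<epsilon>"
        using divide_right_mono[OF a, of \<epsilon>] \<epsilon> unfolding sq by (simp add: field_simps)
      have b': "?\<eta>\<^sup>2 / (4 * \<tau>1 n) \<ge> K' / \<epsilon>"
        using divide_right_mono[OF b, of \<epsilon>] \<epsilon> unfolding sq by (simp add: field_simps)
      \<comment> \<open>Because \<epsilon> \<le> 1, the threshold 16 persists after scaling.\<close>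
      have "K' \<le> K' / \<epsilon>" using \<epsilon> K'0 by (simp add: field_simps)
      then have "?\<eta>\<^sup>2 * 2 ^ n / (4 * \<tau>0) \<ge> 16" using a' by (simp add: K'_def)
      moreover have "?\<eta> > 0" using \<eta> \<epsilon> by simp
      ultimately obtain Bad where Bad: "Bad \<in> sets M"
        "prob Bad \<le> sqrt 2 * (2 * 2 ^ n * exp (- (?\<eta>\<^sup>2 * 2 ^ n / (4 * \<tau>0))) + (2 ^ n + 1) * exp (- ?\<eta>\<^sup>2 / (4 * \<tau>1 n)))"
        "\<And>\<omega> t. \<omega> \<in> space M - Bad \<Longrightarrow> t \<in> {0..1} \<Longrightarrow> norm (W t \<omega> - proj n (sample \<omega>) t) \<le> 5 * ?\<eta>"
        using residual_event by blast
      have KK: "K / \<epsilon> \<le> K' / \<epsilon>" using \<epsilon> by (simp add: K'_def divide_right_mono)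
      show "\<exists>Bad\<in>sets M. prob Bad \<le> B * exp (- K / \<epsilon>) \<and>
        (\<forall>\<omega>\<in>space M - Bad. \<forall>t\<in>{0..1}. norm (sqrt \<epsilon> *\<^sub>R W t \<omega> - sqrt \<epsilon> *\<^sub>R proj n (sample \<omega>) t) \<le> \<delta>)"
      proof (intro bexI[OF _ Bad(1)] conjI ballI)
        have "prob Bad \<le> sqrt 2 * (2 * 2 ^ n * exp (- K / \<epsilon>) + (2 ^ n + 1) * exp (- K / \<epsilon>))"
          using a' b' KK by (intro order_trans[OF Bad(2)] mult_left_mono add_mono) auto
        then show "prob Bad \<le> B * exp (- K / \<epsilon>)" by (simp add: B_def algebra_simps)
        fix \<omega> t assume "\<omega> \<in> space M - Bad" "t \<in> {0..1::real}"
        then have "sqrt \<epsilon> * norm (W t \<omega> - proj n (sample \<omega>) t) \<le> sqrt \<epsilon> * (5 * ?\<eta>)"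
          using \<epsilon> by (intro mult_left_mono Bad(3)) auto
        also have "\<dots> = \<delta>" using \<epsilon> by (simp add: \<eta>_def)
        finally show "norm (sqrt \<epsilon> *\<^sub>R W t \<omega> - sqrt \<epsilon> *\<^sub>R proj n (sample \<omega>) t) \<le> \<delta>"
          using \<epsilon> by (simp flip: scaleR_diff_right)
      qed
    qed
  qed
qed

end

section \<open>The path space\<close>

abbreviation path_metric :: "(real \<Rightarrow> 'a::real_normed_vector) metric" where
  "path_metric \<equiv> cfunspace (top_of_set {0..1}) euclidean_metric"

definition paths :: "(real \<Rightarrow> 'a::real_normed_vector) set" where
  "paths = {F. F \<in> extensional {0..1} \<and> continuous_on {0..1} F}"

lemma mspace_path_metric: "mspace path_metric = (paths :: (real \<Rightarrow> 'a::real_normed_vector) set)"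
proof -
  have "bounded (F ` {0..1})" if "continuous_on {0..1} F" for F :: "real \<Rightarrow> 'a"
    using that by (intro compact_imp_bounded compact_continuous_image) auto
  moreover have "Met_TC.mbounded S \<longleftrightarrow> bounded S" for S :: "'a set"
    unfolding Met_TC.mbounded_def bounded_def by (auto simp: subset_iff)
  ultimately show ?thesis
    by (auto simp: paths_def)
qed

lemma topspace_path_space: "topspace path_space = paths"
  by (simp only: path_space_def topspace_mtopology_of mspace_path_metric)

lemma mdist_path_metric_le:
  "F \<in> paths \<Longrightarrow> G \<in> paths \<Longrightarrow>
    mdist path_metric F G \<le> a \<longleftrightarrow> (\<forall>t\<in>{0..1}. dist (F t) (G t) \<le> a)"
  unfolding mspace_path_metric[symmetric] by (subst cfunspace_mdist_le) auto

text \<open>Closed balls replace open ones, since a distance bound with \<le> is the same as a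
  pointwise bound in t.\<close>

lemma openin_path_space:
  "openin path_space U \<longleftrightarrow> U \<subseteq> paths \<and>
    (\<forall>F\<in>U. \<exists>r>0. \<forall>G\<in>paths. (\<forall>t\<in>{0..1}. dist (F t) (G t) \<le> r) \<longrightarrow> G \<in> U)"
proof -
  interpret Metric_space "paths :: (real \<Rightarrow> 'a) set" "mdist path_metric"
    unfolding mspace_path_metric[symmetric] by (rule Metric_space_mspace_mdist)
  have top: "openin path_space U \<longleftrightarrow> openin mtopology U"
    unfolding path_space_def mtopology_of_def mspace_path_metric ..
  show ?thesis
  proof (cases "U \<subseteq> paths")
    case U: True
    have "(\<exists>r>0. mball F r \<subseteq> U) \<longleftrightarrow> (\<exists>r>0. \<forall>G\<in>paths. (\<forall>t\<in>{0..1}. dist (F t) (G t) \<le> r) \<longrightarrow> G \<in> U)"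
      if F: "F \<in> U" for F
    proof -
      have Fp: "F \<in> paths" using F U by blast
      have "(\<exists>r>0. mball F r \<subseteq> U) \<longleftrightarrow> (\<exists>r>0. mcball F r \<subseteq> U)"
        by (rule mball_iff_mcball)
      also have "\<dots> \<longleftrightarrow> (\<exists>r>0. \<forall>G\<in>paths. mdist path_metric F G \<le> r \<longrightarrow> G \<in> U)"
        using Fp by (auto simp: subset_iff)
      also have "\<dots> \<longleftrightarrow> (\<exists>r>0. \<forall>G\<in>paths. (\<forall>t\<in>{0..1}. dist (F t) (G t) \<le> r) \<longrightarrow> G \<in> U)"
        using mdist_path_metric_le[OF Fp] by auto
      finally show ?thesis .
    qed
    then show ?thesis unfolding top openin_mtopology using U by auto
  next
    case False
    then show ?thesis by (metis openin_subset topspace_path_space)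
  qed
qed

lemma closedin_path_spaceI:
  assumes "A \<subseteq> paths"
    and "\<And>F. F \<in> paths \<Longrightarrow> (\<And>r. r > 0 \<Longrightarrow> \<exists>G\<in>A. \<forall>t\<in>{0..1}. dist (F t) (G t) \<le> r) \<Longrightarrow> F \<in> A"
  shows "closedin path_space A"
  unfolding closedin_def topspace_path_space openin_path_space
  using assms by blast

lemma closedin_path_spaceD:
  assumes A: "closedin path_space A" and F: "F \<in> paths"
    and lim: "\<And>r. r > 0 \<Longrightarrow> \<exists>G\<in>A. \<forall>t\<in>{0..1}. dist (F t) (G t) \<le> r"
  shows "F \<in> A"
proof (rule ccontr)
  assume "F \<notin> A"
  then obtain r where "r > 0" "\<And>G. G \<in> paths \<Longrightarrow> \<forall>t\<in>{0..1}. dist (F t) (G t) \<le> r \<Longrightarrow> G \<notin> A"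
    using A F unfolding closedin_def topspace_path_space openin_path_space by blast
  moreover have "A \<subseteq> paths" using A by (metis closedin_subset topspace_path_space)
  ultimately show False using lim by blast
qed

lemma Hausdorff_path_space: "Hausdorff_space path_space"
  unfolding path_space_def mtopology_of_def
  by (rule Metric_space.Hausdorff_space_mtopology[OF Metric_space_mspace_mdist])

lemma restrict_in_paths: "continuous_on {0..1} F \<Longrightarrow> restrict F {0..1} \<in> paths"
  by (auto simp: paths_def intro: continuous_on_eq)

lemma continuous_on_paths: "F \<in> paths \<Longrightarrow> continuous_on {0..1} F"
  by (simp add: paths_def)

text \<open>Polygons with node values in a countable dense set; uniform continuity makes them
  approximate every path.\<close>

lemma countable_dense_paths:
  "\<exists>D\<subseteq>(paths :: (real \<Rightarrow> 'a::{real_normed_vector, second_countable_topology}) set). countable D \<and>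
     (\<forall>F\<in>paths. \<forall>r>0. \<exists>G\<in>D. \<forall>t\<in>{0..1}. dist (F t) (G t) \<le> r)"
proof -
  obtain D0 :: "'a set" where D0: "countable D0" "\<And>X. open X \<Longrightarrow> X \<noteq> {} \<Longrightarrow> \<exists>d\<in>D0. d \<in> X"
    using countable_dense_exists by blast
  \<comment> \<open>Node values are indexed by k and read off at time s through the floor of 2^n s,
    which is exact at the nodes.\<close>
  define E :: "nat \<Rightarrow> (nat \<Rightarrow> 'a) \<Rightarrow> real \<Rightarrow> 'a" where
    "E n v = (\<lambda>t\<in>{0..1}. polygon n (\<lambda>s. v (nat \<lfloor>2 ^ n * s\<rfloor>)) t)" for n v
  define D where "D = (\<Union>n. E n ` (PiE {..2 ^ n} (\<lambda>_. D0)))"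
  have "countable D" unfolding D_def
    by (intro countable_UN countable_image countable_PiE D0) auto
  moreover have "D \<subseteq> paths"
    unfolding D_def E_def by (auto intro!: restrict_in_paths continuous_on_polygon)
  moreover have "\<exists>G\<in>D. \<forall>t\<in>{0..1}. dist (F t) (G t) \<le> r" if F: "F \<in> paths" and r: "r > 0" for F :: "real \<Rightarrow> 'a" and r
  proof -
    have "uniformly_continuous_on {0..1} F"
      using F by (intro compact_uniformly_continuous continuous_on_paths) auto
    then obtain d where d: "d > 0" "\<And>x y. x \<in> {0..1} \<Longrightarrow> y \<in> {0..1} \<Longrightarrow> dist y x < d \<Longrightarrow> dist (F y) (F x) < r / 2"
      using r unfolding uniformly_continuous_on_def by (metis half_gt_zero)
    obtain n where n: "(1/2) ^ n < d"
      using d(1) real_arch_pow_inv[of d "1/2"] by auto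
    have "\<exists>x\<in>D0. dist (F (real k / 2 ^ n)) x < r / 2" for k :: nat
      using D0(2)[of "ball (F (real k / 2 ^ n)) (r / 2)"] r by auto
    then obtain v where v: "\<And>k. v k \<in> D0" "\<And>k. dist (F (real k / 2 ^ n)) (v k) < r / 2" by metis
    let ?v = "restrict v {..2 ^ n}" and ?V = "\<lambda>s. restrict v {..2 ^ n} (nat \<lfloor>2 ^ n * s\<rfloor>)"
    have V: "?V (real k / 2 ^ n) = v k" if "k \<le> 2 ^ n" for k
      using that by simp
    have "dist (F t) (E n ?v t) \<le> r" if t: "t \<in> {0..1}" for t
    proof -
      obtain k where k: "k < 2 ^ n" "real k / 2 ^ n \<le> t" "t \<le> real (Suc k) / 2 ^ n"
        using exists_dyadic_cell[OF t] .
      have "real (Suc k) / 2 ^ n - real k / 2 ^ n = (1/2) ^ n" by (simp add: field_simps)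
      with n have c: "real (Suc k) / 2 ^ n - real k / 2 ^ n < d" by simp
      have near: "norm (F t - v l) \<le> r" if "real l / 2 ^ n \<in> {0..1}" "dist t (real l / 2 ^ n) < d" for l
      proof -
        have "dist (F t) (F (real l / 2 ^ n)) < r / 2" using that t by (intro d(2))
        then have "dist (F t) (v l) < r / 2 + r / 2" using v(2)[of l] dist_triangle_less_add by (metis dist_commute)
        then show ?thesis by (simp add: dist_norm)
      qed
      have "norm (F t - polygon n ?V t) \<le> r"
      proof (rule norm_polygon_diff_le[OF k])
        show "norm (F t - ?V (real k / 2 ^ n)) \<le> r"
          using k dyadic_bounds[OF k(1)] c by (subst V) (auto intro!: near simp: dist_real_def)
        have "norm (F t - v (Suc k)) \<le> r"
          by (rule near) (use k dyadic_bounds[OF k(1)] c in \<open>auto simp: dist_real_def\<close>)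
        then show "norm (F t - ?V (real (Suc k) / 2 ^ n)) \<le> r"
          using k(1) by (subst V) auto
      qed
      then show ?thesis using t by (simp add: E_def dist_norm)
    qed
    moreover have "E n ?v \<in> D" unfolding D_def using v(1) by (intro UN_I[of n] imageI restrict_PiE_iff[THEN iffD2]) auto
    ultimately show ?thesis by blast
  qed
  ultimately show ?thesis by blast
qed

text \<open>By separability an open set is a countable union of closed balls with centres in D and
  rational radii; by continuity membership in such a ball is decided at rational times.\<close>

lemma measurable_path_map:
  fixes X :: "real \<Rightarrow> 'w \<Rightarrow> 'a::{real_normed_vector, second_countable_topology}"
  assumes X: "\<And>t. t \<in> {0..1} \<Longrightarrow> X t \<in> borel_measurable M"
    and cont: "\<And>\<omega>. \<omega> \<in> space M \<Longrightarrow> continuous_on {0..1} (\<lambda>t. X t \<omega>)"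
  shows "(\<lambda>\<omega>. \<lambda>t\<in>{0..1}. X t \<omega>) \<in> M \<rightarrow>\<^sub>M borel_of path_space"
  unfolding borel_of_def
proof (rule measurable_measure_of)
  let ?\<Phi> = "\<lambda>\<omega>. \<lambda>t\<in>{0..1}. X t \<omega>"
  have \<Phi>: "?\<Phi> \<omega> \<in> paths" if "\<omega> \<in> space M" for \<omega>
    by (rule restrict_in_paths[OF cont[OF that]])
  then show "?\<Phi> \<in> space M \<rightarrow> topspace path_space" by (auto simp: topspace_path_space)
  obtain D :: "(real \<Rightarrow> 'a) set" where D: "D \<subseteq> paths" "countable D"
    "\<And>F r. F \<in> paths \<Longrightarrow> r > 0 \<Longrightarrow> \<exists>G\<in>D. \<forall>t\<in>{0..1}. dist (F t) (G t) \<le> r"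
    using countable_dense_paths by blast
  fix U :: "(real \<Rightarrow> 'a) set" assume "U \<in> {U. openin path_space U}"
  then have U: "openin path_space U" by simp
  define C where "C G q = {\<omega>\<in>space M. \<forall>t\<in>{0..1} \<inter> \<rat>. dist (X t \<omega>) (G t) \<le> q}" for G q
  have C: "C G q \<in> sets M" for G q
  proof -
    have "C G q = (\<Inter>t\<in>{0..1} \<inter> \<rat>. {\<omega>\<in>space M. dist (X t \<omega>) (G t) \<le> q})"
    proof -
      have "0 \<in> {0..1} \<inter> (\<rat> :: real set)" by simp
      then show ?thesis unfolding C_def by blast
    qed
    also have "\<dots> \<in> sets M"
    proof (rule sets.countable_INT')
      have "0 \<in> {0..1} \<inter> (\<rat> :: real set)" by simp
      then show "{0..1} \<inter> \<rat> \<noteq> ({} :: real set)" by blast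
    qed (use countable_rat X in auto)
    finally show ?thesis .
  qed
  have CI: "\<omega> \<in> C G q \<longleftrightarrow> (\<forall>t\<in>{0..1}. dist (X t \<omega>) (G t) \<le> q)" if \<omega>: "\<omega> \<in> space M" and G: "G \<in> paths" for \<omega> G q
  proof
    assume *: "\<omega> \<in> C G q"
    have "continuous_on {0..1} (\<lambda>t. dist (X t \<omega>) (G t))"
      by (intro continuous_intros cont[OF \<omega>] continuous_on_paths[OF G])
    moreover have "closure ({0..1} \<inter> \<rat>) = {0..1::real}"
      by (subst closure_convex_Int_superset) (auto simp: Rats_closure_real)
    ultimately show "\<forall>t\<in>{0..1}. dist (X t \<omega>) (G t) \<le> q"
      using continuous_le_on_closure[of "{0..1} \<inter> \<rat>" "\<lambda>t. dist (X t \<omega>) (G t)" _ q] *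
      by (auto simp: C_def)
  qed (use \<omega> in \<open>auto simp: C_def\<close>)
  let ?I = "{(G, q). G \<in> D \<and> q \<in> \<rat> \<and> (\<forall>F\<in>paths. (\<forall>t\<in>{0..1}. dist (F t) (G t) \<le> q) \<longrightarrow> F \<in> U)}"
  have "?I \<subseteq> D \<times> \<rat>" by auto
  then have "countable ?I" using D(2) countable_rat by (meson countable_SIGMA countable_subset)
  have "?\<Phi> -` U \<inter> space M = (\<Union>(G, q)\<in>?I. C G q)"
  proof (intro equalityI subsetI)
    fix \<omega> assume \<omega>: "\<omega> \<in> ?\<Phi> -` U \<inter> space M"
    then obtain r where r: "r > 0" "\<And>F. F \<in> paths \<Longrightarrow> \<forall>t\<in>{0..1}. dist (?\<Phi> \<omega> t) (F t) \<le> r \<Longrightarrow> F \<in> U"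
      using U unfolding openin_path_space by blast
    \<comment> \<open>A radius below r / 2 keeps the whole ball around the chosen centre within
      distance r of the path.\<close>
    obtain q where q: "q \<in> \<rat>" "0 < q" "q < r / 2" using Rats_dense_in_real[of 0 "r / 2"] r(1) by auto
    obtain G where G: "G \<in> D" "\<forall>t\<in>{0..1}. dist (?\<Phi> \<omega> t) (G t) \<le> q" using D(3) \<Phi> \<omega> q(2) by blast
    have "F \<in> U" if "F \<in> paths" "\<forall>t\<in>{0..1}. dist (F t) (G t) \<le> q" for F
    proof (rule r(2)[OF that(1)], rule)
      fix t :: real assume t: "t \<in> {0..1}"
      show "dist (?\<Phi> \<omega> t) (F t) \<le> r"
        using dist_triangle2[of "?\<Phi> \<omega> t" "F t" "G t"] bspec[OF G(2) t] bspec[OF that(2) t] q(3) by linarith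
    qed
    then have "(G, q) \<in> ?I" using G q by auto
    moreover have "\<omega> \<in> C G q" using CI[of \<omega> G q] \<omega> G D(1) by auto
    ultimately show "\<omega> \<in> (\<Union>(G, q)\<in>?I. C G q)" by blast
  next
    fix \<omega> assume "\<omega> \<in> (\<Union>(G, q)\<in>?I. C G q)"
    then obtain G q where G: "(G, q) \<in> ?I" "\<omega> \<in> C G q" by blast
    then have \<omega>: "\<omega> \<in> space M" by (simp add: C_def)
    have "\<forall>t\<in>{0..1}. dist (X t \<omega>) (G t) \<le> q" using CI[OF \<omega>, of G q] G D(1) by auto
    then show "\<omega> \<in> ?\<Phi> -` U \<inter> space M" using G(1) \<Phi>[OF \<omega>] \<omega> by auto
  qed
  moreover have "(\<Union>(G, q)\<in>?I. C G q) \<in> sets M"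
    using \<open>countable ?I\<close> C by (intro sets.countable_UN') auto
  ultimately show "?\<Phi> -` U \<inter> space M \<in> sets M" by simp
qed (use openin_subset in auto)

section \<open>Logarithmic limits and diagonal extraction\<close>

lemma log_prob_nonpos: "p \<le> 1 \<Longrightarrow> 0 \<le> p \<Longrightarrow> 0 \<le> \<epsilon> \<Longrightarrow> ereal \<epsilon> * log_prob p \<le> 0"
  by (cases "\<epsilon> = 0") (auto simp: log_prob_def mult_nonneg_nonpos)

text \<open>A prefactor independent of \<epsilon> contributes only \<epsilon> ln B, which tends to
  0; events of probability 0 have logarithm \<open>-\<infinity>\<close>.\<close>

lemma Limsup_log_prob_le:
  assumes B: "B > 0" and p: "\<And>\<epsilon>. 0 \<le> p \<epsilon>"
    and le: "\<forall>\<^sub>F \<epsilon> in at_right 0. p \<epsilon> \<le> B * exp (- K / \<epsilon>)"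
  shows "Limsup (at_right 0) (\<lambda>\<epsilon>. ereal \<epsilon> * log_prob (p \<epsilon>)) \<le> ereal (- K)"
proof -
  have pos: "\<forall>\<^sub>F \<epsilon> in at_right 0. (0::real) < \<epsilon>"
    by (simp add: eventually_at_right_less)
  have "\<forall>\<^sub>F \<epsilon> in at_right 0. ereal \<epsilon> * log_prob (p \<epsilon>) \<le> ereal (\<epsilon> * ln B - K)"
    using le pos
  proof eventually_elim
    case (elim \<epsilon>)
    show ?case
    proof (cases "p \<epsilon> = 0")
      case True
      then show ?thesis using elim by (simp add: log_prob_def)
    next
      case False
      then have "p \<epsilon> > 0" using p[of \<epsilon>] by simp
      then have "ln (p \<epsilon>) \<le> ln (B * exp (- K / \<epsilon>))" using elim by simp
      also have "\<dots> = ln B - K / \<epsilon>" using B by (simp add: ln_mult)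
      finally have "\<epsilon> * ln (p \<epsilon>) \<le> \<epsilon> * (ln B - K / \<epsilon>)" using elim by (intro mult_left_mono) auto
      then show ?thesis using False elim by (simp add: log_prob_def right_diff_distrib)
    qed
  qed
  then have "Limsup (at_right 0) (\<lambda>\<epsilon>. ereal \<epsilon> * log_prob (p \<epsilon>)) \<le> Limsup (at_right 0) (\<lambda>\<epsilon>. ereal (\<epsilon> * ln B - K))"
    by (rule Limsup_mono)
  also have "\<dots> = ereal (- K)"
  proof (rule lim_imp_Limsup)
    have "((\<lambda>\<epsilon>. \<epsilon> * ln B - K) \<longlongrightarrow> 0 * ln B - K) (at_right 0)"
      by (intro tendsto_intros)
    then show "((\<lambda>\<epsilon>. ereal (\<epsilon> * ln B - K)) \<longlongrightarrow> ereal (- K)) (at_right 0)" by simp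
  qed simp
  finally show ?thesis .
qed

lemma Liminf_log_prob_ge:
  assumes B: "B > 0"
    and le: "\<forall>\<^sub>F \<epsilon> in at_right 0. p \<epsilon> \<ge> B * exp (- K / \<epsilon>)"
  shows "Liminf (at_right 0) (\<lambda>\<epsilon>. ereal \<epsilon> * log_prob (p \<epsilon>)) \<ge> ereal (- K)"
proof -
  have pos: "\<forall>\<^sub>F \<epsilon> in at_right 0. (0::real) < \<epsilon>"
    by (simp add: eventually_at_right_less)
  have "ereal (- K) = Liminf (at_right 0) (\<lambda>\<epsilon>. ereal (\<epsilon> * ln B - K))"
  proof (rule lim_imp_Liminf[symmetric])
    have "((\<lambda>\<epsilon>. \<epsilon> * ln B - K) \<longlongrightarrow> 0 * ln B - K) (at_right 0)"
      by (intro tendsto_intros)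
    then show "((\<lambda>\<epsilon>. ereal (\<epsilon> * ln B - K)) \<longlongrightarrow> ereal (- K)) (at_right 0)" by simp
  qed simp
  also have "\<dots> \<le> Liminf (at_right 0) (\<lambda>\<epsilon>. ereal \<epsilon> * log_prob (p \<epsilon>))"
  proof (rule Liminf_mono)
    show "\<forall>\<^sub>F \<epsilon> in at_right 0. ereal (\<epsilon> * ln B - K) \<le> ereal \<epsilon> * log_prob (p \<epsilon>)"
      using le pos
    proof eventually_elim
      case (elim \<epsilon>)
      have "0 < B * exp (- K / \<epsilon>)" using B by simp
      then have p: "p \<epsilon> > 0" using elim by linarith
      have "ln B - K / \<epsilon> = ln (B * exp (- K / \<epsilon>))" using B by (simp add: ln_mult)
      also have "\<dots> \<le> ln (p \<epsilon>)" using elim p \<open>0 < B * exp (- K / \<epsilon>)\<close> by (simp only: ln_le_cancel_iff)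
      finally have "\<epsilon> * (ln B - K / \<epsilon>) \<le> \<epsilon> * ln (p \<epsilon>)" using elim by (intro mult_left_mono) auto
      then show ?case using p elim by (simp add: log_prob_def right_diff_distrib)
    qed
  qed
  finally show ?thesis .
qed

lemma bounded_family_convergent_subsequence:
  fixes f :: "nat \<Rightarrow> nat \<Rightarrow> real"
  assumes "\<And>k i. \<bar>f k i\<bar> \<le> M"
  obtains r where "strict_mono r" "\<forall>i. convergent (\<lambda>k. f (r k) i)"
proof -
  interpret subseqs "\<lambda>i s. convergent (\<lambda>k. f (s k) i)"
  proof
    fix i and s :: "nat \<Rightarrow> nat"
    have "seq_compact {- M..M}" by (simp add: compact_imp_seq_compact)
    moreover have "\<forall>k. f (s k) i \<in> {- M..M}" using assms by (simp add: abs_le_iff minus_le_iff)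
    ultimately obtain l r where "strict_mono r" "((\<lambda>k. f (s k) i) \<circ> r) \<longlonglongrightarrow> l"
      unfolding seq_compact_def by (auto dest!: spec[of _ "\<lambda>k. f (s k) i"])
    then show "\<exists>r. strict_mono r \<and> convergent (\<lambda>k. f ((s \<circ> r) k) i)"
      by (auto simp: convergent_def o_def)
  qed
  have "convergent (\<lambda>k. f (diagseq k) i)" for i
  proof -
    \<comment> \<open>From index i + 1 on, the diagonal sequence is a subsequence of the one
      selected for coordinate i.\<close>
    have "convergent (\<lambda>k. f ((diagseq \<circ> ((+) (Suc i))) k) i)"
    proof (rule diagseq_holds)
      fix n and r s :: "nat \<Rightarrow> nat" assume "strict_mono r" "convergent (\<lambda>k. f (s k) n)"
      then show "convergent (\<lambda>k. f ((s \<circ> r) k) n)"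
        using convergent_subseq_convergent[of "\<lambda>k. f (s k) n" r] by (simp add: o_def)
    qed
    then have "convergent (\<lambda>k. f (diagseq (k + Suc i)) i)" by (simp add: o_def add.commute)
    then show ?thesis using convergent_ignore_initial_segment[of "\<lambda>k. f (diagseq k) i" "Suc i"] by simp
  qed
  then show ?thesis using that[of diagseq] subseq_diagseq by blast
qed

section \<open>Closedness and compactness of the level sets\<close>

context covariance_basis
begin

lemma wiener_rate_cong:
  "(\<And>t. t \<in> {0..1} \<Longrightarrow> F t = G t) \<Longrightarrow> wiener_rate Q F = wiener_rate Q G"
  unfolding wiener_rate_def by simp

lemma rate_function_wiener_rate: "rate_function path_space (wiener_rate Q)"
  unfolding rate_function_def topspace_path_space
proof (intro allI impI closedin_path_spaceI)
  fix C :: real and F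
  assume C: "0 \<le> C" and F: "F \<in> paths"
    and lim: "\<And>r. r > 0 \<Longrightarrow> \<exists>G\<in>{x \<in> paths. wiener_rate Q x \<le> ennreal C}. \<forall>t\<in>{0..1}. dist (F t) (G t) \<le> r"
  have "\<exists>G. G \<in> paths \<and> wiener_rate Q G \<le> ennreal C \<and> (\<forall>t\<in>{0..1}. dist (F t) (G t) \<le> (1/2) ^ k)" for k :: nat
    using lim[of "(1/2) ^ k"] by auto
  then have ex: "\<forall>k::nat. \<exists>G. G \<in> paths \<and> wiener_rate Q G \<le> ennreal C \<and> (\<forall>t\<in>{0..1}. dist (F t) (G t) \<le> (1/2) ^ k)"
    by (rule allI)
  obtain G where "\<forall>k. G k \<in> paths \<and> wiener_rate Q (G k) \<le> ennreal C \<and> (\<forall>t\<in>{0..1}. dist (F t) (G k t) \<le> (1/2) ^ k)"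
    using choice[OF ex] by blast
  then have G: "\<And>k. G k \<in> paths" "\<And>k. wiener_rate Q (G k) \<le> ennreal C"
      "\<And>k t. t \<in> {0..1} \<Longrightarrow> dist (F t) (G k t) \<le> (1/2) ^ k"
    by blast+
  note R = wiener_rate_le_iff[OF continuous_on_paths[OF G(1)] C, THEN iffD1, OF G(2)]
  have Glim: "(\<lambda>k. G k t) \<longlonglongrightarrow> F t" if "t \<in> {0..1}" for t
  proof (rule metric_tendsto_imp_tendsto[OF LIMSEQ_realpow_zero[of "1/2"]])
    show "\<forall>\<^sub>F k in sequentially. dist (G k t) (F t) \<le> dist ((1/2::real) ^ k) 0"
      using G(3)[OF that] by (simp add: dist_commute)
  qed auto
  have "F 0 = 0"
    using LIMSEQ_unique[OF Glim[of 0]] R by simp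
  moreover have "F t \<bullet> z = 0" if "t \<in> {0..1}" "Q z = 0" for t z
  proof -
    have "(\<lambda>k. G k t \<bullet> z) \<longlonglongrightarrow> F t \<bullet> z"
      by (intro tendsto_intros Glim that)
    moreover have "(\<lambda>k. G k t \<bullet> z) = (\<lambda>k. 0)" using R that by auto
    ultimately show ?thesis by (simp add: LIMSEQ_const_iff)
  qed
  moreover have "energy n F \<le> 2 * C" for n
  proof (rule LIMSEQ_le_const2)
    show "(\<lambda>k. energy n (G k)) \<longlonglongrightarrow> energy n F"
      unfolding energy_def incr_def
      by (intro tendsto_intros Glim) (use dyadic_bounds in auto)
    show "\<exists>N. \<forall>k\<ge>N. energy n (G k) \<le> 2 * C" using R by blast
  qed
  ultimately show "F \<in> {x \<in> paths. wiener_rate Q x \<le> ennreal C}"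
    using F wiener_rate_le_iff[OF continuous_on_paths[OF F] C] by blast
qed auto

lemma proj_error_tendsto_0:
  "(\<lambda>n. sqrt (B * tail_trace 0 / 2 ^ n) + sqrt (B * tail_trace n)) \<longlonglongrightarrow> 0"
proof -
  have "(\<lambda>n. sqrt (B * tail_trace 0 * (1/2) ^ n) + sqrt (B * tail_trace n)) \<longlonglongrightarrow> sqrt (B * tail_trace 0 * 0) + sqrt (B * 0)"
    by (intro tendsto_intros tail_trace_tendsto_0 LIMSEQ_realpow_zero) auto
  then show ?thesis by (simp add: power_one_over)
qed

text \<open>A common energy bound makes \<open>proj n\<close> uniformly accurate on the level set,
  and for fixed n it depends on finitely many bounded numbers. Diagonal extraction makes all of
  these converge, so the paths are uniformly Cauchy.\<close>

lemma level_set_subsequence: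
  fixes G :: "nat \<Rightarrow> real \<Rightarrow> 'h"
  assumes G: "\<And>k. G k \<in> paths" and C: "0 \<le> C" "\<And>k. wiener_rate Q (G k) \<le> ennreal C"
  obtains r :: "nat \<Rightarrow> nat" and F where "strict_mono r" "F \<in> paths" "wiener_rate Q F \<le> ennreal C"
    "\<forall>\<delta>>0. \<exists>N. \<forall>k\<ge>N. \<forall>t\<in>{0..1}. dist (G (r k) t) (F t) \<le> \<delta>"
proof -
  define B where "B = 2 * C + 1"
  have B: "B \<ge> 0" using C by (simp add: B_def)
  have E: "has_energy (G k) B" for k
    unfolding B_def by (rule has_energy_if_wiener_rate_le[OF C(2,1)]) simp
  have hb: "\<bar>h j \<bullet> G k t\<bar> \<le> sqrt B" if "t \<in> {0..1}" for j k t
  proof -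
    have "(h j \<bullet> G k t)\<^sup>2 \<le> B * (Q (h j) \<bullet> h j)"
      using has_energy_cm_le_value[OF E that] by (simp add: cm_le_def)
    also have "\<dots> \<le> B * 1" using B h_self_le_1 by (intro mult_left_mono) auto
    finally show ?thesis by (simp add: real_le_rsqrt[of "\<bar>_\<bar>"])
  qed
  \<comment> \<open>One natural number encodes the triple (j, n, l) of direction, level and node;
    invalid nodes get 0.\<close>
  define c where "c k i = (case prod_decode i of (j, i') \<Rightarrow> case prod_decode i' of (n, l) \<Rightarrow>
    if l \<le> 2 ^ n then h j \<bullet> G k (real l / 2 ^ n) else 0)" for k i :: nat
  have cb: "\<bar>c k i\<bar> \<le> sqrt B" for k i
    using hb[OF dyadic_in_unit] B by (auto simp: c_def split: prod.split)
  obtain r where r: "strict_mono r" "\<forall>i. convergent (\<lambda>k. c (r k) i)"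
    by (rule bounded_family_convergent_subsequence[of c "sqrt B", OF cb])
  have conv: "convergent (\<lambda>k. h j \<bullet> G (r k) (real l / 2 ^ n))" if "l \<le> 2 ^ n" for j l n
    using r(2)[rule_format, of "prod_encode (j, prod_encode (n, l))"] that by (simp add: c_def)
  have convP: "Cauchy (\<lambda>k. P n (G (r k) (real l / 2 ^ n)))" if "l \<le> 2 ^ n" for l n
  proof -
    define L where "L j = lim (\<lambda>k. h j \<bullet> G (r k) (real l / 2 ^ n))" for j
    have L: "(\<lambda>k. h j \<bullet> G (r k) (real l / 2 ^ n)) \<longlonglongrightarrow> L j" for j
      unfolding L_def using conv[OF that] by (simp add: convergent_LIMSEQ_iff)
    have "(\<lambda>k. P n (G (r k) (real l / 2 ^ n))) \<longlonglongrightarrow> (\<Sum>j<n. L j *\<^sub>R Q (h j))"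
      unfolding P_def by (intro tendsto_intros L)
    then show ?thesis by (rule LIMSEQ_imp_Cauchy)
  qed
  \<comment> \<open>Two projection errors and one distance between projections, each at most
    \<delta> / 4.\<close>
  have uCauchy: "\<exists>N. \<forall>k\<ge>N. \<forall>k'\<ge>N. \<forall>t\<in>{0..1}. dist (G (r k) t) (G (r k') t) < \<delta>" if \<delta>: "\<delta> > 0" for \<delta>
  proof -
    have "\<forall>\<^sub>F n in sequentially. sqrt (B * tail_trace 0 / 2 ^ n) + sqrt (B * tail_trace n) < \<delta> / 4"
      by (rule order_tendstoD[OF proj_error_tendsto_0]) (use \<delta> in simp)
    then obtain n where n: "sqrt (B * tail_trace 0 / 2 ^ n) + sqrt (B * tail_trace n) < \<delta> / 4"
      unfolding eventually_sequentially by blast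
    have err: "norm (G k t - proj n (G k) t) < \<delta> / 4" if "t \<in> {0..1}" for k t
      using has_energy_norm_diff_proj[OF E that, of k n] n by simp
    have "\<exists>N. \<forall>k\<ge>N. \<forall>k'\<ge>N. dist (P n (G (r k) (real l / 2 ^ n))) (P n (G (r k') (real l / 2 ^ n))) < \<delta> / 4"
      if "l \<le> 2 ^ n" for l
      by (rule metric_CauchyD[OF convP[OF that]]) (use \<delta> in simp)
    then obtain N where N: "\<And>l k k'. l \<le> 2 ^ n \<Longrightarrow> k \<ge> N l \<Longrightarrow> k' \<ge> N l \<Longrightarrow>
        dist (P n (G (r k) (real l / 2 ^ n))) (P n (G (r k') (real l / 2 ^ n))) < \<delta> / 4"
      by metis
    define N0 where "N0 = (\<Sum>l\<le>2 ^ n. N l)"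
    have N0: "N l \<le> N0" if "l \<le> 2 ^ n" for l
      unfolding N0_def using that by (intro member_le_sum) auto
    have "dist (G (r k) t) (G (r k') t) < \<delta>" if k: "k \<ge> N0" "k' \<ge> N0" and t: "t \<in> {0..1}" for k k' t
    proof -
      obtain l where l: "l < 2 ^ n" "real l / 2 ^ n \<le> t" "t \<le> real (Suc l) / 2 ^ n"
        using exists_dyadic_cell[OF t] .
      let ?D = "\<lambda>s. P n (G (r k) s) - P n (G (r k') s)"
      have "norm (0 - ?D (real i / 2 ^ n)) \<le> \<delta> / 4" if "i \<le> 2 ^ n" for i
        using N[OF that, of k k'] N0[OF that] k by (simp add: dist_norm norm_minus_commute)
      then have "norm (0 - polygon n ?D t) \<le> \<delta> / 4"
        using l(1) by (intro norm_polygon_diff_le[OF l]) (auto simp del: of_nat_Suc)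
      moreover have "polygon n ?D t = proj n (G (r k)) t - proj n (G (r k')) t"
      proof -
        have "incr n i ?D = P n (incr n i (G (r k))) - P n (incr n i (G (r k')))" for i
          by (simp add: incr_def P.diff)
        then show ?thesis
          by (simp add: polygon_def proj_def P.add P.sum P.scaleR scaleR_diff_right sum_subtractf)
      qed
      ultimately have 1: "norm (proj n (G (r k)) t - proj n (G (r k')) t) \<le> \<delta> / 4"
        by (simp add: norm_minus_commute)
      have "dist (G (r k) t) (G (r k') t) \<le> norm (G (r k) t - proj n (G (r k)) t)
          + norm (proj n (G (r k)) t - proj n (G (r k')) t) + norm (G (r k') t - proj n (G (r k')) t)"
        unfolding dist_norm
        using norm_triangle_ineq4[of "G (r k) t - proj n (G (r k)) t + (proj n (G (r k)) t - proj n (G (r k')) t)" "G (r k') t - proj n (G (r k')) t"]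
          norm_triangle_ineq[of "G (r k) t - proj n (G (r k)) t" "proj n (G (r k)) t - proj n (G (r k')) t"]
        by simp
      then show ?thesis using 1 err[OF t, of "r k"] err[OF t, of "r k'"] \<delta> by linarith
    qed
    then show ?thesis by blast
  qed
  have "uniformly_convergent_on {0..1} (\<lambda>k. G (r k))"
    unfolding uniformly_convergent_eq_Cauchy uniformly_Cauchy_on_def using uCauchy by blast
  then obtain F0 where F0: "uniform_limit {0..1} (\<lambda>k. G (r k)) F0 sequentially"
    by (auto simp: uniformly_convergent_on_def)
  define F where "F = restrict F0 {0..1}"
  have "continuous_on {0..1} F0"
    by (rule uniform_limit_theorem[OF always_eventually F0]) (simp_all add: continuous_on_paths G)
  then have F: "F \<in> paths" unfolding F_def by (rule restrict_in_paths)
  have lim: "\<exists>N. \<forall>k\<ge>N. \<forall>t\<in>{0..1}. dist (G (r k) t) (F t) \<le> \<delta>" if "\<delta> > 0" for \<delta>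
    using uniform_limitD[OF F0 that] unfolding eventually_sequentially F_def
    by (auto intro: less_imp_le) 
  have "F \<in> {x \<in> topspace path_space. wiener_rate Q x \<le> ennreal C}"
  proof (rule closedin_path_spaceD[OF _ F])
    show "closedin path_space {x \<in> topspace path_space. wiener_rate Q x \<le> ennreal C}"
      using rate_function_wiener_rate C(1) unfolding rate_function_def by blast
    fix \<delta> :: real assume "\<delta> > 0"
    then obtain N where "\<forall>t\<in>{0..1}. dist (G (r N) t) (F t) \<le> \<delta>" using lim by blast
    then show "\<exists>H\<in>{x \<in> topspace path_space. wiener_rate Q x \<le> ennreal C}. \<forall>t\<in>{0..1}. dist (F t) (H t) \<le> \<delta>"
      using G C(2) by (intro bexI[of _ "G (r N)"]) (auto simp: topspace_path_space dist_commute)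
  qed
  then show ?thesis using that[OF r(1) F] lim by blast
qed

text \<open>Otherwise paths of rate at most L approach A, and by compactness a limit in A has rate
  at most L. The gap matters because the projection of a path in A is only near A.\<close>

lemma rate_gap:
  assumes A: "closedin path_space A" and L: "0 \<le> L" "ennreal L < (INF F\<in>A. wiener_rate Q F)"
  obtains \<delta> where "\<delta> > 0"
    "\<And>F G. F \<in> A \<Longrightarrow> G \<in> paths \<Longrightarrow> \<forall>t\<in>{0..1}. dist (F t) (G t) \<le> \<delta> \<Longrightarrow> ennreal L < wiener_rate Q G"
proof (rule ccontr)
  note gap = that
  assume no: "\<not> thesis"
  have "\<exists>F\<in>A. \<exists>G\<in>paths. (\<forall>t\<in>{0..1}. dist (F t) (G t) \<le> \<delta>) \<and> wiener_rate Q G \<le> ennreal L" if "\<delta> > 0" for \<delta>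
    using gap[OF that] no by (meson not_le)
  then have "\<exists>F\<in>A. \<exists>G\<in>paths. (\<forall>t\<in>{0..1}. dist (F t) (G t) \<le> (1/2) ^ k) \<and> wiener_rate Q G \<le> ennreal L" for k :: nat
    by simp
  then obtain F G :: "nat \<Rightarrow> real \<Rightarrow> 'h" where FG: "\<And>k. F k \<in> A" "\<And>k. G k \<in> paths"
    "\<And>k t. t \<in> {0..1} \<Longrightarrow> dist (F k t) (G k t) \<le> (1/2) ^ k" "\<And>k. wiener_rate Q (G k) \<le> ennreal L"
    unfolding Bex_def by metis
  obtain r :: "nat \<Rightarrow> nat" and H where r: "strict_mono r" and H: "H \<in> paths" "wiener_rate Q H \<le> ennreal L"
    and lim: "\<forall>\<delta>>0. \<exists>N. \<forall>k\<ge>N. \<forall>t\<in>{0..1}. dist (G (r k) t) (H t) \<le> \<delta>"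
    by (rule level_set_subsequence[of G L, OF FG(2) L(1) FG(4)])
  have "H \<in> A"
  proof (rule closedin_path_spaceD[OF A H(1)])
    fix \<delta> :: real assume \<delta>: "\<delta> > 0"
    then obtain N where "\<forall>k\<ge>N. \<forall>t\<in>{0..1}. dist (G (r k) t) (H t) \<le> \<delta> / 2"
      using lim half_gt_zero by blast
    then have N: "dist (G (r k) t) (H t) \<le> \<delta> / 2" if "k \<ge> N" "t \<in> {0..1}" for k t
      using that by blast
    obtain N' where N': "(1/2) ^ N' < \<delta> / 2"
      using \<delta> real_arch_pow_inv[of "\<delta> / 2" "1/2"] by auto
    define k where "k = max N N'"
    have "r k \<ge> N'" using seq_suble[OF r, of k] by (simp add: k_def)
    then have small: "(1/2) ^ r k \<le> (1/2::real) ^ N'" by (simp add: power_decreasing)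
    have "dist (H t) (F (r k) t) \<le> \<delta>" if t: "t \<in> {0..1}" for t
    proof -
      have "dist (H t) (F (r k) t) \<le> dist (G (r k) t) (H t) + dist (F (r k) t) (G (r k) t)"
        by (metis dist_commute dist_triangle add.commute)
      moreover have "k \<ge> N" by (simp add: k_def)
      ultimately show ?thesis using N[OF \<open>k \<ge> N\<close> t] FG(3)[OF t, of "r k"] small N' by linarith
    qed
    then show "\<exists>F\<in>A. \<forall>t\<in>{0..1}. dist (H t) (F t) \<le> \<delta>" using FG(1) by blast
  qed
  then have "(INF F\<in>A. wiener_rate Q F) \<le> ennreal L"
    using H(2) by (meson INF_lower2)
  with L(2) show False by simp
qed

end

section \<open>The large deviation bounds\<close>

context wiener_basis
begin

lemma measurable_coord [measurable]: "(\<lambda>\<omega>. coord n i (sample \<omega>)) \<in> borel_measurable M"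
proof (cases "i \<in> coords n")
  case True
  then have [measurable]: "(\<lambda>\<omega>. incr n (fst i) (sample \<omega>)) \<in> borel_measurable M"
    by (intro measurable_incr) (auto simp: coords_def)
  show ?thesis using True by (simp add: coord_def)
qed (simp add: coord_def)

text \<open>The coordinates behave as independent Gaussians; the variance factor is 1, or 0 where
  \<open>h j\<close> vanishes.\<close>

lemma mgf_coord:
  "(\<integral>\<^sup>+\<omega>. ennreal (exp (\<Sum>i\<in>coords n. y i * coord n i (sample \<omega>))) \<partial>M)
    = ennreal (exp ((\<Sum>i\<in>coords n. (y i)\<^sup>2 * (Q (h (snd i)) \<bullet> h (snd i))) / 2))"
proof -
  define g where "g k = (\<Sum>j<n. (y (k, j) * sqrt (2 ^ n)) *\<^sub>R h j)" for k
  have "(\<Sum>i\<in>coords n. y i * coord n i F) = (\<Sum>(k, j)\<in>coords n. y (k, j) * sqrt (2 ^ n) * (h j \<bullet> incr n k F))" for F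
    by (intro sum.cong) (auto simp: coord_def)
  then have lin: "(\<Sum>i\<in>coords n. y i * coord n i F) = (\<Sum>k<2^n. g k \<bullet> incr n k F)" for F
    by (simp add: coords_def g_def inner_sum_left flip: sum.cartesian_product)
  have Qg: "Q (g k) \<bullet> g k = 2 ^ n * (\<Sum>j<n. (y (k, j))\<^sup>2 * (Q (h j) \<bullet> h j))" for k
  proof -
    have "Q (g k) \<bullet> g k = (\<Sum>j<n. (y (k, j) * sqrt (2 ^ n)) * (Q (h j) \<bullet> g k))"
      by (subst (1) g_def) (simp add: Q.sum Q.scaleR inner_sum_left)
    also have "\<dots> = (\<Sum>j<n. 2 ^ n * ((y (k, j))\<^sup>2 * (Q (h j) \<bullet> h j)))"
    proof (intro sum.cong refl)
      fix j assume j: "j \<in> {..<n}"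
      have "Q (h j) \<bullet> g k = (\<Sum>i<n. if i = j then y (k, j) * sqrt (2 ^ n) * (Q (h j) \<bullet> h j) else 0)"
        unfolding g_def inner_sum_right by (intro sum.cong) (auto simp: Q_h_orthogonal)
      then have "Q (h j) \<bullet> g k = y (k, j) * sqrt (2 ^ n) * (Q (h j) \<bullet> h j)" using j by simp
      moreover have "sqrt (2 ^ n) * sqrt (2 ^ n) = (2::real) ^ n" by simp
      ultimately show "(y (k, j) * sqrt (2 ^ n)) * (Q (h j) \<bullet> g k) = 2 ^ n * ((y (k, j))\<^sup>2 * (Q (h j) \<bullet> h j))"
        by (simp add: power2_eq_square mult_ac)
    qed
    finally show ?thesis by (simp add: sum_distrib_left)
  qed
  have "(\<Sum>k<2^n. Q (g k) \<bullet> g k) / 2 ^ n = (\<Sum>i\<in>coords n. (y i)\<^sup>2 * (Q (h (snd i)) \<bullet> h (snd i)))"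
    unfolding Qg
    by (simp add: coords_def sum.cartesian_product case_prod_beta flip: sum_distrib_left)
  then show ?thesis unfolding lin mgf_sum_incr by simp
qed

text \<open>A sum of Gaussian squares has exponential moments only below the critical constant,
  whence c < 1. The prefactor depends on n and c but not on \<epsilon>.\<close>

lemma energy_tail:
  assumes c: "0 < c" "c < 1" and \<epsilon>: "0 < \<epsilon>"
  shows "prob {\<omega>\<in>space M. \<epsilon> * energy n (sample \<omega>) / 2 \<ge> L}
    \<le> (1 / sqrt (1 - c)) ^ card (coords n) * exp (- (c * L) / \<epsilon>)"
proof -
  have [measurable]: "(\<lambda>\<omega>. energy n (sample \<omega>)) \<in> borel_measurable M"
    unfolding sum_coord_sq[symmetric] by measurable
  have "(\<integral>\<^sup>+\<omega>. ennreal (exp (c / 2 * (\<Sum>i\<in>coords n. (coord n i (sample \<omega>))\<^sup>2))) \<partial>M)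
      \<le> ennreal ((1 / sqrt (1 - c)) ^ card (coords n))"
  proof (rule nn_integral_exp_sum_squares[OF finite_coords])
    fix y :: "nat \<times> nat \<Rightarrow> real"
    have "(\<Sum>i\<in>coords n. (y i)\<^sup>2 * (Q (h (snd i)) \<bullet> h (snd i))) \<le> (\<Sum>i\<in>coords n. (y i)\<^sup>2)"
      using h_self_le_1 by (intro sum_mono mult_left_le) auto
    then show "(\<integral>\<^sup>+\<omega>. ennreal (exp (\<Sum>i\<in>coords n. y i * coord n i (sample \<omega>))) \<partial>M)
        \<le> ennreal (exp ((\<Sum>i\<in>coords n. (y i)\<^sup>2) / 2))"
      unfolding mgf_coord by (intro ennreal_leI) simp
  qed (use c in auto)
  then have "prob {\<omega>\<in>space M. c / 2 * energy n (sample \<omega>) \<ge> c * L / \<epsilon>}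
      \<le> (1 / sqrt (1 - c)) ^ card (coords n) * exp (- (c * L / \<epsilon>))"
    unfolding sum_coord_sq using c by (intro nn_integral_Chernoff) auto
  moreover have "c / 2 * x \<ge> c * L / \<epsilon> \<longleftrightarrow> \<epsilon> * x / 2 \<ge> L" for x
  proof -
    have "c / 2 * x \<ge> c * L / \<epsilon> \<longleftrightarrow> c * (L / \<epsilon>) \<le> c * (x / 2)" by simp
    also have "\<dots> \<longleftrightarrow> L / \<epsilon> \<le> x / 2" by (rule mult_le_cancel_left_pos[OF c(1)])
    also have "\<dots> \<longleftrightarrow> L \<le> \<epsilon> * x / 2" using \<epsilon> by (simp add: pos_divide_le_eq mult.commute)
    finally show ?thesis .
  qed
  ultimately show ?thesis by simp
qed

abbreviation scaled :: "real \<Rightarrow> 'w \<Rightarrow> real \<Rightarrow> 'h" where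
  "scaled \<epsilon> \<omega> \<equiv> (\<lambda>t\<in>{0..1}. sqrt \<epsilon> *\<^sub>R W t \<omega>)"

lemma measurable_scaled: "scaled \<epsilon> \<in> M \<rightarrow>\<^sub>M borel_of path_space"
proof (rule measurable_path_map)
  show "(\<lambda>\<omega>. sqrt \<epsilon> *\<^sub>R W t \<omega>) \<in> borel_measurable M" if "t \<in> {0..1}" for t
    using measurable_W[OF that] by measurable
  show "continuous_on {0..1} (\<lambda>t. sqrt \<epsilon> *\<^sub>R W t \<omega>)" if "\<omega> \<in> space M" for \<omega>
    by (intro continuous_intros continuous_W that)
qed

lemma scaled_in_paths: "\<omega> \<in> space M \<Longrightarrow> scaled \<epsilon> \<omega> \<in> paths"
  by (intro restrict_in_paths continuous_intros continuous_W)

lemma measure_scaled_law: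
  "A \<in> sets (borel_of path_space) \<Longrightarrow> measure (scaled_law M W \<epsilon>) A = prob (scaled \<epsilon> -` A \<inter> space M)"
  unfolding scaled_law_def by (rule measure_distr[OF measurable_scaled])

text \<open>The level n is fixed by the gap \<delta> and the residual rate before \<epsilon> tends
  to 0, so its prefactors disappear in the limit.\<close>

lemma upper_bound_aux:
  assumes A: "closedin path_space A" and L: "0 \<le> L" "ennreal L < (INF F\<in>A. wiener_rate Q F)"
    and c: "0 < c" "c < 1"
  shows "Limsup (at_right 0) (\<lambda>\<epsilon>. ereal \<epsilon> * log_prob (measure (scaled_law M W \<epsilon>) A)) \<le> ereal (- (c * L))"
proof -
  obtain \<delta> where \<delta>: "\<delta> > 0"
    "\<And>F G. F \<in> A \<Longrightarrow> G \<in> paths \<Longrightarrow> \<forall>t\<in>{0..1}. dist (F t) (G t) \<le> \<delta> \<Longrightarrow> ennreal L < wiener_rate Q G"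
    using rate_gap[OF A L] by blast
  \<comment> \<open>The residual rate must be positive and at least \<open>c * L\<close>;
    \<open>L + 1\<close> also serves L = 0.\<close>
  have "0 < L + 1" using L(1) by simp
  from residual_exponentially_small[OF \<delta>(1) this]
  obtain n B where B: "B > 0" and Bad: "\<And>\<epsilon>. \<epsilon> \<in> {0<..1} \<Longrightarrow> \<exists>Bad\<in>sets M. prob Bad \<le> B * exp (- (L + 1) / \<epsilon>) \<and>
    (\<forall>\<omega>\<in>space M - Bad. \<forall>t\<in>{0..1}. norm (sqrt \<epsilon> *\<^sub>R W t \<omega> - sqrt \<epsilon> *\<^sub>R proj n (sample \<omega>) t) \<le> \<delta>)"
    by (meson order_refl)
  define B' where "B' = B + (1 / sqrt (1 - c)) ^ card (coords n)"
  have B': "B' > 0" unfolding B'_def using B c by (intro add_pos_nonneg) auto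
  have le: "measure (scaled_law M W \<epsilon>) A \<le> B' * exp (- (c * L) / \<epsilon>)" if \<epsilon>: "\<epsilon> \<in> {0<..1}" for \<epsilon>
  proof -
    obtain N where N: "N \<in> sets M" "prob N \<le> B * exp (- (L + 1) / \<epsilon>)"
      "\<And>\<omega> t. \<omega> \<in> space M - N \<Longrightarrow> t \<in> {0..1} \<Longrightarrow> norm (sqrt \<epsilon> *\<^sub>R W t \<omega> - sqrt \<epsilon> *\<^sub>R proj n (sample \<omega>) t) \<le> \<delta>"
      using Bad[OF \<epsilon>] by blast
    have [measurable]: "(\<lambda>\<omega>. energy n (sample \<omega>)) \<in> borel_measurable M"
      unfolding sum_coord_sq[symmetric] by measurable
    define E where "E = {\<omega>\<in>space M. \<epsilon> * energy n (sample \<omega>) / 2 \<ge> L}"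
    have E: "E \<in> sets M" unfolding E_def by measurable
    \<comment> \<open>Off N the projection is \<delta>-close to a path in A, hence has rate above L,
      while its rate is at most half its energy.\<close>
    have "scaled \<epsilon> -` A \<inter> space M \<subseteq> N \<union> E"
    proof
      fix \<omega> assume \<omega>: "\<omega> \<in> scaled \<epsilon> -` A \<inter> space M"
      show "\<omega> \<in> N \<union> E"
      proof (cases "\<omega> \<in> N")
        case False
        let ?F = "\<lambda>t. sqrt \<epsilon> *\<^sub>R W t \<omega>"
        let ?G = "restrict (proj n ?F) {0..1}"
        have "ennreal L < wiener_rate Q ?G"
        proof (rule \<delta>(2))
          show "scaled \<epsilon> \<omega> \<in> A" using \<omega> by simp
          show "?G \<in> paths" by (intro restrict_in_paths continuous_on_proj)
          show "\<forall>t\<in>{0..1}. dist (scaled \<epsilon> \<omega> t) (?G t) \<le> \<delta>"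
            using N(3)[of \<omega>] \<omega> False by (simp add: dist_norm proj_scaleR)
        qed
        also have "wiener_rate Q ?G = wiener_rate Q (proj n ?F)" by (rule wiener_rate_cong) simp
        also have "\<dots> \<le> ennreal (energy n ?F / 2)"
          using \<omega> W_0 by (intro wiener_rate_proj_le) simp
        also have "energy n ?F = \<epsilon> * energy n (sample \<omega>)"
          using \<epsilon> by (simp add: energy_def incr_scaleR power_mult_distrib sum_distrib_left mult_ac)
        finally have "L \<le> \<epsilon> * energy n (sample \<omega>) / 2"
          using L(1) by (simp add: ennreal_less_iff)
        then show ?thesis using \<omega> by (simp add: E_def)
      qed simp
    qed
    then have "prob (scaled \<epsilon> -` A \<inter> space M) \<le> prob (N \<union> E)"
      using N(1) E by (intro finite_measure_mono) auto
    also have "\<dots> \<le> prob N + prob E" by (rule measure_Un_le[OF N(1) E])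
    also have "\<dots> \<le> B * exp (- (L + 1) / \<epsilon>) + (1 / sqrt (1 - c)) ^ card (coords n) * exp (- (c * L) / \<epsilon>)"
      unfolding E_def using energy_tail[OF c, where \<epsilon> = \<epsilon> and n = n and L = L] \<epsilon> N(2) by (intro add_mono) auto
    also have "\<dots> \<le> B * exp (- (c * L) / \<epsilon>) + (1 / sqrt (1 - c)) ^ card (coords n) * exp (- (c * L) / \<epsilon>)"
    proof -
      have "c * L \<le> 1 * L" using c L(1) by (intro mult_right_mono) auto
      then have "- (L + 1) / \<epsilon> \<le> - (c * L) / \<epsilon>" using \<epsilon> by (intro divide_right_mono) auto
      then show ?thesis using B by (intro add_right_mono mult_left_mono) auto
    qed
    finally show ?thesis
      unfolding measure_scaled_law[OF sets_borel_of_closedin[OF A]] by (simp add: B'_def algebra_simps)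
  qed
  have "\<forall>\<^sub>F \<epsilon> in at_right (0::real). \<epsilon> \<in> {0<..1}"
    unfolding eventually_at_right_field by (intro exI[of _ 1]) auto
  then have "\<forall>\<^sub>F \<epsilon> in at_right 0. measure (scaled_law M W \<epsilon>) A \<le> B' * exp (- (c * L) / \<epsilon>)"
    by (rule eventually_mono) (rule le)
  then show ?thesis by (rule Limsup_log_prob_le[OF B' measure_nonneg])
qed

text \<open>The constant c is sent to 1 only after the limit in \<epsilon>. Working with a real z
  strictly below the infimum covers an infinite infimum as well.\<close>

lemma upper_bound:
  assumes A: "closedin path_space A"
  shows "Limsup (at_right 0) (\<lambda>\<epsilon>. ereal \<epsilon> * log_prob (measure (scaled_law M W \<epsilon>) A))
    \<le> - enn2ereal (INF F\<in>A. wiener_rate Q F)" (is "?l \<le> - enn2ereal ?I")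
proof (rule ccontr)
  assume "\<not> ?l \<le> - enn2ereal ?I"
  then have "- ?l < enn2ereal ?I" by (metis ereal_uminus_less_reorder not_le)
  then obtain z where z: "- ?l < ereal z" "ereal z < enn2ereal ?I"
    using ereal_dense2 by blast
  \<comment> \<open>This makes z positive, so that it can be compared with the rate as an extended
    nonnegative real.\<close>
  have l0: "?l \<le> 0"
  proof -
    have "\<forall>\<^sub>F \<epsilon> in at_right 0. ereal \<epsilon> * log_prob (measure (scaled_law M W \<epsilon>) A) \<le> 0"
    proof (rule eventually_mono[OF eventually_at_right_less])
      fix \<epsilon> :: real assume "0 < \<epsilon>"
      then show "ereal \<epsilon> * log_prob (measure (scaled_law M W \<epsilon>) A) \<le> 0"
        unfolding measure_scaled_law[OF sets_borel_of_closedin[OF A]] by (intro log_prob_nonpos) auto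
    qed
    then show ?thesis by (rule Limsup_bounded)
  qed
  then have "0 \<le> - ?l" by simp
  then have zpos: "z > 0" using z(1) by (metis ereal_less(2) le_less_trans)
  have zI: "ennreal z < ?I"
    using z(2) zpos by (metis enn2ereal_ennreal less_ennreal.rep_eq less_imp_le)
  have up: "?l \<le> ereal (- (c * z))" if "0 < c" "c < 1" for c
    using upper_bound_aux[OF A _ zI that] zpos by simp
  \<comment> \<open>The choice c = 1 - 1 / (n + 2) lies strictly between 0 and 1 for all n.\<close>
  have le: "?l \<le> ereal (- ((1 - inverse (real (Suc (Suc n)))) * z))" for n
    by (rule up) (auto simp: field_simps)
  have "(\<lambda>n. inverse (real (Suc (Suc n)))) \<longlonglongrightarrow> 0"
    by (rule LIMSEQ_Suc[OF LIMSEQ_inverse_real_of_nat])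
  then have "(\<lambda>n. - ((1 - inverse (real (Suc (Suc n)))) * z)) \<longlonglongrightarrow> - ((1 - 0) * z)"
    by (intro tendsto_intros)
  then have lim: "(\<lambda>n. ereal (- ((1 - inverse (real (Suc (Suc n)))) * z))) \<longlonglongrightarrow> ereal (- z)"
    by simp
  have "?l \<le> ereal (- z)" by (rule LIMSEQ_le_const[OF lim]) (use le in blast)
  then have "- ereal (- z) \<le> - ?l" by (simp only: ereal_minus_le_minus)
  then have "ereal z \<le> - ?l" by simp
  with z(1) show False by simp
qed

text \<open>The distance \<delta> is split in three: projection error of F, distance of the two
  projections, projection error of the process. Only the middle one carries the cost, through
  finitely many Gaussian coordinates.\<close>

lemma lower_bound_aux:
  assumes G: "openin path_space G" and F: "F \<in> G" and C: "0 \<le> C" "wiener_rate Q F \<le> ennreal C" and \<eta>: "\<eta> > 0"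
  shows "Liminf (at_right 0) (\<lambda>\<epsilon>. ereal \<epsilon> * log_prob (measure (scaled_law M W \<epsilon>) G)) \<ge> ereal (- (C + \<eta>))"
proof -
  have Fp: "F \<in> paths" using F G by (metis openin_subset subsetD topspace_path_space)
  obtain \<delta> where \<delta>: "\<delta> > 0" "\<And>H. H \<in> paths \<Longrightarrow> \<forall>t\<in>{0..1}. dist (F t) (H t) \<le> \<delta> \<Longrightarrow> H \<in> G"
    using G F unfolding openin_path_space by blast
  have E: "has_energy F (2 * C + 1)" by (rule has_energy_if_wiener_rate_le[OF C(2,1)]) simp
  have en: "F 0 = 0" "\<And>n. energy n F \<le> 2 * C"
    using wiener_rate_le_iff[OF continuous_on_paths[OF Fp] C(1)] C(2) by auto
  \<comment> \<open>The residual rate exceeds the target rate by 1, which makes the exceptional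
    event negligible.\<close>
  obtain n0 where n0: "\<And>n. n \<ge> n0 \<Longrightarrow> \<exists>B>0. \<forall>\<epsilon>\<in>{0<..1}. \<exists>Bad\<in>sets M. prob Bad \<le> B * exp (- (C + \<eta> + 1) / \<epsilon>) \<and>
    (\<forall>\<omega>\<in>space M - Bad. \<forall>t\<in>{0..1}. norm (sqrt \<epsilon> *\<^sub>R W t \<omega> - sqrt \<epsilon> *\<^sub>R proj n (sample \<omega>) t) \<le> \<delta> / 3)"
    using residual_exponentially_small[of "\<delta> / 3" "C + \<eta> + 1"] \<delta>(1) C(1) \<eta> by auto
  have "\<forall>\<^sub>F n in sequentially. sqrt ((2 * C + 1) * tail_trace 0 / 2 ^ n) + sqrt ((2 * C + 1) * tail_trace n) < \<delta> / 3"
    by (rule order_tendstoD[OF proj_error_tendsto_0]) (use \<delta> in simp)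
  then obtain n1 where n1: "\<And>n. n \<ge> n1 \<Longrightarrow> sqrt ((2 * C + 1) * tail_trace 0 / 2 ^ n) + sqrt ((2 * C + 1) * tail_trace n) < \<delta> / 3"
    unfolding eventually_sequentially by blast
  define n where "n = max n0 n1"
  have Fproj: "norm (F t - proj n F t) \<le> \<delta> / 3" if "t \<in> {0..1}" for t
    using has_energy_norm_diff_proj[OF E that, of n] n1[of n] by (simp add: n_def)
  obtain B where B: "B > 0" and Bad: "\<And>\<epsilon>. \<epsilon> \<in> {0<..1} \<Longrightarrow> \<exists>Bad\<in>sets M. prob Bad \<le> B * exp (- (C + \<eta> + 1) / \<epsilon>) \<and>
    (\<forall>\<omega>\<in>space M - Bad. \<forall>t\<in>{0..1}. norm (sqrt \<epsilon> *\<^sub>R W t \<omega> - sqrt \<epsilon> *\<^sub>R proj n (sample \<omega>) t) \<le> \<delta> / 3)"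
    using n0[of n] by (auto simp: n_def)
  define S where "S = (\<Sum>i\<in>coords n. norm (Q (h (snd i))))"
  define A1 where "A1 = (\<Sum>i\<in>coords n. \<bar>coord n i F\<bar>)"
  have S0: "S \<ge> 0" "A1 \<ge> 0" unfolding S_def A1_def by (auto intro: sum_nonneg)
  \<comment> \<open>The first term keeps the projections within \<delta> / 3, the second keeps the
    linear cost \<open>d * A1\<close> of the tilt below \<eta>; the added 1 guards against S = 0 and
    A1 = 0.\<close>
  define d where "d = min (\<delta> / (3 * (S + 1))) (\<eta> / (A1 + 1))"
  have d0: "d > 0" unfolding d_def using \<delta> \<eta> S0 by auto
  have dS: "d * S \<le> \<delta> / 3"
  proof -
    have "d * S \<le> \<delta> / (3 * (S + 1)) * (S + 1)" using S0 \<delta> by (intro mult_mono) (auto simp: d_def)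
    also have "\<dots> = \<delta> / 3"
    proof -
      have "x / (3 * s) * s = x / 3" if "s > 0" for x s :: real using that by (simp add: field_simps)
      from this[of "S + 1" \<delta>] show ?thesis using S0 by (simp only: add_nonneg_pos zero_less_one)
    qed
    finally show ?thesis .
  qed
  have dA: "d * A1 \<le> \<eta>"
  proof -
    have "d * A1 \<le> \<eta> / (A1 + 1) * (A1 + 1)" using S0 \<eta> by (intro mult_mono) (auto simp: d_def)
    also have "\<dots> = \<eta>" using S0 by simp
    finally show ?thesis .
  qed
  have pos: "\<forall>\<^sub>F \<epsilon> in at_right (0::real). \<epsilon> \<in> {0<..1}"
    unfolding eventually_at_right_field by (intro exI[of _ 1]) auto
  have exp0: "((\<lambda>\<epsilon>. exp (- a / \<epsilon>)) \<longlongrightarrow> 0) (at_right (0::real))" if "a > 0" for a :: real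
  proof -
    have "filterlim (\<lambda>\<epsilon>. a * inverse \<epsilon>) at_top (at_right (0::real))"
      by (rule filterlim_tendsto_pos_mult_at_top[OF tendsto_const that filterlim_inverse_at_top_right])
    then have "filterlim (\<lambda>\<epsilon>. - (a * inverse \<epsilon>)) at_bot (at_right (0::real))"
      by (simp add: filterlim_uminus_at_bot)
    then have "((\<lambda>\<epsilon>. exp (- (a * inverse \<epsilon>))) \<longlongrightarrow> 0) (at_right (0::real))"
      by (rule filterlim_compose[OF exp_at_bot])
    then show ?thesis by (simp add: divide_inverse)
  qed
  have ev1: "\<forall>\<^sub>F \<epsilon> in at_right 0. real (2 * card (coords n)) * exp (- d\<^sup>2 / (2 * \<epsilon>)) \<le> 1 / 2"
  proof -
    have "((\<lambda>\<epsilon>. real (2 * card (coords n)) * exp (- (d\<^sup>2 / 2) / \<epsilon>)) \<longlongrightarrow> real (2 * card (coords n)) * 0) (at_right 0)"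
      using d0 by (intro tendsto_mult_left exp0) auto
    then have "\<forall>\<^sub>F \<epsilon> in at_right 0. real (2 * card (coords n)) * exp (- (d\<^sup>2 / 2) / \<epsilon>) < 1 / 2"
      by (rule order_tendstoD) simp
    then show ?thesis by (rule eventually_mono) simp
  qed
  \<comment> \<open>The exceptional event may take a quarter, which leaves 1/2 - 1/4 of the
    exponential.\<close>
  have ev2: "\<forall>\<^sub>F \<epsilon> in at_right 0. B * exp (- 1 / \<epsilon>) \<le> 1 / 4"
  proof -
    have "((\<lambda>\<epsilon>. B * exp (- 1 / \<epsilon>)) \<longlongrightarrow> B * 0) (at_right 0)"
      by (intro tendsto_mult_left exp0) auto
    then have "\<forall>\<^sub>F \<epsilon> in at_right 0. B * exp (- 1 / \<epsilon>) < 1 / 4"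
      by (rule order_tendstoD) simp
    then show ?thesis by (rule eventually_mono) simp
  qed
  have "\<forall>\<^sub>F \<epsilon> in at_right 0. measure (scaled_law M W \<epsilon>) G \<ge> 1 / 4 * exp (- (C + \<eta>) / \<epsilon>)"
    using pos ev1 ev2
  proof eventually_elim
    case (elim \<epsilon>)
    then have \<epsilon>: "0 < \<epsilon>" "\<epsilon> \<le> 1" by auto
    obtain N where N: "N \<in> sets M" "prob N \<le> B * exp (- (C + \<eta> + 1) / \<epsilon>)"
      "\<And>\<omega> t. \<omega> \<in> space M - N \<Longrightarrow> t \<in> {0..1} \<Longrightarrow> norm (sqrt \<epsilon> *\<^sub>R W t \<omega> - sqrt \<epsilon> *\<^sub>R proj n (sample \<omega>) t) \<le> \<delta> / 3"
      using Bad[OF elim(1)] by blast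
    define good where "good = {\<omega>\<in>space M. \<forall>i\<in>coords n. \<bar>sqrt \<epsilon> * coord n i (sample \<omega>) - coord n i F\<bar> \<le> d}"
    have good: "good \<in> sets M" unfolding good_def using finite_coords by measurable
    have "prob good \<ge> 1 / 2 * exp (- ((\<Sum>i\<in>coords n. (coord n i F)\<^sup>2) / 2 + d * (\<Sum>i\<in>coords n. \<bar>coord n i F\<bar>)) / \<epsilon>)"
      unfolding good_def
    proof (rule gaussian_vector_lower_bound[OF finite_coords measurable_coord mgf_coord _ \<epsilon>(1) d0 elim(2)])
      fix i assume "i \<in> coords n"
      show "0 \<le> Q (h (snd i)) \<bullet> h (snd i) \<and> Q (h (snd i)) \<bullet> h (snd i) \<le> 1 \<and>
          Q (h (snd i)) \<bullet> h (snd i) * coord n i F = coord n i F"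
        using h_self_le_1[of "snd i"] h_coeff(1)[of "snd i"] by (simp add: coord_def mult.left_commute)
    qed
    moreover have "- (C + \<eta>) / \<epsilon> \<le> - ((\<Sum>i\<in>coords n. (coord n i F)\<^sup>2) / 2 + d * (\<Sum>i\<in>coords n. \<bar>coord n i F\<bar>)) / \<epsilon>"
      using dA en(2)[of n] \<epsilon> unfolding sum_coord_sq A1_def[symmetric] by (intro divide_right_mono) auto
    then have "exp (- (C + \<eta>) / \<epsilon>) \<le> exp (- ((\<Sum>i\<in>coords n. (coord n i F)\<^sup>2) / 2 + d * (\<Sum>i\<in>coords n. \<bar>coord n i F\<bar>)) / \<epsilon>)"
      by (simp only: exp_le_cancel_iff)
    ultimately have pg: "prob good \<ge> 1 / 2 * exp (- (C + \<eta>) / \<epsilon>)"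
      by linarith
    have sub: "good - N \<subseteq> scaled \<epsilon> -` G \<inter> space M"
    proof
      fix \<omega> assume \<omega>: "\<omega> \<in> good - N"
      then have sp: "\<omega> \<in> space M" by (simp add: good_def)
      have "dist (F t) (scaled \<epsilon> \<omega> t) \<le> \<delta>" if t: "t \<in> {0..1}" for t
      proof -
        let ?W = "\<lambda>t. sqrt \<epsilon> *\<^sub>R W t \<omega>"
        have "norm (proj n ?W t - proj n F t) \<le> d * S"
          unfolding S_def
        proof (rule norm_proj_diff_le)
          show "\<bar>coord n i ?W - coord n i F\<bar> \<le> d" if "i \<in> coords n" for i
            using \<omega> that by (simp add: good_def coord_def incr_scaleR mult.left_commute)
        qed (use W_0[OF sp] en(1) d0 in auto)
        then have 1: "norm (proj n ?W t - proj n F t) \<le> \<delta> / 3" using dS by linarith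
        have 2: "norm (?W t - proj n ?W t) \<le> \<delta> / 3"
          using N(3)[OF _ t, of \<omega>] \<omega> sp by (simp add: proj_scaleR)
        have "norm (F t - ?W t) \<le> norm (F t - proj n F t) + norm (proj n ?W t - proj n F t) + norm (?W t - proj n ?W t)"
          using norm_triangle_ineq4[of "(F t - proj n F t) - (proj n ?W t - proj n F t)" "?W t - proj n ?W t"]
            norm_triangle_ineq4[of "F t - proj n F t" "proj n ?W t - proj n F t"]
          by simp
        then show ?thesis using 1 2 Fproj[OF t] t by (simp add: dist_norm)
      qed
      then have "scaled \<epsilon> \<omega> \<in> G" by (intro \<delta>(2) scaled_in_paths sp) auto
      then show "\<omega> \<in> scaled \<epsilon> -` G \<inter> space M" using sp by simp
    qed
    have "prob good - prob N \<le> prob (good - N)"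
      using finite_measure_Diff'[OF good N(1)] finite_measure_mono[of "good \<inter> N" N] N(1) by simp
    also have "\<dots> \<le> prob (scaled \<epsilon> -` G \<inter> space M)"
      using sub measurable_sets[OF measurable_scaled sets_borel_of_openin[OF G]] by (intro finite_measure_mono)
    finally have 1: "prob good - prob N \<le> measure (scaled_law M W \<epsilon>) G"
      unfolding measure_scaled_law[OF sets_borel_of_openin[OF G]] .
    have "prob N \<le> exp (- (C + \<eta>) / \<epsilon>) * (B * exp (- 1 / \<epsilon>))"
    proof -
      have "- (C + \<eta> + 1) / \<epsilon> = - (C + \<eta>) / \<epsilon> + - 1 / \<epsilon>"
        by (simp only: add_divide_distrib[symmetric] minus_add_distrib)
      then show ?thesis using N(2) by (simp only: exp_add mult_ac)
    qed
    also have "\<dots> \<le> exp (- (C + \<eta>) / \<epsilon>) * (1 / 4)"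
      using elim(3) by (intro mult_left_mono) auto
    finally show ?case using 1 pg by linarith
  qed
  then show ?thesis by (intro Liminf_log_prob_ge[of "1/4"]) auto
qed

lemma lower_bound:
  assumes G: "openin path_space G"
  shows "- enn2ereal (INF F\<in>G. wiener_rate Q F)
    \<le> Liminf (at_right 0) (\<lambda>\<epsilon>. ereal \<epsilon> * log_prob (measure (scaled_law M W \<epsilon>) G))" (is "- enn2ereal ?I \<le> ?l")
proof (rule ccontr)
  assume "\<not> - enn2ereal ?I \<le> ?l"
  then have "enn2ereal ?I < - ?l" by (metis ereal_less_uminus_reorder not_le)
  then obtain z where z: "enn2ereal ?I < ereal z" "ereal z < - ?l"
    using ereal_dense2 by blast
  \<comment> \<open>Two reals above the infimum: y bounds the rate of some F in G, and z - y is the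
    slack \<eta>.\<close>
  obtain y where y: "enn2ereal ?I < ereal y" "ereal y < ereal z"
    using ereal_dense2[OF z(1)] by blast
  have y0: "0 < y" using y(1) enn2ereal_nonneg[of ?I] by (metis ereal_less(2) le_less_trans)
  have "?I < ennreal y" using y(1) y0 by (metis enn2ereal_ennreal less_ennreal.rep_eq less_imp_le)
  then obtain F where F: "F \<in> G" "wiener_rate Q F < ennreal y" unfolding INF_less_iff by blast
  have "ereal (- (y + (z - y))) \<le> ?l"
    using y y0 F by (intro lower_bound_aux[OF G F(1)]) auto
  then have "- ?l \<le> ereal z" by (metis ereal_uminus_le_reorder uminus_ereal.simps(1) add.commute diff_add_cancel)
  with z(2) show False by simp
qed

lemma large_deviation_principle_scaled_law:
  "large_deviation_principle path_space (scaled_law M W) (wiener_rate Q)"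
  unfolding large_deviation_principle_def
proof (intro conjI ballI allI impI)
  fix \<epsilon> :: real
  show "prob_space (scaled_law M W \<epsilon>)"
    unfolding scaled_law_def by (rule prob_space_distr[OF measurable_scaled])
  show "sets (scaled_law M W \<epsilon>) = sets (borel_of path_space)"
    by (simp add: scaled_law_def)
qed (simp_all add: Hausdorff_path_space rate_function_wiener_rate upper_bound lower_bound)

end

theorem theorem2:
  fixes Q :: "'h::{real_inner, banach, second_countable_topology} \<Rightarrow> 'h"
    and M :: "'w measure"
    and W :: "real \<Rightarrow> 'w \<Rightarrow> 'h"
  assumes "bounded_linear Q"
    and "self_adjoint Q"
    and "positive_operator Q"
    and "trace_class Q"
    and "Q_Wiener_process M Q W"
  shows "large_deviation_principle path_space (scaled_law M W) (wiener_rate Q)"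
proof -
  interpret covariance_operator Q by (rule covariance_operator.intro[OF assms(1-3)])
  obtain e where "covariance_basis Q e" using covariance_basis_exists[OF assms(4)] ..
  then interpret wiener_basis Q e M W
    using assms(5) by (simp add: wiener_basis_def)
  show ?thesis by (rule large_deviation_principle_scaled_law)
qed

end
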